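(* Let $d\ge1$ and let $X$ be the randomly trapped random walk on $\mathbb Z^d$ with step distribution $\nu$ and trap law $\mu$. Let $m_x=\int u\,\pi_x(du)\in(0,\infty]$. If $\nu\ne\delta_0$ and $\mathbb E[m_0]=M<\infty$, then the rescaled clock processes $S_N(t)=\frac1N S(\lfloor Nt\rfloor)$ converge in $\mathbb P$-distribution, as $N\to\infty$, on the space $D^1$ equipped with the Skorohod $J_1$-topology, to the linear process $\mathcal S(t)=Mt$. If in addition the random walk $Y$ is genuinely $d$-dimensional, $\nu$ is centred ($\mathbb E[Y(1)]=0$) and $\nu$ has finite range ($\mathbb P[|Y(1)|>C]=0$ for some $C<\infty$), and $\mathcal A$ is a $d\times d$ matrix such that $\frac1{\sqrt N}\mathcal AY(\lfloor Nt\rfloor)$ converges in distribution to a standard $d$-dimensional Brownian motion, then the processes $X_N(t)=\frac1{\sqrt N}\mathcal AX(Nt)$ converge in $\mathbb P$-distribution on $D^d$ equipped with the Skorohod $J_1$-topology to $\mathcal X(t)=B(M^{-1}t)$, where $B$ is a standard $d$-dimensional Brownian motion.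
   Context: Randomly trapped random walk (RTRW). Let $\nu$ be a probability measure on $\mathbb Z^d$, and let $\mu$ be a probability measure on the space of probability measures on $(0,\infty)$. On a probability space $(\Omega,\mathcal F,\mathbb P)$ let $\pi=(\pi_x)_{x\in\mathbb Z^d}$ be i.i.d. random probability measures with law $\mu$, and let $\xi=(\xi_i)_{i\ge1}$ be i.i.d. with law $\nu$, independent of $\pi$. Put $Y(0)=0$, $Y(n)=\xi_1+\dots+\xi_n$, and $L(x,n)=\sum_{k=0}^n\mathbf 1\{Y(k)=x\}$. Given $\pi$, let $(\tau_x^i)_{x\in\mathbb Z^d,i\ge1}$ be independent random variables, independent of $\xi$, such that $\tau_x^i$ has distribution $\pi_x$. The clock process is $S(0)=0$, $S(n)=\sum_{x\in\mathbb Z^d}\sum_{i=1}^{L(x,n-1)}\tau_x^i$ for $n\ge1$. The RTRW is $X(t)=Y(k)$ for $S(k)\le t<S(k+1)$. $\mathbb P$ is the annealed law (averaged over the environment $\pi$). $D^d$ is the space of cadlag $\mathbb R^d$-valued functions on $[0,\infty)$. "Genuinely $d$-dimensional" means that the subgroup of $\mathbb Z^d$ generated by $\{x:\nu(x)>0\}$ is $d$-dimensional. Under the additional hypotheses a matrix $\mathcal A$ as in the claim exists. *)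

theory Defs
  imports "HOL-Probability.Probability" "HOL-Computational_Algebra.Group_Closure"
begin

section \<open>Skorohod space\<close>

text \<open>Functions on the half-line are total functions on \<^typ>\<open>real\<close> restricted to \<open>{0..}\<close>.\<close>

definition skorohod_space :: "(real \<Rightarrow> 'a::metric_space) set" where
  "skorohod_space = {f \<in> extensional {0..}.
     (\<forall>t\<ge>0. (f \<longlongrightarrow> f t) (at_right t)) \<and> (\<forall>t>0. \<exists>l. (f \<longlongrightarrow> l) (at_left t))}"

definition time_change :: "(real \<Rightarrow> real) \<Rightarrow> bool" where
  "time_change l \<longleftrightarrow> continuous_on {0..} l \<and> strict_mono_on {0..} l \<and> l 0 = 0
     \<and> filterlim l at_top at_top"

definition J1_converges :: "(nat \<Rightarrow> real \<Rightarrow> 'a::metric_space) \<Rightarrow> (real \<Rightarrow> 'a) \<Rightarrow> bool" where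
  "J1_converges f g \<longleftrightarrow> (\<exists>l. (\<forall>n. time_change (l n))
     \<and> uniform_limit {0..} l (\<lambda>t. t) sequentially
     \<and> (\<forall>T. uniform_limit {0..T} (\<lambda>n t. f n (l n t)) g sequentially))"

text \<open>The Skorohod \<open>J\<^sub>1\<close> topology is the metrizable topology on the space of cadlag functions
  whose convergent sequences are the \<open>J\<^sub>1\<close>-convergent ones (Jacod--Shiryaev, Theorem VI.1.14).
  Being metrizable, it is determined by these: a set is open iff it is sequentially open.\<close>

definition J1_topology :: "(real \<Rightarrow> 'a::metric_space) topology" where
  "J1_topology = topology (\<lambda>U. U \<subseteq> skorohod_space \<and>
     (\<forall>g\<in>U. \<forall>f. range f \<subseteq> skorohod_space \<and> J1_converges f g
        \<longrightarrow> (\<forall>\<^sub>F n in sequentially. f n \<in> U)))"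

lemma openin_J1_topology:
  "openin J1_topology U \<longleftrightarrow> U \<subseteq> skorohod_space \<and>
     (\<forall>g\<in>U. \<forall>f. range f \<subseteq> skorohod_space \<and> J1_converges f g
        \<longrightarrow> (\<forall>\<^sub>F n in sequentially. f n \<in> U))"
proof -
  have "istopology (\<lambda>U :: (real \<Rightarrow> 'a) set. U \<subseteq> skorohod_space \<and>
     (\<forall>g\<in>U. \<forall>f. range f \<subseteq> skorohod_space \<and> J1_converges f g
        \<longrightarrow> (\<forall>\<^sub>F n in sequentially. f n \<in> U)))" (is "istopology ?O")
    unfolding istopology_def
  proof (rule conjI; intro allI impI)
    fix S T assume ST: "?O S" "?O T"
    then have "S \<inter> T \<subseteq> skorohod_space" by blast
    with ST show "?O (S \<inter> T)" unfolding Int_iff eventually_conj_iff by blast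
  next
    fix K assume K: "\<forall>S\<in>K. ?O S"
    have "\<forall>\<^sub>F n in sequentially. f n \<in> \<Union> K"
      if g: "g \<in> \<Union> K" and f: "range f \<subseteq> skorohod_space \<and> J1_converges f g" for g f
    proof -
      obtain S where S: "S \<in> K" "g \<in> S" using g by blast
      then have "\<forall>\<^sub>F n in sequentially. f n \<in> S" using K f by blast
      then show ?thesis by (rule eventually_mono) (use S in blast)
    qed
    moreover have "\<Union> K \<subseteq> skorohod_space" using K by blast
    ultimately show "?O (\<Union> K)" by blast
  qed
  then show ?thesis
    unfolding J1_topology_def by (simp add: topology_inverse')
qed

lemma topspace_J1_topology [simp]: "topspace J1_topology = skorohod_space"
proof -
  have "openin J1_topology skorohod_space"
    unfolding openin_J1_topology by (blast intro: always_eventually)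
  then show ?thesis
    by (metis openin_J1_topology openin_subset openin_topspace subset_antisym)
qed

section \<open>Convergence in distribution\<close>

definition borel_of :: "'a topology \<Rightarrow> 'a measure" where
  "borel_of T = sigma (topspace T) {U. openin T U}"

text \<open>Weak convergence of the laws of random elements of \<open>T\<close>. A random element needs to be
  defined only almost surely: \<open>Z'\<close> and \<open>Y'\<close> are measurable versions of \<open>Z\<close> and \<open>Y\<close>. (The paths of
  the processes considered below are cadlag only outside a null set.)\<close>

definition converges_in_distribution ::
  "'a topology \<Rightarrow> 'w measure \<Rightarrow> (nat \<Rightarrow> 'w \<Rightarrow> 'a) \<Rightarrow> 'v measure \<Rightarrow> ('v \<Rightarrow> 'a) \<Rightarrow> bool" where
  "converges_in_distribution T P Z W Y \<longleftrightarrow> (\<exists>Z' Y'.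
     (\<forall>n. Z' n \<in> P \<rightarrow>\<^sub>M borel_of T \<and> (AE \<omega> in P. Z' n \<omega> = Z n \<omega>)) \<and>
     Y' \<in> W \<rightarrow>\<^sub>M borel_of T \<and> (AE \<omega> in W. Y' \<omega> = Y \<omega>) \<and>
     (\<forall>F. continuous_map T euclideanreal F \<and> bounded (F ` topspace T) \<longrightarrow>
        (\<lambda>n. \<integral>\<omega>. F (Z' n \<omega>) \<partial>P) \<longlonglongrightarrow> (\<integral>\<omega>. F (Y' \<omega>) \<partial>W)))"

section \<open>Standard Brownian motion\<close>

locale standard_brownian_motion = prob_space W for W :: "'v measure" +
  fixes B :: "real \<Rightarrow> 'v \<Rightarrow> real ^ 'd"
  assumes measurable_B: "\<And>t. t \<ge> 0 \<Longrightarrow> B t \<in> borel_measurable W"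
    and start: "AE \<omega> in W. B 0 \<omega> = 0"
    and continuous_paths: "AE \<omega> in W. continuous_on {0..} (\<lambda>t. B t \<omega>)"
    and gaussian_increments: "\<And>s t. 0 \<le> s \<Longrightarrow> s < t \<Longrightarrow>
      distributed W lborel (\<lambda>\<omega>. B t \<omega> - B s \<omega>)
        (\<lambda>x. ennreal (\<Prod>i\<in>UNIV. normal_density 0 (sqrt (t - s)) (x $ i)))"
    and independent_increments: "\<And>(n::nat) t. 0 \<le> t 0 \<Longrightarrow> mono_on {..n} t \<Longrightarrow>
      indep_vars (\<lambda>_. borel) (\<lambda>k \<omega>. B (t (Suc k)) \<omega> - B (t k) \<omega>) {..<n}"

section \<open>Randomly trapped random walk\<close>

text \<open>The points of \<open>trap_space\<close> are the probability measures on \<open>{0<..}\<close>.\<close>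

definition trap_space :: "real measure measure" where
  "trap_space = prob_algebra (restrict_space borel {0<..})"

text \<open>Assumption \<open>traps\<close> states, in terms of the conditional expectation with respect to
  the sigma-algebra generated by \<open>\<pi>\<close>, that given \<open>\<pi>\<close> the \<open>\<tau> x i\<close> are independent, independent of \<open>\<xi>\<close>,
  and that \<open>\<tau> x i\<close> has distribution \<open>\<pi> x\<close>.\<close>

locale randomly_trapped_random_walk = prob_space P for P :: "'w measure" +
  fixes \<nu> :: "(int ^ 'd) pmf"
    and \<mu> :: "real measure measure"
    and \<pi> :: "int ^ 'd \<Rightarrow> 'w \<Rightarrow> real measure"
    and \<xi> :: "nat \<Rightarrow> 'w \<Rightarrow> int ^ 'd"
    and \<tau> :: "int ^ 'd \<Rightarrow> nat \<Rightarrow> 'w \<Rightarrow> real"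
  assumes trap_law: "\<mu> \<in> space (prob_algebra trap_space)"
    and environment_indep: "indep_vars (\<lambda>_. trap_space) \<pi> UNIV"
    and environment_distr: "\<And>x. distr P trap_space (\<pi> x) = \<mu>"
    and steps_indep: "indep_vars (\<lambda>_. count_space UNIV) \<xi> {1..}"
    and steps_distr: "\<And>i. i \<ge> 1 \<Longrightarrow> distr P (count_space UNIV) (\<xi> i) = measure_pmf \<nu>"
    and environment_steps_indep:
      "indep_set
         (sets (vimage_algebra (space P) (\<lambda>\<omega> x. \<pi> x \<omega>) (PiM UNIV (\<lambda>_. trap_space))))
         (sets (vimage_algebra (space P) (\<lambda>\<omega>. \<lambda>i\<in>{1..}. \<xi> i \<omega>) (PiM {1..} (\<lambda>_. count_space UNIV))))"
    and traps_measurable: "\<And>x i. i \<ge> 1 \<Longrightarrow> \<tau> x i \<in> P \<rightarrow>\<^sub>M restrict_space borel {0<..}"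
    and traps: "\<And>J A C. finite J \<Longrightarrow> J \<subseteq> UNIV \<times> {1..} \<Longrightarrow>
      (\<And>x i. (x, i) \<in> J \<Longrightarrow> A x i \<in> sets (restrict_space borel {0<..})) \<Longrightarrow>
      C \<in> sets (PiM {1..} (\<lambda>_. count_space UNIV)) \<Longrightarrow>
      AE \<omega> in P.
        real_cond_exp P (vimage_algebra (space P) (\<lambda>\<omega> x. \<pi> x \<omega>) (PiM UNIV (\<lambda>_. trap_space)))
          (indicator {\<omega> \<in> space P. (\<forall>(x, i)\<in>J. \<tau> x i \<omega> \<in> A x i) \<and> (\<lambda>i\<in>{1..}. \<xi> i \<omega>) \<in> C}) \<omega>
        = (\<Prod>(x, i)\<in>J. measure (\<pi> x \<omega>) (A x i))
            * measure P {\<omega> \<in> space P. (\<lambda>i\<in>{1..}. \<xi> i \<omega>) \<in> C}"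

definition walk :: "(nat \<Rightarrow> 'w \<Rightarrow> int ^ 'd) \<Rightarrow> nat \<Rightarrow> 'w \<Rightarrow> int ^ 'd" where
  "walk \<xi> n \<omega> = (\<Sum>k=1..n. \<xi> k \<omega>)"

definition local_time :: "(nat \<Rightarrow> 'w \<Rightarrow> int ^ 'd) \<Rightarrow> int ^ 'd \<Rightarrow> nat \<Rightarrow> 'w \<Rightarrow> nat" where
  "local_time \<xi> x n \<omega> = (\<Sum>k=0..n. if walk \<xi> k \<omega> = x then 1 else 0)"

text \<open>Only finitely many terms of the infinite sum are nonzero.\<close>

definition clock ::
  "(nat \<Rightarrow> 'w \<Rightarrow> int ^ 'd) \<Rightarrow> (int ^ 'd \<Rightarrow> nat \<Rightarrow> 'w \<Rightarrow> real) \<Rightarrow> nat \<Rightarrow> 'w \<Rightarrow> real" where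
  "clock \<xi> \<tau> n \<omega> = (if n = 0 then 0
     else (\<Sum>\<^sub>\<infinity>x\<in>UNIV. \<Sum>i=1..local_time \<xi> x (n - 1) \<omega>. \<tau> x i \<omega>))"

text \<open>The index \<open>k\<close> is unique because the clock is strictly increasing; it exists for all \<open>t \<ge> 0\<close>
  when the clock is unbounded, which holds almost surely.\<close>

definition rtrw ::
  "(nat \<Rightarrow> 'w \<Rightarrow> int ^ 'd) \<Rightarrow> (int ^ 'd \<Rightarrow> nat \<Rightarrow> 'w \<Rightarrow> real) \<Rightarrow> real \<Rightarrow> 'w \<Rightarrow> int ^ 'd" where
  "rtrw \<xi> \<tau> t \<omega> = walk \<xi> (THE k. clock \<xi> \<tau> k \<omega> \<le> t \<and> t < clock \<xi> \<tau> (Suc k) \<omega>) \<omega>"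

definition real_vec :: "int ^ 'd \<Rightarrow> real ^ 'd" where
  "real_vec x = (\<chi> i. real_of_int (x $ i))"

text \<open>The dimension of a subgroup of the integer lattice is its rank, which is the dimension of
  its real linear span.\<close>

definition genuinely_full_dimensional :: "(int ^ 'd) pmf \<Rightarrow> bool" where
  "genuinely_full_dimensional \<nu> \<longleftrightarrow>
     dim (real_vec ` group_closure {x. pmf \<nu> x > 0}) = CARD('d)"

definition scaled_clock ::
  "(nat \<Rightarrow> 'w \<Rightarrow> int ^ 'd) \<Rightarrow> (int ^ 'd \<Rightarrow> nat \<Rightarrow> 'w \<Rightarrow> real) \<Rightarrow> nat \<Rightarrow> 'w \<Rightarrow> real \<Rightarrow> real" where
  "scaled_clock \<xi> \<tau> N \<omega> = (\<lambda>t\<in>{0..}. 1 / real N * clock \<xi> \<tau> (nat \<lfloor>real N * t\<rfloor>) \<omega>)"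

definition scaled_walk ::
  "(nat \<Rightarrow> 'w \<Rightarrow> int ^ 'd) \<Rightarrow> real ^ 'd ^ 'd \<Rightarrow> nat \<Rightarrow> 'w \<Rightarrow> real \<Rightarrow> real ^ 'd" where
  "scaled_walk \<xi> A N \<omega> = (\<lambda>t\<in>{0..}.
     (1 / sqrt (real N)) *\<^sub>R (A *v real_vec (walk \<xi> (nat \<lfloor>real N * t\<rfloor>) \<omega>)))"

definition scaled_rtrw ::
  "(nat \<Rightarrow> 'w \<Rightarrow> int ^ 'd) \<Rightarrow> (int ^ 'd \<Rightarrow> nat \<Rightarrow> 'w \<Rightarrow> real) \<Rightarrow> real ^ 'd ^ 'd \<Rightarrow>
     nat \<Rightarrow> 'w \<Rightarrow> real \<Rightarrow> real ^ 'd" where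
  "scaled_rtrw \<xi> \<tau> A N \<omega> = (\<lambda>t\<in>{0..}.
     (1 / sqrt (real N)) *\<^sub>R (A *v real_vec (rtrw \<xi> \<tau> (real N * t) \<omega>)))"

end

theory Submission
  imports Defs
begin

text \<open>Group the clock by time instead of by site: \<open>S n\<close> is the sum over \<open>k < n\<close> of the sojourn times
  \<open>\<sigma>\<^sub>k\<close>, the trap variable used at the \<open>k\<close>-th step. Under the annealed law every \<open>\<sigma>\<^sub>k\<close> has the same
  distribution, of mean \<open>M\<close>, and \<open>\<sigma>\<^sub>j\<close>, \<open>\<sigma>\<^sub>k\<close> are independent given that \<open>Y j \<noteq> Y k\<close>, because the
  environment is i.i.d. As \<open>\<nu> \<noteq> \<delta>\<^sub>0\<close>, the probability of \<open>Y j = Y k\<close> vanishes as \<open>\<bar>j - k\<bar> \<rightarrow> \<infinity>\<close>, so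
  truncation and a second moment bound give \<open>S n / n \<rightarrow> M\<close> in \<open>L\<^sup>1\<close>; monotonicity upgrades this to
  locally uniform convergence in probability. The walk itself is \<open>Y\<close> run along the inverse clock, which
  is therefore close to \<open>t / M\<close>; since Brownian paths are continuous, a random time change that
  converges to a deterministic one can be replaced by its limit.\<close>

section \<open>Step functions and the \<open>J\<^sub>1\<close> topology\<close>

text \<open>The clock is a functional of the walk, so the two cannot be treated as independent when
  one is run along the inverse of the other. The deterministic limit of the clock removes the need
  for joint convergence. The \<open>J\<^sub>1\<close> topology is given only by its convergent
  sequences; hence continuity of functionals is always sequential continuity, and a random path is
  measurable because it is the image, under a sequentially continuous map, of a random sequence of
  breakpoints and values. For the time change there is no coupling that makes the paths converge
  almost surely. Its place is taken by the function \<open>rho\<close>, which measures locally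
  uniform closeness: its value against a fixed continuous path depends
  \<open>J\<^sub>1\<close>-continuously on the other argument, so it yields test functions to which
  the assumed convergence applies, and a path close to a continuous one tolerates every small time
  change. The clock needs no distinction between recurrent and transient walks, because the law of
  large numbers uses only the average number of pairs of times at which the walk occupies the same
  site.\<close>

definition partition_times :: "(nat \<Rightarrow> real) set" where
  "partition_times = {s. s 0 = 0 \<and> strict_mono s \<and> (\<forall>x. \<exists>k. x < s k)}"

text \<open>The index is selected by the same definite description as in \<open>rtrw\<close>, so a
  path of the trapped walk is a step function whose breakpoints are the clock values.\<close>

definition step_fun :: "(nat \<Rightarrow> real) \<Rightarrow> (nat \<Rightarrow> 'a) \<Rightarrow> real \<Rightarrow> 'a" where
  "step_fun s y = (\<lambda>t\<in>{0..}. y (THE k. s k \<le> t \<and> t < s (Suc k)))"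

lemma partition_index_exists:
  assumes "s \<in> partition_times" "0 \<le> t"
  obtains k where "s k \<le> t" "t < s (Suc k)"
proof -
  have ex: "\<exists>n. t < s n" using assms(1) by (auto simp: partition_times_def)
  define n where "n = (LEAST n. t < s n)"
  have n: "t < s n" unfolding n_def using ex by (rule LeastI_ex)
  have "n \<noteq> 0" using n assms by (auto simp: partition_times_def intro!: Nat.gr0I)
  then obtain k where k: "n = Suc k" by (cases n) auto
  have "\<not> t < s k" using not_less_Least[of k "\<lambda>n. t < s n"] k by (simp add: n_def[symmetric])
  then show ?thesis using n k that[of k] by simp
qed

lemma partition_index_unique:
  assumes "strict_mono (s :: nat \<Rightarrow> real)" "s k \<le> t" "t < s (Suc k)"
  shows "(THE k. s k \<le> t \<and> t < s (Suc k)) = k"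
proof (rule the_equality)
  fix j assume j: "s j \<le> t \<and> t < s (Suc j)"
  have "s j < s (Suc k)" "s k < s (Suc j)" using j assms by auto
  then show "j = k" using strict_mono_less[OF assms(1)] by auto
qed (use assms in auto)

lemma step_fun_eq:
  assumes "s \<in> partition_times" "s k \<le> t" "t < s (Suc k)"
  shows "step_fun s y t = y k"
proof -
  have "s 0 \<le> s k" using assms(1) strict_mono_less_eq[of s 0 k] by (simp add: partition_times_def)
  then have "0 \<le> t" using assms by (auto simp: partition_times_def)
  then show ?thesis
    using partition_index_unique[of s k t] assms by (simp add: step_fun_def partition_times_def)
qed

lemma scaled_partition_times:
  assumes "s \<in> partition_times" "0 < c"
  shows "(\<lambda>k. s k / c) \<in> partition_times"
proof -
  have "\<exists>k. x < s k / c" for x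
  proof -
    obtain k where "x * c < s k" using assms(1) by (auto simp: partition_times_def)
    then show ?thesis using assms(2) by (auto simp: pos_less_divide_eq)
  qed
  then show ?thesis using assms by (auto simp: partition_times_def strict_mono_def divide_strict_right_mono)
qed

lemma step_fun_in_skorohod_space:
  fixes y :: "nat \<Rightarrow> 'a :: metric_space"
  assumes s: "s \<in> partition_times"
  shows "step_fun s y \<in> skorohod_space"
proof -
  have sm: "strict_mono s" using s by (auto simp: partition_times_def)
  have "(step_fun s y \<longlongrightarrow> step_fun s y t) (at_right t)" if t: "0 \<le> t" for t
  proof -
    obtain k where k: "s k \<le> t" "t < s (Suc k)" using partition_index_exists[OF s t] .
    have "\<forall>\<^sub>F u in at_right t. step_fun s y u = step_fun s y t"
      using eventually_at_right_less[of t] eventually_at_right_real[OF k(2)]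
      proof eventually_elim
        case (elim u) then show ?case using k step_fun_eq[OF s, of k u y] step_fun_eq[OF s k, of y] by simp
      qed
    then show ?thesis by (rule tendsto_eventually)
  qed
  moreover have "\<exists>l. (step_fun s y \<longlongrightarrow> l) (at_left t)" if t: "0 < t" for t
  proof -
    obtain k where k: "s k \<le> t" "t < s (Suc k)" using partition_index_exists[OF s, of t] t by auto
    \<comment> \<open>At a breakpoint the left limit is the value of the preceding interval, so
      \<open>t\<close> is now located in an interval that is open on the left and closed on the
      right.\<close>
    have "\<exists>j. s j < t \<and> t \<le> s (Suc j)"
    proof (cases "s k < t")
      case True then show ?thesis using k by auto
    next
      case False
      then have "s k = t" using k by simp
      moreover have "k \<noteq> 0" using calculation t s by (auto simp: partition_times_def intro!: Nat.gr0I)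
      ultimately show ?thesis using strict_mono_less[OF sm, of "k - 1" k] by (intro exI[of _ "k - 1"]) auto
    qed
    then obtain j where j: "s j < t" "t \<le> s (Suc j)" by blast
    have "\<forall>\<^sub>F u in at_left t. step_fun s y u = y j"
      using eventually_at_left_real[OF j(1)]
    proof eventually_elim
      case (elim u) then show ?case using j step_fun_eq[OF s, of j u y] by simp
    qed
    then show ?thesis by (intro exI tendsto_eventually)
  qed
  ultimately show ?thesis by (auto simp: skorohod_space_def step_fun_def)
qed

section \<open>Time changes and a criterion for convergence\<close>

lemma time_change_id: "time_change (\<lambda>t. t)"
  by (auto simp: time_change_def strict_mono_on_def filterlim_ident)

text \<open>Only finitely many breakpoints can be matched at once, so the time changes are diagonalised
  over the number of matched breakpoints.\<close>
lemma J1_convergesI: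
  fixes f :: "nat \<Rightarrow> real \<Rightarrow> 'a :: metric_space"
  assumes "\<And>K e. 0 < e \<Longrightarrow> \<forall>\<^sub>F n in sequentially. \<exists>l. time_change l \<and>
      (\<forall>t\<ge>0. \<bar>l t - t\<bar> < e) \<and> (\<forall>t\<in>{0..K}. dist (f n (l t)) (g t) < e)"
  shows "J1_converges f g"
proof -
  define Q where "Q n m l \<longleftrightarrow> time_change l \<and> (\<forall>t\<ge>0. \<bar>l t - t\<bar> < 1 / (real m + 1)) \<and>
     (\<forall>t\<in>{0..real m}. dist (f n (l t)) (g t) < 1 / (real m + 1))" for n m l
  \<comment> \<open>The bound \<open>m \<le> n\<close> makes \<open>R n\<close> finite, so that a
    best precision \<open>Max (R n)\<close> exists. The identity serves as default while no
    precision has been reached.\<close>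
  define R where "R n = {m. m \<le> n \<and> (\<exists>l. Q n m l)}" for n
  define l where "l n = (if R n = {} then \<lambda>t. t else SOME l. Q n (Max (R n)) l)" for n
  have fin: "finite (R n)" for n unfolding R_def by simp
  have Ql: "Q n (Max (R n)) (l n)" if "R n \<noteq> {}" for n
  proof -
    have "Max (R n) \<in> R n" using Max_in[OF fin that] .
    then have "\<exists>l. Q n (Max (R n)) l" by (auto simp: R_def)
    then show ?thesis unfolding l_def using that by (simp add: someI_ex)
  qed
  have tc: "time_change (l n)" for n
    using Ql[of n] by (cases "R n = {}") (auto simp: l_def time_change_id Q_def)
  have ev: "\<forall>\<^sub>F n in sequentially. R n \<noteq> {} \<and> m \<le> Max (R n)" for m
  proof -
    have "\<forall>\<^sub>F n in sequentially. \<exists>l. Q n m l"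
      unfolding Q_def by (rule assms) simp
    then show ?thesis using eventually_ge_at_top[of m]
    proof eventually_elim
      case (elim n)
      then have "m \<in> R n" by (auto simp: R_def)
      then show ?case using fin by (auto intro: Max_ge)
    qed
  qed
  have key: "\<forall>\<^sub>F n in sequentially. (\<forall>t\<ge>0. dist (l n t) t < e) \<and>
      (\<forall>t\<in>{0..T}. dist (f n (l n t)) (g t) < e)" if e: "0 < e" for e T
  proof -
    obtain m1 where m1: "1 / (real m1 + 1) < e"
      using reals_Archimedean[OF e] by (auto simp: inverse_eq_divide add.commute)
    obtain m2 where m2: "T \<le> real m2" using real_arch_simple by blast
    show ?thesis using ev[of "max m1 m2"]
    proof eventually_elim
      case (elim n)
      then have q: "Q n (Max (R n)) (l n)" "m1 \<le> Max (R n)" "m2 \<le> Max (R n)" using Ql by auto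
      have "1 / (real (Max (R n)) + 1) \<le> 1 / (real m1 + 1)"
        using q(2) by (intro divide_left_mono) auto
      then have "1 / (real (Max (R n)) + 1) < e" using m1 by simp
      moreover have "T \<le> real (Max (R n))" using q(3) m2 by linarith
      ultimately show ?case using q(1) unfolding Q_def dist_real_def
        by (auto intro: order.strict_trans)
    qed
  qed
  show ?thesis unfolding J1_converges_def uniform_limit_iff
  proof (intro exI[of _ l] conjI allI impI)
    fix e :: real assume e: "0 < e"
    show "\<forall>\<^sub>F n in sequentially. \<forall>x\<in>{0..}. dist (l n x) x < e"
      using key[OF e, of 0] by eventually_elim auto
    fix T show "\<forall>\<^sub>F n in sequentially. \<forall>x\<in>{0..T}. dist (f n (l n x)) (g x) < e"
      using key[OF e, of T] by eventually_elim auto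
  qed (rule tc)
qed

text \<open>Stretch each of the first \<open>K\<close> intervals linearly, with slope
  \<open>\<Delta>' k / \<Delta> k\<close>, and continue with slope 1. The deviation from the
  identity accumulates only through the changes of the interval lengths.\<close>

lemma exists_time_change_matching:
  assumes s: "s \<in> partition_times" and s': "s' \<in> partition_times"
  obtains l where "time_change l" "\<And>k. k \<le> K \<Longrightarrow> l (s k) = s' k"
    "\<And>t. 0 \<le> t \<Longrightarrow> \<bar>l t - t\<bar> \<le> (\<Sum>k<K. \<bar>(s' (Suc k) - s' k) - (s (Suc k) - s k)\<bar>)"
proof -
  have sm: "strict_mono s" "strict_mono s'" and s0: "s 0 = 0" "s' 0 = 0"
    using s s' by (auto simp: partition_times_def)
  define \<Delta> \<Delta>' where "\<Delta> k = s (Suc k) - s k" and "\<Delta>' k = s' (Suc k) - s' k" for k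
  have pos: "0 < \<Delta> k" "0 < \<Delta>' k" for k
    using sm by (auto simp: \<Delta>_def \<Delta>'_def strict_mono_less)
  \<comment> \<open>\<open>cl k t\<close> is the time that \<open>{0..t}\<close> spends in the
    \<open>k\<close>-th interval. With such clamped terms, continuity of \<open>l\<close> is
    immediate and the identity has the telescoping form \<open>tel\<close>.\<close>
  define cl where "cl k t = max 0 (min (t - s k) (\<Delta> k))" for k t
  define l where "l t = (\<Sum>k<K. \<Delta>' k / \<Delta> k * cl k t) + max 0 (t - s K)" for t
  have tel: "(\<Sum>k<n. cl k t) + max 0 (t - s n) = t" if "0 \<le> t" for n t
  proof (induction n)
    case 0 then show ?case using that s0 by simp
  next
    case (Suc n)
    have "s n < s (Suc n)" using sm by (simp add: strict_mono_less)
    then have "cl n t + max 0 (t - s (Suc n)) = max 0 (t - s n)"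
      by (auto simp: cl_def \<Delta>_def max_def min_def)
    then show ?case using Suc by simp
  qed
  have clm: "cl k t \<le> cl k u" if "t \<le> u" for k t u using that by (auto simp: cl_def)
  have cl0: "0 \<le> cl k t" "cl k t \<le> \<Delta> k" for k t using pos(1)[of k] by (auto simp: cl_def)
  \<comment> \<open>The smallest slope, where 1 stands for the part after \<open>s K\<close>. The
    bound \<open>grow\<close> then gives strict monotonicity and divergence at once.\<close>
  define c where "c = Min (insert 1 ((\<lambda>k. \<Delta>' k / \<Delta> k) ` {..<K}))"
  have cpos: "0 < c" unfolding c_def using pos by (subst Min_gr_iff) auto
  have cle: "c \<le> 1" "k < K \<Longrightarrow> c \<le> \<Delta>' k / \<Delta> k" for k unfolding c_def by (auto intro: Min_le)
  have grow: "c * (u - t) \<le> l u - l t" if "0 \<le> t" "t \<le> u" for t u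
  proof -
    have "c * (u - t) = (\<Sum>k<K. c * (cl k u - cl k t)) + c * (max 0 (u - s K) - max 0 (t - s K))"
      using tel[of t K] tel[of u K] that
      by (simp add: sum_distrib_left[symmetric] sum_subtractf distrib_left[symmetric])
    also have "\<dots> \<le> (\<Sum>k<K. \<Delta>' k / \<Delta> k * (cl k u - cl k t)) + 1 * (max 0 (u - s K) - max 0 (t - s K))"
      using that clm cle by (intro add_mono sum_mono mult_right_mono) auto
    also have "\<dots> = l u - l t"
      by (simp add: l_def sum_subtractf right_diff_distrib)
    finally show ?thesis .
  qed
  have l0: "l 0 = 0"
  proof -
    have s_nonneg: "0 \<le> s k" for k using strict_mono_less_eq[OF sm(1), of 0 k] s0(1) by simp
    have "cl k 0 = 0" for k using s_nonneg[of k] pos(1)[of k] by (simp add: cl_def)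
    moreover have "max 0 (0 - s K) = 0" using s_nonneg[of K] by simp
    ultimately
    show ?thesis by (simp add: l_def)
  qed
  show thesis
  proof (rule that[of l])
    have "filterlim l at_top at_top"
    proof (rule filterlim_at_top_mono)
      show "filterlim (\<lambda>t. c * t) at_top at_top"
        using cpos by (simp add: filterlim_tendsto_pos_mult_at_top[OF tendsto_const] filterlim_ident)
      show "\<forall>\<^sub>F t in at_top. c * t \<le> l t"
        using eventually_ge_at_top[of 0] by eventually_elim (use grow[of 0] l0 in auto)
    qed
    moreover have "strict_mono_on {0..} l"
    proof (rule strict_mono_onI)
      fix t u :: real assume tu: "t \<in> {0..}" "u \<in> {0..}" "t < u"
      then have "0 < c * (u - t)" using cpos by simp
      then show "l t < l u" using grow[of t u] tu by simp
    qed
    moreover have "continuous_on {0..} l"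
      unfolding l_def cl_def by (intro continuous_intros)
    ultimately show "time_change l" using l0 by (simp add: time_change_def)
    show "l (s k) = s' k" if "k \<le> K" for k
    proof -
      have "cl j (s k) = (if j < k then \<Delta> j else 0)" for j
      proof (cases "j < k")
        case True
        then have "s (Suc j) \<le> s k" using sm by (simp add: strict_mono_less_eq)
        then show ?thesis using True pos(1)[of j] by (auto simp: cl_def \<Delta>_def)
      next
        case False
        then have "s k \<le> s j" using sm by (simp add: strict_mono_less_eq)
        then show ?thesis using False pos(1)[of j] by (auto simp: cl_def)
      qed
      then have "(\<Sum>j<K. \<Delta>' j / \<Delta> j * cl j (s k)) = (\<Sum>j<K. if j < k then \<Delta>' j else 0)"
        using pos(1) by (intro sum.cong) (auto simp: less_imp_neq[symmetric])
      also have "\<dots> = (\<Sum>j<k. \<Delta>' j)"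
        using that by (intro sum.mono_neutral_cong_right) auto
      also have "\<dots> = s' k" unfolding \<Delta>'_def by (simp add: sum_lessThan_telescope s0)
      finally show ?thesis using sm that by (simp add: l_def strict_mono_less_eq)
    qed
    show "\<bar>l t - t\<bar> \<le> (\<Sum>k<K. \<bar>(s' (Suc k) - s' k) - (s (Suc k) - s k)\<bar>)" if "0 \<le> t" for t
    proof -
      have "l t - t = (\<Sum>k<K. (\<Delta>' k / \<Delta> k - 1) * cl k t)"
        using tel[OF that, of K] by (simp add: l_def sum_subtractf left_diff_distrib)
      also have "\<bar>\<dots>\<bar> \<le> (\<Sum>k<K. \<bar>\<Delta>' k / \<Delta> k - 1\<bar> * \<Delta> k)"
        by (intro order_trans[OF sum_abs] sum_mono) (auto simp: abs_mult cl0 intro!: mult_left_mono)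
      also have "\<dots> = (\<Sum>k<K. \<bar>\<Delta>' k - \<Delta> k\<bar>)"
      proof (intro sum.cong refl)
        fix k
        have "\<bar>\<Delta>' k / \<Delta> k - 1\<bar> * \<Delta> k = \<bar>(\<Delta>' k / \<Delta> k - 1) * \<Delta> k\<bar>"
          using pos(1)[of k] by (simp add: abs_mult)
        also have "(\<Delta>' k / \<Delta> k - 1) * \<Delta> k = \<Delta>' k - \<Delta> k" using pos(1)[of k] by (simp add: left_diff_distrib)
        finally show "\<bar>\<Delta>' k / \<Delta> k - 1\<bar> * \<Delta> k = \<bar>\<Delta>' k - \<Delta> k\<bar>" .
      qed
      finally show ?thesis by (simp add: \<Delta>_def \<Delta>'_def)
    qed
  qed
qed

text \<open>Once the breakpoints up to the horizon are matched, both paths are in the interval of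
  the same index at corresponding times, and only finitely many values remain to be compared. This
  is the sequential continuity behind the measurability of random step functions.\<close>

lemma J1_converges_step_fun:
  fixes y :: "nat \<Rightarrow> 'a :: metric_space"
  assumes s: "s \<in> partition_times" and s': "\<And>n. s' n \<in> partition_times"
    and lims: "\<And>k. (\<lambda>n. s' n k) \<longlonglongrightarrow> s k" and limy: "\<And>k. (\<lambda>n. y' n k) \<longlonglongrightarrow> y k"
  shows "J1_converges (\<lambda>n. step_fun (s' n) (y' n)) (step_fun s y)"
proof (rule J1_convergesI)
  fix T e :: real assume e: "0 < e"
  obtain K where K: "T < s K" using s by (auto simp: partition_times_def)
  have "(\<lambda>n. \<Sum>k<K. \<bar>(s' n (Suc k) - s' n k) - (s (Suc k) - s k)\<bar>)
      \<longlonglongrightarrow> (\<Sum>k<K. \<bar>(s (Suc k) - s k) - (s (Suc k) - s k)\<bar>)"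
    by (intro tendsto_intros lims)
  then have ev1: "\<forall>\<^sub>F n in sequentially. (\<Sum>k<K. \<bar>(s' n (Suc k) - s' n k) - (s (Suc k) - s k)\<bar>) < e"
    using order_tendstoD(2)[of _ 0 sequentially e] e by simp
  have ev2: "\<forall>\<^sub>F n in sequentially. \<forall>k<K. dist (y' n k) (y k) < e"
    using eventually_ball_finite[of "{..<K}" "\<lambda>n k. dist (y' n k) (y k) < e" sequentially] tendstoD[OF limy e]
    by (simp add: Ball_def)
  show "\<forall>\<^sub>F n in sequentially. \<exists>l. time_change l \<and> (\<forall>t\<ge>0. \<bar>l t - t\<bar> < e) \<and>
     (\<forall>t\<in>{0..T}. dist (step_fun (s' n) (y' n) (l t)) (step_fun s y t) < e)"
    using ev1 ev2
  proof eventually_elim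
    case (elim n)
    obtain l where l: "time_change l" "\<And>k. k \<le> K \<Longrightarrow> l (s k) = s' n k"
      "\<And>t. 0 \<le> t \<Longrightarrow> \<bar>l t - t\<bar> \<le> (\<Sum>k<K. \<bar>(s' n (Suc k) - s' n k) - (s (Suc k) - s k)\<bar>)"
      using exists_time_change_matching[OF s s'[of n], of K] by blast
    have "dist (step_fun (s' n) (y' n) (l t)) (step_fun s y t) < e" if t: "t \<in> {0..T}" for t
    proof -
      obtain k where k: "s k \<le> t" "t < s (Suc k)" using partition_index_exists[OF s, of t] t by auto
      have "s k < s K" using k t K by auto
      then have kK: "k < K" using s by (auto simp: partition_times_def strict_mono_less)
      have mono: "strict_mono_on {0..} l" using l(1) by (simp add: time_change_def)
      have "0 \<le> s k" using s strict_mono_less_eq[of s 0 k] by (simp add: partition_times_def)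
      then have "l (s k) \<le> l t" "l t < l (s (Suc k))"
        using mono k by (auto simp: strict_mono_on_def order_le_less)
      then have "step_fun (s' n) (y' n) (l t) = y' n k"
        using l(2)[of k] l(2)[of "Suc k"] kK by (intro step_fun_eq s') auto
      then show ?thesis using step_fun_eq[OF s k, of y] elim kK by simp
    qed
    moreover have "\<forall>t\<ge>0. \<bar>l t - t\<bar> < e" using l(3) elim by force
    ultimately show ?case using l(1) by blast
  qed
qed

section \<open>Continuity and Borel measurability for the \<open>J\<^sub>1\<close> topology\<close>

lemma continuous_map_J1_iff:
  fixes F :: "(real \<Rightarrow> 'a :: metric_space) \<Rightarrow> real"
  shows "continuous_map J1_topology euclideanreal F \<longleftrightarrow>
     (\<forall>f g. range f \<subseteq> skorohod_space \<and> g \<in> skorohod_space \<and> J1_converges f g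
        \<longrightarrow> (\<lambda>n. F (f n)) \<longlonglongrightarrow> F g)" (is "?L \<longleftrightarrow> ?R")
proof
  assume L: ?L
  show ?R
  proof (intro allI impI)
    fix f :: "nat \<Rightarrow> real \<Rightarrow> 'a" and g assume fg: "range f \<subseteq> skorohod_space \<and> g \<in> skorohod_space \<and> J1_converges f g"
    show "(\<lambda>n. F (f n)) \<longlonglongrightarrow> F g"
    proof (rule topological_tendstoI)
      fix S assume S: "open S" "F g \<in> S"
      have "openin J1_topology {x \<in> topspace J1_topology. F x \<in> S}"
        using L S(1) by (auto simp: continuous_map_def)
      then have "\<forall>\<^sub>F n in sequentially. f n \<in> {x \<in> topspace J1_topology. F x \<in> S}"
        using fg S(2) unfolding openin_J1_topology by auto
      then show "\<forall>\<^sub>F n in sequentially. F (f n) \<in> S" by eventually_elim auto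
    qed
  qed
next
  assume R: ?R
  show ?L unfolding continuous_map_def openin_J1_topology
  proof (intro conjI allI impI ballI)
    fix U g and f :: "nat \<Rightarrow> real \<Rightarrow> 'a" assume U: "openin euclideanreal U" and g: "g \<in> {x \<in> topspace J1_topology. F x \<in> U}"
      and f: "range f \<subseteq> skorohod_space \<and> J1_converges f g"
    then have "(\<lambda>n. F (f n)) \<longlonglongrightarrow> F g" using R by auto
    then have "\<forall>\<^sub>F n in sequentially. F (f n) \<in> U"
      using U g by (auto dest: topological_tendstoD)
    then show "\<forall>\<^sub>F n in sequentially. f n \<in> {x \<in> topspace J1_topology. F x \<in> U}"
      by eventually_elim (use f in auto)
  qed auto
qed

lemma space_borel_of [simp]: "space (borel_of T) = topspace T"
  by (simp add: borel_of_def space_measure_of_conv)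

lemma sets_borel_of: "sets (borel_of T) = sigma_sets (topspace T) {U. openin T U}"
  unfolding borel_of_def by (rule sets_measure_of) (auto dest: openin_subset)

lemma openin_in_sets_borel_of: "openin T U \<Longrightarrow> U \<in> sets (borel_of T)"
  by (auto simp: sets_borel_of)

lemma continuous_map_measurable_borel_of:
  assumes "continuous_map T euclidean F"
  shows "F \<in> borel_of T \<rightarrow>\<^sub>M borel"
proof (rule borel_measurableI)
  fix S :: "'b set" assume "open S"
  then have "openin T {x \<in> topspace T. F x \<in> S}" using assms by (auto simp: continuous_map_def)
  moreover have "F -` S \<inter> space (borel_of T) = {x \<in> topspace T. F x \<in> S}" by auto
  ultimately show "F -` S \<inter> space (borel_of T) \<in> sets (borel_of T)"
    by (simp add: openin_in_sets_borel_of)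
qed

lemma measurable_into_borel_of:
  assumes "\<And>w. w \<in> space P \<Longrightarrow> Z w \<in> topspace T"
    and "\<And>U. openin T U \<Longrightarrow> {w \<in> space P. Z w \<in> U} \<in> sets P"
  shows "Z \<in> P \<rightarrow>\<^sub>M borel_of T"
  unfolding borel_of_def
proof (rule measurable_measure_of)
  fix U assume "U \<in> {U. openin T U}"
  then show "Z -` U \<inter> space P \<in> sets P"
    using assms(2)[of U] by (simp add: vimage_def Int_def conj_commute)
qed (use assms(1) in \<open>auto dest: openin_subset\<close>)

text \<open>If points of \<open>E\<close> outside \<open>V\<close> came arbitrarily close to a point
  of \<open>V\<close> in \<open>E\<close>, they would contain a sequence forbidden by the
  assumption. The lemma turns sets known only through sequences into genuinely open sets of a metric
  space.\<close>

lemma sequentially_open_relative: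
  fixes E V :: "'a :: metric_space set"
  assumes "\<And>x z. x \<in> V \<Longrightarrow> x \<in> E \<Longrightarrow> (\<And>n. z n \<in> E) \<Longrightarrow> z \<longlonglongrightarrow> x \<Longrightarrow> \<exists>n. z n \<in> V"
  obtains W where "open W" "W \<inter> E = V \<inter> E"
proof -
  have "openin (top_of_set E) (V \<inter> E)"
    unfolding openin_euclidean_subtopology_iff
  proof (intro conjI ballI)
    fix x assume x: "x \<in> V \<inter> E"
    show "\<exists>e>0. \<forall>x'\<in>E. dist x' x < e \<longrightarrow> x' \<in> V \<inter> E"
    proof (rule ccontr)
      assume "\<not> ?thesis"
      then have "\<forall>e>0. \<exists>x'\<in>E. dist x' x < e \<and> x' \<notin> V" by blast
      then have "\<exists>x'\<in>E. dist x' x < inverse (real (Suc n)) \<and> x' \<notin> V" for n by simp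
      then obtain z where z: "\<And>n. z n \<in> E" "\<And>n. dist (z n) x < inverse (real (Suc n))" "\<And>n. z n \<notin> V"
        by metis
      have "z \<longlonglongrightarrow> x" unfolding lim_sequentially
      proof (intro allI impI)
        fix r :: real assume "0 < r"
        then obtain m where m: "inverse (real (Suc m)) < r" using reals_Archimedean by blast
        have "dist (z n) x < r" if "m \<le> n" for n
        proof -
          have "inverse (real (Suc n)) \<le> inverse (real (Suc m))" using that by simp
          then show ?thesis using z(2)[of n] m by linarith
        qed
        then show "\<exists>no. \<forall>n\<ge>no. dist (z n) x < r" by blast
      qed
      then show False using assms[of x z] x z by auto
    qed
  qed auto
  then show ?thesis using that by (auto simp: openin_open)
qed

text \<open>The path is a function of the sequence of breakpoints and the sequence of values. That
  pair lives in a second-countable metric space, where measurability is checked coordinatewise, and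
  \<open>step_fun\<close> is sequentially continuous on it, so it pulls
  \<open>J\<^sub>1\<close>-open sets back to relatively open ones.\<close>

lemma measurable_step_fun:
  fixes y :: "nat \<Rightarrow> 'w \<Rightarrow> 'a :: {metric_space, second_countable_topology}"
  assumes s: "\<And>k. s k \<in> borel_measurable P" and y: "\<And>k. y k \<in> borel_measurable P"
    and part: "AE w in P. (\<lambda>k. s k w) \<in> partition_times"
  shows "\<exists>Z. Z \<in> P \<rightarrow>\<^sub>M borel_of J1_topology \<and>
    (AE w in P. Z w = step_fun (\<lambda>k. s k w) (\<lambda>k. y k w))"
proof -
  obtain N where N: "N \<in> null_sets P" "{w \<in> space P. (\<lambda>k. s k w) \<notin> partition_times} \<subseteq> N"
    using part by (auto elim!: AE_E intro: null_setsI)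
  \<comment> \<open>On the exceptional null set the integers are used as breakpoints, so that the
    version is a step function everywhere.\<close>
  define s' where "s' k w = (if w \<in> N then real k else s k w)" for k w
  have real_part: "real \<in> partition_times"
    by (auto simp: partition_times_def strict_mono_def reals_Archimedean2)
  have s'P: "(\<lambda>k. s' k w) \<in> partition_times" if "w \<in> space P" for w
    using N(2) that real_part by (cases "w \<in> N") (auto simp: s'_def)
  define X where "X w = ((\<lambda>k. s' k w), (\<lambda>k. y k w))" for w
  define Z where "Z w = step_fun (fst (X w)) (snd (X w))" for w
  have s'm: "s' k \<in> borel_measurable P" for k
    unfolding s'_def using s N(1) by (intro measurable_If_set) auto
  have Xm: "X \<in> borel_measurable P"
    unfolding X_def by (intro borel_measurable_Pair measurable_coordinatewise_then_product s'm y)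
  let ?E = "{x :: (nat \<Rightarrow> real) \<times> (nat \<Rightarrow> 'a). fst x \<in> partition_times}"
  have "Z \<in> P \<rightarrow>\<^sub>M borel_of J1_topology"
  proof (rule measurable_into_borel_of)
    show "Z w \<in> topspace J1_topology" if "w \<in> space P" for w
      using step_fun_in_skorohod_space s'P[OF that] by (simp add: Z_def X_def)
    fix U :: "(real \<Rightarrow> 'a) set" assume U: "openin J1_topology U"
    obtain W where W: "open W" "W \<inter> ?E = {x. step_fun (fst x) (snd x) \<in> U} \<inter> ?E"
    proof (rule sequentially_open_relative)
      fix x z assume x: "x \<in> {x. step_fun (fst x) (snd x) \<in> U}" "x \<in> ?E"
        and z: "\<And>n. z n \<in> ?E" "z \<longlonglongrightarrow> x"
      have "(\<lambda>n. fst (z n) k) \<longlonglongrightarrow> fst x k" "(\<lambda>n. snd (z n) k) \<longlonglongrightarrow> snd x k" for k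
      proof -
        have c: "continuous_on UNIV (\<lambda>x :: nat \<Rightarrow> 'b :: metric_space. x k)"
          by (rule continuous_on_product_then_coordinatewise) (rule continuous_on_id)
        show "(\<lambda>n. fst (z n) k) \<longlonglongrightarrow> fst x k"
          using continuous_on_tendsto_compose[OF c tendsto_fst[OF z(2)]] by simp
        have c: "continuous_on UNIV (\<lambda>x :: nat \<Rightarrow> 'a. x k)"
          by (rule continuous_on_product_then_coordinatewise) (rule continuous_on_id)
        show "(\<lambda>n. snd (z n) k) \<longlonglongrightarrow> snd x k"
          using continuous_on_tendsto_compose[OF c tendsto_snd[OF z(2)]] by simp
      qed
      then have J: "J1_converges (\<lambda>n. step_fun (fst (z n)) (snd (z n))) (step_fun (fst x) (snd x))"
        using x z(1) by (intro J1_converges_step_fun) auto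
      have r: "range (\<lambda>n. step_fun (fst (z n)) (snd (z n))) \<subseteq> skorohod_space"
        using z(1) by (auto intro!: step_fun_in_skorohod_space)
      have "\<forall>\<^sub>F n in sequentially. step_fun (fst (z n)) (snd (z n)) \<in> U"
        using U J r x unfolding openin_J1_topology by blast
      then have "\<exists>n. step_fun (fst (z n)) (snd (z n)) \<in> U"
        using eventually_happens'[OF sequentially_bot] by blast
      then show "\<exists>n. z n \<in> {x. step_fun (fst x) (snd x) \<in> U}" by simp
    qed
    \<comment> \<open>\<open>W\<close> describes the preimage of \<open>U\<close> only inside
      \<open>?E\<close>, which suffices because \<open>X\<close> takes all its values there.\<close>
    have "{w \<in> space P. Z w \<in> U} = X -` W \<inter> space P"
    proof (intro set_eqI iffI)
      fix w assume "w \<in> {w \<in> space P. Z w \<in> U}"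
      then have "X w \<in> {x. step_fun (fst x) (snd x) \<in> U} \<inter> ?E" "w \<in> space P"
        using s'P by (auto simp: Z_def X_def)
      then show "w \<in> X -` W \<inter> space P" using W(2) by blast
    next
      fix w assume w: "w \<in> X -` W \<inter> space P"
      then have "X w \<in> W \<inter> ?E" using s'P by (auto simp: X_def)
      then have "X w \<in> {x. step_fun (fst x) (snd x) \<in> U}" using W(2) by blast
      then show "w \<in> {w \<in> space P. Z w \<in> U}" using w by (auto simp: Z_def)
    qed
    also have "\<dots> \<in> sets P" using Xm W(1) by (simp add: in_borel_measurable_borel measurable_sets)
    finally show "{w \<in> space P. Z w \<in> U} \<in> sets P" .
  qed
  moreover have "AE w in P. Z w = step_fun (\<lambda>k. s k w) (\<lambda>k. y k w)"
    using AE_not_in[OF N(1)] by eventually_elim (simp add: Z_def X_def s'_def)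
  ultimately show ?thesis by blast
qed

section \<open>A weighted uniform distance\<close>

text \<open>A distance for locally uniform convergence. The weight makes late times negligible and
  the truncation at 1 keeps the supremum finite. A single supremum over all times, instead of a sum
  over horizons, allows a comparison term by term after a time change.\<close>

definition rho :: "(real \<Rightarrow> 'a::metric_space) \<Rightarrow> (real \<Rightarrow> 'a) \<Rightarrow> real" where
  "rho f g = (SUP t\<in>{0..}. exp (-t) * min 1 (dist (f t) (g t)))"

lemma rho_term_le_exp: "exp (- t) * min 1 (dist x y) \<le> exp (- t :: real)"
  by (simp add: mult_left_le)

lemma rho_bdd: "bdd_above ((\<lambda>t. exp (-t) * min 1 (dist (f t) (g t))) ` {0::real..})"
proof (rule bdd_aboveI2)
  fix t :: real assume "t \<in> {0..}"
  then show "exp (-t) * min 1 (dist (f t) (g t)) \<le> 1"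
    using rho_term_le_exp[of t "f t" "g t"] by (smt (verit) atLeast_iff exp_le_one_iff)
qed

lemma rho_upper: "0 \<le> t \<Longrightarrow> exp (-t) * min 1 (dist (f t) (g t)) \<le> rho f g"
  unfolding rho_def by (rule cSUP_upper[OF _ rho_bdd]) simp

lemma rho_least: "(\<And>t. 0 \<le> t \<Longrightarrow> exp (-t) * min 1 (dist (f t) (g t)) \<le> c) \<Longrightarrow> rho f g \<le> c"
  unfolding rho_def by (rule cSUP_least) auto

lemma rho_nonneg: "0 \<le> rho f g"
  using rho_upper[of 0 f g] by (auto intro: order_trans[rotated])

lemma rho_commute: "rho f g = rho g f"
  by (simp add: rho_def dist_commute)

lemma rho_triangle: "rho f h \<le> rho f g + rho g h"
proof (rule rho_least)
  fix t :: real assume t: "0 \<le> t"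
  have "min 1 (dist (f t) (h t)) \<le> min 1 (dist (f t) (g t)) + min 1 (dist (g t) (h t))"
    using dist_triangle[of "f t" "h t" "g t"] zero_le_dist[of "f t" "g t"] zero_le_dist[of "g t" "h t"]
    by linarith
  then have "exp (-t) * min 1 (dist (f t) (h t)) \<le>
      exp (-t) * min 1 (dist (f t) (g t)) + exp (-t) * min 1 (dist (g t) (h t))"
    by (metis distrib_left exp_ge_zero mult_left_mono)
  then show "exp (-t) * min 1 (dist (f t) (h t)) \<le> rho f g + rho g h"
    using rho_upper[OF t, of f g] rho_upper[OF t, of g h] by linarith
qed

lemma rho_le: "\<lbrakk>0 \<le> e; \<And>t. \<lbrakk>0 \<le> t; t \<le> T\<rbrakk> \<Longrightarrow> dist (f t) (g t) \<le> e\<rbrakk> \<Longrightarrow> rho f g \<le> e + exp (-T)"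
proof (rule rho_least)
  fix t :: real assume t: "0 \<le> t" and e: "0 \<le> e"
    and b: "\<And>t. \<lbrakk>0 \<le> t; t \<le> T\<rbrakk> \<Longrightarrow> dist (f t) (g t) \<le> e"
  show "exp (-t) * min 1 (dist (f t) (g t)) \<le> e + exp (-T)"
  proof (cases "t \<le> T")
    case True
    have "exp (-t) * min 1 (dist (f t) (g t)) \<le> 1 * e"
      using b[OF t True] t e by (intro mult_mono) auto
    then show ?thesis by (smt (verit) exp_ge_zero)
  next
    case False
    then have "exp (-t) \<le> exp (-T)" by simp
    then show ?thesis using rho_term_le_exp[of t "f t" "g t"] e by linarith
  qed
qed

text \<open>Undoing the weight up to time \<open>T\<close> costs the factor \<open>exp T\<close>; as
  the result is at most 1, the truncation in \<open>rho\<close> cannot have been active.\<close>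

lemma dist_less_if_rho_less:
  assumes "rho f g < r" "0 \<le> t" "t \<le> T" "r * exp T \<le> 1"
  shows "dist (f t) (g t) < r * exp T"
proof -
  have "exp (-t) * min 1 (dist (f t) (g t)) < r" using rho_upper[OF assms(2), of f g] assms(1) by linarith
  then have "exp t * (exp (-t) * min 1 (dist (f t) (g t))) < exp t * r" by simp
  then have "min 1 (dist (f t) (g t)) < exp t * r" by (simp add: mult.assoc[symmetric] exp_add[symmetric])
  also have "\<dots> \<le> exp T * r"
    using assms(1,3) rho_nonneg[of f g] by (intro mult_right_mono) auto
  finally show ?thesis using assms(4) by (auto simp: mult.commute min_def split: if_splits)
qed

lemma uniform_limit_if_rho_tendsto:
  assumes "(\<lambda>n. rho (f n) g) \<longlonglongrightarrow> 0"
  shows "uniform_limit {0..T} f g sequentially"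
  unfolding uniform_limit_iff
proof (intro allI impI)
  fix e :: real assume e: "0 < e"
  define r where "r = min 1 e * exp (-T)"
  have r: "0 < r" "r * exp T = min 1 e" using e by (auto simp: r_def mult.assoc exp_add[symmetric])
  have "\<forall>\<^sub>F n in sequentially. rho (f n) g < r" using order_tendstoD(2)[OF assms r(1)] .
  then show "\<forall>\<^sub>F n in sequentially. \<forall>x\<in>{0..T}. dist (f n x) (g x) < e"
  proof eventually_elim
    case (elim n)
    then show ?case using dist_less_if_rho_less[OF elim] r(2) by fastforce
  qed
qed

section \<open>The distance \<open>rho\<close> under time changes\<close>

lemma time_change_nonneg: "\<lbrakk>time_change l; 0 \<le> t\<rbrakk> \<Longrightarrow> 0 \<le> l t"
  unfolding time_change_def strict_mono_on_def by (cases "t = 0") force+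

lemma time_change_surj:
  assumes l: "time_change l" and t: "0 \<le> t"
  obtains s where "0 \<le> s" "l s = t"
proof -
  have "\<forall>\<^sub>F u in at_top. t \<le> l u \<and> 0 \<le> u"
    using l eventually_ge_at_top[of 0] by (auto simp: time_change_def filterlim_at_top eventually_conj_iff)
  then obtain b where b: "t \<le> l b" "0 \<le> b" using eventually_happens'[OF trivial_limit_at_top_linorder] by blast
  have "\<exists>x\<ge>0. x \<le> b \<and> l x = t"
    using l b t by (intro IVT') (auto simp: time_change_def intro: continuous_on_subset)
  then show ?thesis using that by blast
qed

lemma abs_exp_minus_diff_le: "\<lbrakk>0 \<le> a; 0 \<le> b\<rbrakk> \<Longrightarrow> \<bar>exp (-a) - exp (-b)\<bar> \<le> \<bar>a - b :: real\<bar>"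
proof (induction a b rule: linorder_wlog)
  case (le a b)
  have "exp (-a) * (1 - exp (a - b)) \<le> 1 * (b - a)"
  proof (rule mult_mono)
    show "1 - exp (a - b) \<le> b - a" using exp_ge_add_one_self[of "a - b"] by linarith
  qed (use le in auto)
  then have "exp (-a) - exp (-b) \<le> b - a" by (simp add: right_diff_distrib exp_add[symmetric])
  then show ?case using le by simp
qed (auto simp: abs_minus_commute)

text \<open>The minimum keeps two bounds available: \<open>\<bar>x - y\<bar>\<close> for times
  before a horizon, and the weight alone for times after it.\<close>

lemma rho_terms_close:
  fixes a b x y :: real
  assumes "0 \<le> a" "0 \<le> b" "0 \<le> x" "0 \<le> y"
  shows "\<bar>exp (-a) * min 1 x - exp (-b) * min 1 y\<bar> \<le> \<bar>a - b\<bar> + min \<bar>x - y\<bar> (exp (-b))"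
proof -
  have "exp (-a) * min 1 x - exp (-b) * min 1 y
      = (exp (-a) - exp (-b)) * min 1 x + exp (-b) * (min 1 x - min 1 y)" by (simp add: algebra_simps)
  also have "\<bar>\<dots>\<bar> \<le> \<bar>exp (-a) - exp (-b)\<bar> * min 1 x + exp (-b) * \<bar>min 1 x - min 1 y\<bar>"
    using assms by (intro order_trans[OF abs_triangle_ineq]) (simp add: abs_mult)
  also have "\<dots> \<le> \<bar>a - b\<bar> * 1 + min \<bar>x - y\<bar> (exp (-b))"
  proof (rule add_mono)
    show "\<bar>exp (-a) - exp (-b)\<bar> * min 1 x \<le> \<bar>a - b\<bar> * 1"
      using assms abs_exp_minus_diff_le[of a b] by (intro mult_mono) auto
    have "exp (-b) * \<bar>min 1 x - min 1 y\<bar> \<le> 1 * \<bar>x - y\<bar>"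
      using assms by (intro mult_mono) auto
    moreover have "exp (-b) * \<bar>min 1 x - min 1 y\<bar> \<le> exp (-b) * 1"
      using assms by (intro mult_left_mono) auto
    ultimately show "exp (-b) * \<bar>min 1 x - min 1 y\<bar> \<le> min \<bar>x - y\<bar> (exp (-b))" by simp
  qed
  finally show ?thesis by simp
qed

text \<open>Compare the term of \<open>rho (f n) g\<close> at \<open>l n s\<close> with the term of
  \<open>rho h g\<close> at \<open>s\<close>: \<open>f n (l n s)\<close> is near \<open>h s\<close>
  by convergence, and \<open>g (l n s)\<close> is near \<open>g s\<close> by uniform continuity of
  \<open>g\<close>. With a jump of \<open>g\<close> the second comparison would fail.\<close>

lemma tendsto_rho:
  assumes J: "J1_converges f h" and g: "continuous_on {0..} g"
  shows "(\<lambda>n. rho (f n) g) \<longlonglongrightarrow> rho h g"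
proof (rule tendstoI)
  fix e :: real assume e: "0 < e"
  \<comment> \<open>Displacing the time costs less than \<open>d\<close> in the weight, and the two
    path comparisons cost \<open>d\<close> each, in total \<open>3 * d < e\<close>.\<close>
  define d where "d = e / 4"
  have d: "0 < d" using e by (simp add: d_def)
  obtain l where l: "\<And>n. time_change (l n)" "uniform_limit {0..} l (\<lambda>t. t) sequentially"
    "\<And>T. uniform_limit {0..T} (\<lambda>n t. f n (l n t)) h sequentially"
    using J by (auto simp: J1_converges_def)
  define T where "T = max 0 (- ln d)"
  have T: "0 \<le> T" "exp (-T) \<le> d" using d by (auto simp: T_def max_def not_le intro: order_trans)
  \<comment> \<open>The extra unit leaves room for \<open>l n s\<close>, which may exceed
    \<open>T\<close> by less than 1.\<close>
  have "uniformly_continuous_on {0..T+1} g"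
    by (rule compact_uniformly_continuous) (use g in \<open>auto intro: continuous_on_subset\<close>)
  then obtain r where r: "0 < r" "\<And>u s. \<lbrakk>u \<in> {0..T+1}; s \<in> {0..T+1}; dist u s < r\<rbrakk> \<Longrightarrow> dist (g u) (g s) < d"
    using d unfolding uniformly_continuous_on_def by metis
  define m where "m = min d (min r 1)"
  have m: "0 < m" "m \<le> d" "m \<le> r" "m \<le> 1" using d r by (auto simp: m_def)
  show "\<forall>\<^sub>F n in sequentially. dist (rho (f n) g) (rho h g) < e"
    using uniform_limitD[OF l(2) m(1)] uniform_limitD[OF l(3)[of T] d]
  proof eventually_elim
    case (elim n)
    have close: "\<bar>exp (- l n s) * min 1 (dist (f n (l n s)) (g (l n s))) - exp (-s) * min 1 (dist (h s) (g s))\<bar> \<le> 3 * d"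
      if s: "0 \<le> s" for s
    proof -
      have ls: "0 \<le> l n s" "\<bar>l n s - s\<bar> < m"
        using time_change_nonneg[OF l(1) s] elim(1) s by (auto simp: dist_real_def)
      have "min \<bar>dist (f n (l n s)) (g (l n s)) - dist (h s) (g s)\<bar> (exp (-s)) \<le> 2 * d"
      proof (cases "s \<le> T")
        case True
        have "dist (f n (l n s)) (h s) < d" using elim(2) s True by auto
        moreover have "dist (g (l n s)) (g s) < d"
          using ls m s True by (intro r(2)) (auto simp: dist_real_def)
        moreover have "\<bar>dist (f n (l n s)) (g (l n s)) - dist (h s) (g s)\<bar>
            \<le> dist (f n (l n s)) (h s) + dist (g (l n s)) (g s)"
          by (smt (verit) dist_commute dist_triangle)
        ultimately show ?thesis by linarith
      next
        case False
        then have "exp (-s) \<le> exp (-T)" by simp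
        then show ?thesis using T d by linarith
      qed
      then show ?thesis
        using rho_terms_close[OF ls(1) s, of "dist (f n (l n s)) (g (l n s))" "dist (h s) (g s)"] ls m
        by simp
    qed
    have "rho h g \<le> rho (f n) g + 3 * d"
    proof (rule rho_least)
      fix s :: real assume s: "0 \<le> s"
      show "exp (-s) * min 1 (dist (h s) (g s)) \<le> rho (f n) g + 3 * d"
        using close[OF s] rho_upper[OF time_change_nonneg[OF l(1) s], of n "f n" g] by linarith
    qed
    moreover have "rho (f n) g \<le> rho h g + 3 * d"
    proof (rule rho_least)
      fix t :: real assume t: "0 \<le> t"
      \<comment> \<open>A time change is onto the half-line, so the terms at times
        \<open>l n s\<close> are all the terms of \<open>rho (f n) g\<close>.\<close>
      obtain s where s: "0 \<le> s" "l n s = t" using time_change_surj[OF l(1) t] .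
      show "exp (-t) * min 1 (dist (f n t) (g t)) \<le> rho h g + 3 * d"
        using close[OF s(1)] rho_upper[OF s(1), of h g] s(2) by simp
    qed
    ultimately show ?case using e by (auto simp: dist_real_def d_def)
  qed
qed

section \<open>Piecewise linear paths\<close>

definition interp :: "nat \<Rightarrow> 'a::real_normed_vector list \<Rightarrow> real \<Rightarrow> 'a" where
  "interp m as t = (\<Sum>k<length as. max 0 (1 - \<bar>real m * t - real k\<bar>) *\<^sub>R (as ! k))"

lemma continuous_on_interp: "continuous_on S (interp m as)"
  unfolding interp_def by (intro continuous_intros)

lemma hat_partition_of_unity:
  assumes "0 \<le> x" "x \<le> real n"
  shows "(\<Sum>k\<le>n. max 0 (1 - \<bar>x - real k\<bar>)) = 1"
  using assms
proof (induction n)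
  case (Suc n)
  show ?case
  proof (cases "x \<le> real n")
    case True then show ?thesis using Suc by simp
  next
    case False
    have "(\<Sum>k\<le>n. max 0 (1 - \<bar>x - real k\<bar>)) = (\<Sum>k\<in>{n}. max 0 (1 - \<bar>x - real k\<bar>))"
      using False by (intro sum.mono_neutral_right) (auto simp: not_less)
    then show ?thesis using False Suc.prems by simp
  qed
qed simp

text \<open>By the partition of unity, \<open>interp m as t\<close> is a convex combination of
  values at the nodes within \<open>1 / m\<close> of \<open>t\<close>, hence near \<open>g t\<close>
  by uniform continuity. Values taken from a countable dense set give countably many approximating
  paths.\<close>

lemma interp_dense:
  fixes g :: "real \<Rightarrow> 'a :: real_normed_vector"
  assumes g: "continuous_on {0..} g" and e: "0 < e"
    and D: "\<And>x r. 0 < r \<Longrightarrow> \<exists>d\<in>D. dist x d < (r::real)"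
  obtains m as where "set as \<subseteq> D" "rho g (interp m as) < e"
proof -
  obtain T :: nat where T: "- ln (e/2) < real T" using reals_Archimedean2 by blast
  then have "- real T < ln (e/2)" by simp
  then have "exp (- real T) < exp (ln (e/2))" by (simp only: exp_less_cancel_iff)
  then have expT: "exp (- real T) < e / 2" using e by simp
  have "uniformly_continuous_on {0..real T} g"
    by (rule compact_uniformly_continuous) (use g in \<open>auto intro: continuous_on_subset\<close>)
  then obtain r where r: "0 < r" "\<And>u s. \<lbrakk>u \<in> {0..real T}; s \<in> {0..real T}; dist u s < r\<rbrakk> \<Longrightarrow> dist (g u) (g s) < e/4"
    using e unfolding uniformly_continuous_on_def by (metis divide_pos_pos zero_less_numeral)
  obtain m0 where m0: "inverse (real (Suc m0)) < r" using reals_Archimedean[OF r(1)] by blast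
  define m where "m = Suc m0"
  have m: "0 < real m" "1 / real m < r" using m0 by (auto simp: m_def inverse_eq_divide)
  obtain a where a: "\<And>k. a k \<in> D" "\<And>k. dist (g (real k / real m)) (a k) < e/4"
  proof -
    have "\<exists>d. d \<in> D \<and> dist (g (real k / real m)) d < e/4" for k
      using D[of "e/4" "g (real k / real m)"] e by auto
    then show ?thesis using that by metis
  qed
  \<comment> \<open>The node \<open>m * T\<close> is included so that the hat functions sum to 1 on
    all of \<open>{0..T}\<close>.\<close>
  define as where "as = map a [0..<Suc (m * T)]"
  have "dist (g t) (interp m as t) \<le> e / 2" if t: "0 \<le> t" "t \<le> real T" for t
  proof -
    define h where "h k = max 0 (1 - \<bar>real m * t - real k\<bar>)" for k
    have h1: "(\<Sum>k\<le>m*T. h k) = 1" unfolding h_def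
      using t m by (intro hat_partition_of_unity) auto
    have ip: "interp m as t = (\<Sum>k\<le>m*T. h k *\<^sub>R a k)"
      unfolding interp_def as_def h_def by (intro sum.cong) (auto simp: nth_append lessThan_Suc_atMost simp del: upt_Suc)
    have "g t - interp m as t = (\<Sum>k\<le>m*T. h k *\<^sub>R (g t - a k))"
      using h1 by (simp add: ip scaleR_diff_right sum_subtractf scaleR_left.sum[symmetric])
    also have "norm \<dots> \<le> (\<Sum>k\<le>m*T. h k * (e / 2))"
    proof (rule sum_norm_le)
      fix k assume k: "k \<in> {..m * T}"
      show "norm (h k *\<^sub>R (g t - a k)) \<le> h k * (e / 2)"
      proof (cases "h k = 0")
        case False
        then have "\<bar>real m * t - real k\<bar> < 1" by (auto simp: h_def max_def split: if_splits)
        moreover have "t - real k / real m = (real m * t - real k) / real m"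
          using m by (simp add: diff_divide_distrib)
        ultimately have "\<bar>t - real k / real m\<bar> < 1 / real m"
          using m by (simp add: abs_divide divide_strict_right_mono)
        moreover have "real k / real m \<le> real T"
          using k m by (simp add: divide_le_eq mult.commute flip: of_nat_mult)
        ultimately have "dist (g t) (g (real k / real m)) < e / 4"
          using t m by (intro r(2)) (auto simp: dist_real_def)
        then have "dist (g t) (a k) \<le> e / 2"
          using a(2)[of k] dist_triangle[of "g t" "a k" "g (real k / real m)"] by linarith
        then have "h k * norm (g t - a k) \<le> h k * (e / 2)"
            by (intro mult_left_mono) (simp_all add: h_def dist_norm)
          then show ?thesis by (simp add: h_def)
      qed simp
    qed
    also have "\<dots> = e / 2" using h1 by (simp only: sum_distrib_right[symmetric] mult_1)
    finally show ?thesis by (simp add: dist_norm)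
  qed
  then have "rho g (interp m as) \<le> e / 2 + exp (- real T)" using e by (intro rho_le) auto
  then have "rho g (interp m as) < e" using expT by linarith
  moreover have "set as \<subseteq> D" using a(1) by (auto simp: as_def)
  ultimately show ?thesis using that by blast
qed

section \<open>Composition and rescaling of convergent paths\<close>

lemma J1_converges_compose:
  fixes f :: "nat \<Rightarrow> real \<Rightarrow> 'a :: metric_space"
  assumes f: "(\<lambda>n. rho (f n) g) \<longlonglongrightarrow> 0" and g: "continuous_on {0..} g" and c: "0 \<le> c"
    and v: "\<And>n t. 0 \<le> t \<Longrightarrow> 0 \<le> v n t"
    and vlim: "\<And>T. uniform_limit {0..T} v (\<lambda>t. c * t) sequentially"
  shows "J1_converges (\<lambda>n. \<lambda>t\<in>{0..}. f n (v n t)) (\<lambda>t\<in>{0..}. g (c * t))"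
  unfolding J1_converges_def
\<comment> \<open>The limit path is continuous, so locally uniform convergence can be proved
  directly and the identity serves as time change. Accordingly \<open>v n\<close> may be any
  nonnegative function, neither continuous nor monotone.\<close>
proof (intro exI[of _ "\<lambda>n t. t"] conjI allI time_change_id)
  show "uniform_limit {0..} (\<lambda>n t. t) (\<lambda>t. t) sequentially" by (simp add: uniform_limit_iff)
  fix T :: real
  show "uniform_limit {0..T} (\<lambda>n t. (\<lambda>t\<in>{0..}. f n (v n t)) t) (\<lambda>t\<in>{0..}. g (c * t)) sequentially"
    unfolding uniform_limit_iff
  proof (intro allI impI)
    fix e :: real assume e: "0 < e"
    \<comment> \<open>The margin 1 keeps \<open>v n t\<close> inside the interval on which
      \<open>g\<close> is uniformly continuous.\<close>
    define R where "R = c * T + 1"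
    have "uniformly_continuous_on {0..R} g"
      by (rule compact_uniformly_continuous) (use g in \<open>auto intro: continuous_on_subset\<close>)
    then obtain r where r: "0 < r" "\<And>u s. \<lbrakk>u \<in> {0..R}; s \<in> {0..R}; dist u s < r\<rbrakk> \<Longrightarrow> dist (g u) (g s) < e/2"
      using e unfolding uniformly_continuous_on_def by (metis half_gt_zero)
    have "0 < min r 1" "0 < e/2" using r e by auto
    from uniform_limitD[OF vlim[of T] this(1)] uniform_limitD[OF uniform_limit_if_rho_tendsto[OF f, of R] this(2)]
    show "\<forall>\<^sub>F n in sequentially. \<forall>x\<in>{0..T}. dist ((\<lambda>t\<in>{0..}. f n (v n t)) x) ((\<lambda>t\<in>{0..}. g (c * t)) x) < e"
    proof eventually_elim
      case (elim n)
      show ?case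
      proof
        fix t assume t: "t \<in> {0..T}"
        have ct: "0 \<le> c * t" "c * t \<le> c * T" using c t by (auto intro: mult_left_mono)
        have "\<bar>v n t - c * t\<bar> < min r 1" using elim(1) t by (auto simp: dist_real_def)
        then have vt: "v n t \<in> {0..R}" "c * t \<in> {0..R}" "dist (v n t) (c * t) < r"
          using v[of t n] t ct by (simp_all add: R_def dist_real_def) linarith+
        have "dist (f n (v n t)) (g (v n t)) < e/2" using elim(2) vt by auto
        moreover have "dist (g (v n t)) (g (c * t)) < e/2" using r(2) vt by auto
        ultimately have "dist (f n (v n t)) (g (c * t)) < e"
          using dist_triangle[of "f n (v n t)" "g (c * t)" "g (v n t)"] by linarith
        then show "dist ((\<lambda>t\<in>{0..}. f n (v n t)) t) ((\<lambda>t\<in>{0..}. g (c * t)) t) < e" using t by simp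
      qed
    qed
  qed
qed

lemma skorohod_space_scale:
  assumes "f \<in> skorohod_space" "0 < c"
  shows "(\<lambda>t\<in>{0..}. f (c * t)) \<in> skorohod_space"
  unfolding skorohod_space_def
proof (intro CollectI conjI allI impI)
  fix t :: real assume t: "0 \<le> t"
  have "filterlim (\<lambda>u. c * u) (at_right (c * t)) (at_right t)"
    unfolding filterlim_at
  proof
    show "\<forall>\<^sub>F u in at_right t. c * u \<in> {c * t<..} \<and> c * u \<noteq> c * t"
      using eventually_at_right_less[of t] by eventually_elim (use assms(2) in simp)
  qed (intro tendsto_intros)
  moreover have "(f \<longlongrightarrow> f (c * t)) (at_right (c * t))" using assms t by (simp add: skorohod_space_def)
  ultimately have "((\<lambda>u. f (c * u)) \<longlongrightarrow> f (c * t)) (at_right t)" by (rule filterlim_compose[rotated])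
  moreover have "\<forall>\<^sub>F u in at_right t. f (c * u) = (\<lambda>t\<in>{0..}. f (c * t)) u"
    using eventually_at_right_less[of t] by eventually_elim (use t in simp)
  ultimately have "((\<lambda>t\<in>{0..}. f (c * t)) \<longlongrightarrow> f (c * t)) (at_right t)"
    by (rule Lim_transform_eventually)
  then show "((\<lambda>t\<in>{0..}. f (c * t)) \<longlongrightarrow> (\<lambda>t\<in>{0..}. f (c * t)) t) (at_right t)" using t by simp
next
  fix t :: real assume t: "0 < t"
  obtain l where l: "(f \<longlongrightarrow> l) (at_left (c * t))" 
  proof -
    have "0 < c * t" using assms(2) t by simp
    then have "\<exists>l. (f \<longlongrightarrow> l) (at_left (c * t))" using assms(1) by (simp add: skorohod_space_def)
    then show ?thesis using that by (rule exE)
  qed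
  have "filterlim (\<lambda>u. c * u) (at_left (c * t)) (at_left t)"
    unfolding filterlim_at
  proof
    show "\<forall>\<^sub>F u in at_left t. c * u \<in> {..<c * t} \<and> c * u \<noteq> c * t"
      using eventually_at_left_real[OF t] by eventually_elim (use assms(2) in simp)
  qed (intro tendsto_intros)
  with l have "((\<lambda>u. f (c * u)) \<longlongrightarrow> l) (at_left t)" by (rule filterlim_compose)
  moreover have "\<forall>\<^sub>F u in at_left t. f (c * u) = (\<lambda>t\<in>{0..}. f (c * t)) u"
    using eventually_at_left_real[OF t] by eventually_elim simp
  ultimately have "((\<lambda>t\<in>{0..}. f (c * t)) \<longlongrightarrow> l) (at_left t)"
    by (rule Lim_transform_eventually)
  then show "\<exists>l. ((\<lambda>t\<in>{0..}. f (c * t)) \<longlongrightarrow> l) (at_left t)" by (rule exI)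
qed simp

lemma time_change_scale:
  assumes l: "time_change l" and c: "0 < c"
  shows "time_change (\<lambda>t. l (c * t) / c)"
  unfolding time_change_def
proof (intro conjI)
  have "continuous_on {0..} (\<lambda>t. l (c * t))"
  proof (rule continuous_on_compose2[of "{0..}" l "{0..}" "\<lambda>t. c * t"])
    show "continuous_on {0..} l" using l by (simp add: time_change_def)
  qed (use c in \<open>auto intro: continuous_intros\<close>)
  then show "continuous_on {0..} (\<lambda>t. l (c * t) / c)" using c by (intro continuous_intros) auto
  show "strict_mono_on {0..} (\<lambda>t. l (c * t) / c)"
    using l c by (auto simp: time_change_def strict_mono_on_def divide_strict_right_mono)
  have "filterlim (\<lambda>t. c * t) at_top at_top"
    using c by (simp add: filterlim_tendsto_pos_mult_at_top[OF tendsto_const] filterlim_ident)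
  moreover have "filterlim l at_top at_top" using l by (simp add: time_change_def)
  ultimately have "filterlim (\<lambda>t. l (c * t)) at_top at_top" by (rule filterlim_compose[rotated])
  then have "filterlim (\<lambda>t. inverse c * l (c * t)) at_top at_top"
    using c by (intro filterlim_tendsto_pos_mult_at_top[OF tendsto_const]) auto
  then show "filterlim (\<lambda>t. l (c * t) / c) at_top at_top" by (simp add: inverse_eq_divide)
qed (use l in \<open>simp add: time_change_def\<close>)

text \<open>The time change is conjugated by the scaling, which divides its deviation from the
  identity by \<open>c\<close>; hence the precision \<open>e * c\<close> below.\<close>

lemma J1_converges_scale:
  assumes "J1_converges f g" and c: "0 < c"
  shows "J1_converges (\<lambda>n. \<lambda>t\<in>{0..}. f n (c * t)) (\<lambda>t\<in>{0..}. g (c * t))"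
proof (rule J1_convergesI)
  obtain l where l: "\<And>n. time_change (l n)" "uniform_limit {0..} l (\<lambda>t. t) sequentially"
    "\<And>T. uniform_limit {0..T} (\<lambda>n t. f n (l n t)) g sequentially"
    using assms(1) by (auto simp: J1_converges_def)
  fix T e :: real assume e: "0 < e"
  then have "0 < e * c" using c by simp
  from uniform_limitD[OF l(2) this] uniform_limitD[OF l(3)[of "c * T"] e]
  show "\<forall>\<^sub>F n in sequentially. \<exists>l. time_change l \<and> (\<forall>t\<ge>0. \<bar>l t - t\<bar> < e) \<and>
     (\<forall>t\<in>{0..T}. dist ((\<lambda>t\<in>{0..}. f n (c * t)) (l t)) ((\<lambda>t\<in>{0..}. g (c * t)) t) < e)"
  proof eventually_elim
    case (elim n)
    let ?l = "\<lambda>t. l n (c * t) / c"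
    have "\<bar>?l t - t\<bar> < e" if "0 \<le> t" for t
    proof -
      have "\<bar>l n (c * t) - c * t\<bar> < e * c" using elim(1) c that by (auto simp: dist_real_def)
      moreover have "?l t - t = (l n (c * t) - c * t) / c" using c by (simp add: diff_divide_distrib)
      ultimately show ?thesis using c by (simp add: abs_divide pos_divide_less_eq)
    qed
    moreover have "dist ((\<lambda>t\<in>{0..}. f n (c * t)) (?l t)) ((\<lambda>t\<in>{0..}. g (c * t)) t) < e"
      if t: "t \<in> {0..T}" for t
    proof -
      have "0 \<le> ?l t" using time_change_nonneg[OF l(1), of "c * t" n] c t by simp
      moreover have "dist (f n (l n (c * t))) (g (c * t)) < e" using elim(2) t c by auto
      ultimately show ?thesis using t c by simp
    qed
    ultimately show ?case using time_change_scale[OF l(1) c] by blast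
  qed
qed

section \<open>Convergence in distribution under a random time change\<close>

lemma continuous_in_skorohod_space:
  fixes g :: "real \<Rightarrow> 'a :: metric_space"
  assumes "continuous_on {0..} g"
  shows "restrict g {0..} \<in> skorohod_space"
proof -
  have *: "continuous_on {0..} (restrict g {0..})" using assms by (rule continuous_on_eq) simp
  have "(restrict g {0..} \<longlongrightarrow> restrict g {0..} t) (at_right t)" if "0 \<le> t" for t
  proof (rule tendsto_within_subset)
    show "(restrict g {0..} \<longlongrightarrow> restrict g {0..} t) (at t within {0..})"
      using bspec[OF *[unfolded continuous_on_def], of t] that by simp
  qed (use that in auto)
  moreover have "\<exists>l. (restrict g {0..} \<longlongrightarrow> l) (at_left t)" if "0 < t" for t
  proof (rule exI)
    have "(restrict g {0..} \<longlongrightarrow> restrict g {0..} t) (at t within {0..t})"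
    proof (rule tendsto_within_subset)
      show "(restrict g {0..} \<longlongrightarrow> restrict g {0..} t) (at t within {0..})"
        using bspec[OF *[unfolded continuous_on_def], of t] that by simp
    qed auto
    then show "(restrict g {0..} \<longlongrightarrow> restrict g {0..} t) (at_left t)"
      using at_within_Icc_at_left[OF that] by simp
  qed
  ultimately show ?thesis by (simp add: skorohod_space_def)
qed

text \<open>One index \<open>j\<close> fixes both the horizon and the precision, so that countably
  many neighbourhoods suffice. Composition with an arbitrary \<open>v\<close> may leave the path
  space, on which alone a functional is controlled; this is excluded by the last conjunct.\<close>

definition admissible :: "real \<Rightarrow> nat \<Rightarrow> (real \<Rightarrow> 'a::metric_space) \<Rightarrow> (real \<Rightarrow> real) \<Rightarrow> bool" where
  "admissible c j f v \<longleftrightarrow> (\<forall>t\<ge>0. 0 \<le> v t) \<and> (\<forall>t\<in>{0..real j + 1}. \<bar>v t - c * t\<bar> < 1 / (real j + 1))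
     \<and> (\<lambda>t\<in>{0..}. f (v t)) \<in> skorohod_space"

text \<open>Counterexamples for every \<open>j\<close> would form a sequence to which
  \<open>J1_converges_compose\<close> applies, against the sequential continuity of
  \<open>F\<close>. The gain is uniformity: one \<open>j\<close> serves all paths near
  \<open>g\<close> and all admissible time changes.\<close>

lemma continuous_map_J1_compose:
  fixes F :: "(real \<Rightarrow> 'a :: metric_space) \<Rightarrow> real"
  assumes F: "continuous_map J1_topology euclideanreal F" and g: "continuous_on {0..} g"
    and c: "0 < c" and e: "0 < e"
  obtains j where "\<And>f v. \<lbrakk>rho f g < 1 / (real j + 1); admissible c j f v\<rbrakk> \<Longrightarrow>
     \<bar>F (\<lambda>t\<in>{0..}. f (v t)) - F (\<lambda>t\<in>{0..}. g (c * t))\<bar> < e"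
proof (rule ccontr)
  assume "\<not> thesis"
  then have "\<exists>f v. rho f g < 1 / (real j + 1) \<and> admissible c j f v \<and>
     \<not> \<bar>F (\<lambda>t\<in>{0..}. f (v t)) - F (\<lambda>t\<in>{0..}. g (c * t))\<bar> < e" for j
    using that by blast
  then obtain f v where fv: "\<And>j. rho (f j) g < 1 / (real j + 1)" "\<And>j. admissible c j (f j) (v j)"
     "\<And>j. \<not> \<bar>F (\<lambda>t\<in>{0..}. f j (v j t)) - F (\<lambda>t\<in>{0..}. g (c * t))\<bar> < e"
    by metis
  have lim0: "(\<lambda>j. 1 / (real j + 1)) \<longlonglongrightarrow> 0"
    using LIMSEQ_inverse_real_of_nat by (simp add: inverse_eq_divide add.commute)
  have "(\<lambda>j. rho (f j) g) \<longlonglongrightarrow> 0"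
    by (rule tendsto_sandwich[OF _ _ tendsto_const lim0])
      (use fv(1) rho_nonneg in \<open>auto intro!: always_eventually intro: less_imp_le\<close>)
  moreover have "uniform_limit {0..T} v (\<lambda>t. c * t) sequentially" for T
    unfolding uniform_limit_iff
  proof (intro allI impI)
    fix r :: real assume "0 < r"
    obtain J where J: "T \<le> real J" using real_arch_simple by blast
    show "\<forall>\<^sub>F n in sequentially. \<forall>x\<in>{0..T}. dist (v n x) (c * x) < r"
      using order_tendstoD(2)[OF lim0 \<open>0 < r\<close>] eventually_ge_at_top[of J]
    proof eventually_elim
      case (elim n)
      show ?case
      proof
        fix x assume "x \<in> {0..T}"
        then have "\<bar>v n x - c * x\<bar> < 1 / (real n + 1)"
          using fv(2)[of n] J elim(2) by (auto simp: admissible_def)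
        then show "dist (v n x) (c * x) < r" using elim(1) by (simp add: dist_real_def)
      qed
    qed
  qed
  ultimately have J: "J1_converges (\<lambda>n. \<lambda>t\<in>{0..}. f n (v n t)) (\<lambda>t\<in>{0..}. g (c * t))"
    using g c fv(2) by (intro J1_converges_compose) (auto simp: admissible_def)
  have "continuous_on {0..} (\<lambda>t. g (c * t))"
    by (rule continuous_on_compose2[OF g]) (use c in \<open>auto intro!: continuous_intros\<close>)
  then have "(\<lambda>t\<in>{0..}. g (c * t)) \<in> skorohod_space" by (rule continuous_in_skorohod_space)
  then have "(\<lambda>n. F (\<lambda>t\<in>{0..}. f n (v n t))) \<longlonglongrightarrow> F (\<lambda>t\<in>{0..}. g (c * t))"
    using F[unfolded continuous_map_J1_iff, rule_format,
        of "\<lambda>n. \<lambda>t\<in>{0..}. f n (v n t)" "\<lambda>t\<in>{0..}. g (c * t)"] J fv(2)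
    by (auto simp: admissible_def)
  then have "\<forall>\<^sub>F n in sequentially. dist (F (\<lambda>t\<in>{0..}. f n (v n t))) (F (\<lambda>t\<in>{0..}. g (c * t))) < e"
    using e by (rule tendstoD)
  then have "\<exists>n. dist (F (\<lambda>t\<in>{0..}. f n (v n t))) (F (\<lambda>t\<in>{0..}. g (c * t))) < e"
    by (rule eventually_happens'[OF sequentially_bot])
  then show False using fv(3) by (simp add: dist_real_def)
qed

lemma integrable_bounded_borel_of:
  assumes P: "prob_space P" and Z: "Z \<in> P \<rightarrow>\<^sub>M borel_of T"
    and F: "continuous_map T euclideanreal F" "\<And>x. x \<in> topspace T \<Longrightarrow> \<bar>F x\<bar> \<le> K"
  shows "integrable P (\<lambda>w. F (Z w))"
proof -
  interpret prob_space P by fact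
  show ?thesis
  proof (rule integrable_const_bound)
    show "AE w in P. norm (F (Z w)) \<le> K"
      using measurable_space[OF Z] F(2) by (auto intro!: AE_I2)
    show "(\<lambda>w. F (Z w)) \<in> borel_measurable P"
      using measurable_compose[OF Z continuous_map_measurable_borel_of[OF F(1)]] .
  qed
qed

lemma abs_integral_diff_le:
  fixes f g h :: "'a \<Rightarrow> real"
  assumes "integrable M f" "integrable M g" "integrable M h" "AE x in M. \<bar>f x - g x\<bar> \<le> h x"
  shows "\<bar>(\<integral>x. f x \<partial>M) - (\<integral>x. g x \<partial>M)\<bar> \<le> (\<integral>x. h x \<partial>M)"
proof -
  have "\<bar>(\<integral>x. f x \<partial>M) - (\<integral>x. g x \<partial>M)\<bar> = \<bar>\<integral>x. f x - g x \<partial>M\<bar>" using assms by simp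
  also have "\<dots> \<le> (\<integral>x. \<bar>f x - g x\<bar> \<partial>M)" by (rule integral_abs_bound)
  also have "\<dots> \<le> (\<integral>x. h x \<partial>M)" using assms by (intro integral_mono_AE) auto
  finally show ?thesis .
qed

lemma bounded_image_obtains:
  fixes F :: "'a \<Rightarrow> real"
  assumes "bounded (F ` S)"
  obtains K where "0 < K" "\<And>x. x \<in> S \<Longrightarrow> \<bar>F x\<bar> \<le> K"
  using assms unfolding bounded_pos by auto

text \<open>A bounded continuous \<open>F\<close> barely changes between \<open>V \<circ> v\<close> and \<open>V \<circ> (\<lambda>t. c * t)\<close> when \<open>V\<close> lies in a small
  ball around a continuous path. Countably many such balls around piecewise linear paths cover all
  continuous paths, so finitely many carry most of the mass of the limit, and \<open>\<phi> k\<close> is a continuous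
  lower bound of the indicator of their union.\<close>
lemma converges_in_distribution_time_change:
  fixes X V :: "nat \<Rightarrow> 'w \<Rightarrow> real \<Rightarrow> 'a::{real_normed_vector, second_countable_topology}"
    and B :: "'v \<Rightarrow> real \<Rightarrow> 'a"
  assumes P: "prob_space P" and W: "prob_space W" and c: "0 < c"
    and conv: "converges_in_distribution J1_topology P V W B"
    and cont: "AE w in W. continuous_on {0..} (B w)"
    and meas: "\<And>n. \<exists>Z. Z \<in> P \<rightarrow>\<^sub>M borel_of J1_topology \<and> (AE w in P. Z w = X n w)"
    and X: "\<And>n. AE w in P. X n w = (\<lambda>t\<in>{0..}. V n w (v n w t)) \<and> (\<forall>t\<ge>0. 0 \<le> v n w t)"
    and close: "\<And>T e. 0 < e \<Longrightarrow> \<exists>E. (\<forall>n. E n \<in> sets P) \<and> (\<lambda>n. measure P (E n)) \<longlonglongrightarrow> 1 \<and>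
       (\<forall>n. \<forall>w\<in>E n. \<forall>t\<in>{0..T}. \<bar>v n w t - c * t\<bar> < e)"
  shows "converges_in_distribution J1_topology P X W (\<lambda>w. \<lambda>t\<in>{0..}. B w (c * t))"
proof -
  interpret P: prob_space P by fact
  interpret W: prob_space W by fact
  let ?D = "skorohod_space :: (real \<Rightarrow> 'a) set"
  define sc where "sc f = (\<lambda>t\<in>{0..}. f (c * t))" for f :: "real \<Rightarrow> 'a"
  have sc_sk: "sc f \<in> ?D" if "f \<in> ?D" for f
    unfolding sc_def using that c by (rule skorohod_space_scale)
  have sc_J1: "J1_converges (\<lambda>n. sc (f n)) (sc g)" if "J1_converges f g" for f g
    unfolding sc_def using that c by (rule J1_converges_scale)
  obtain V' B' where V': "\<And>n. V' n \<in> P \<rightarrow>\<^sub>M borel_of J1_topology" "\<And>n. AE w in P. V' n w = V n w"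
    and B': "B' \<in> W \<rightarrow>\<^sub>M borel_of J1_topology" "AE w in W. B' w = B w"
    and lim: "\<And>F. \<lbrakk>continuous_map J1_topology euclideanreal F; bounded (F ` topspace J1_topology)\<rbrakk> \<Longrightarrow>
        (\<lambda>n. \<integral>w. F (V' n w) \<partial>P) \<longlonglongrightarrow> (\<integral>w. F (B' w) \<partial>W)"
    using conv unfolding converges_in_distribution_def by blast
  have V's: "V' n w \<in> ?D" if "w \<in> space P" for n w using measurable_space[OF V'(1) that] by simp
  have B's: "B' w \<in> ?D" if "w \<in> space W" for w using measurable_space[OF B'(1) that] by simp
  have meas_sc: "(\<lambda>w. sc (B' w)) \<in> W \<rightarrow>\<^sub>M borel_of J1_topology"
  proof (rule measurable_into_borel_of)
    fix U :: "(real \<Rightarrow> 'a) set" assume U: "openin J1_topology U"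
    have "openin J1_topology {f \<in> ?D. sc f \<in> U}" unfolding openin_J1_topology
    proof (intro conjI ballI allI impI)
      fix g and f :: "nat \<Rightarrow> real \<Rightarrow> 'a"
      assume g: "g \<in> {f \<in> ?D. sc f \<in> U}" and f: "range f \<subseteq> ?D \<and> J1_converges f g"
      have "range (\<lambda>n. sc (f n)) \<subseteq> ?D \<and> J1_converges (\<lambda>n. sc (f n)) (sc g)"
        using f sc_sk sc_J1 by auto
      then have "\<forall>\<^sub>F n in sequentially. sc (f n) \<in> U"
        using U g unfolding openin_J1_topology by blast
      then show "\<forall>\<^sub>F n in sequentially. f n \<in> {f \<in> ?D. sc f \<in> U}"
        by eventually_elim (use f in auto)
    qed auto
    then have "B' -` {f \<in> ?D. sc f \<in> U} \<inter> space W \<in> sets W"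
      by (intro measurable_sets[OF B'(1)] openin_in_sets_borel_of)
    also have "B' -` {f \<in> ?D. sc f \<in> U} \<inter> space W = {w \<in> space W. sc (B' w) \<in> U}" using B's by auto
    finally show "{w \<in> space W. sc (B' w) \<in> U} \<in> sets W" .
  qed (use B's sc_sk in simp)
  obtain X' where X': "\<And>n. X' n \<in> P \<rightarrow>\<^sub>M borel_of J1_topology" "\<And>n. AE w in P. X' n w = X n w"
    using meas by metis
  have X's: "X' n w \<in> ?D" if "w \<in> space P" for n w using measurable_space[OF X'(1) that] by simp
  have main: "(\<lambda>n. \<integral>w. F (X' n w) \<partial>P) \<longlonglongrightarrow> (\<integral>w. F (sc (B' w)) \<partial>W)"
    if F: "continuous_map J1_topology euclideanreal F" and Fb: "bounded (F ` topspace J1_topology)"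
    for F :: "(real \<Rightarrow> 'a) \<Rightarrow> real"
  proof -
    obtain K where K: "0 < K" "\<And>x. x \<in> ?D \<Longrightarrow> \<bar>F x\<bar> \<le> K"
      using bounded_image_obtains[OF Fb] by auto
    \<comment> \<open>The linear time change is itself \<open>J\<^sub>1\<close>-continuous, so the
      hypothesis already yields the limit for \<open>sc (V' n w)\<close>. What remains is to compare
      \<open>X' n w\<close> with it.\<close>
    have Fsc: "continuous_map J1_topology euclideanreal (\<lambda>f. F (sc f))"
      unfolding continuous_map_J1_iff
    proof (intro allI impI)
      fix f :: "nat \<Rightarrow> real \<Rightarrow> 'a" and g assume "range f \<subseteq> ?D \<and> g \<in> ?D \<and> J1_converges f g"
      then have "range (\<lambda>n. sc (f n)) \<subseteq> ?D \<and> sc g \<in> ?D \<and> J1_converges (\<lambda>n. sc (f n)) (sc g)"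
        using sc_sk sc_J1 by auto
      then show "(\<lambda>n. F (sc (f n))) \<longlonglongrightarrow> F (sc g)"
        using F[unfolded continuous_map_J1_iff, rule_format, of "\<lambda>n. sc (f n)" "sc g"] by blast
    qed
    have "bounded ((\<lambda>f. F (sc f)) ` topspace J1_topology)"
      unfolding bounded_iff using K(2) sc_sk by (auto intro!: exI[of _ K])
    from lim[OF Fsc this]
    have lim_sc: "(\<lambda>n. \<integral>w. F (sc (V' n w)) \<partial>P) \<longlonglongrightarrow> (\<integral>w. F (sc (B' w)) \<partial>W)" .
    have "(\<lambda>n. (\<integral>w. F (X' n w) \<partial>P) - (\<integral>w. F (sc (V' n w)) \<partial>P)) \<longlonglongrightarrow> 0"
    proof (rule tendstoI)
      fix \<epsilon> :: real assume "0 < \<epsilon>"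
      define e where "e = \<epsilon> / 3"
      have e: "0 < e" using \<open>0 < \<epsilon>\<close> by (simp add: e_def)
      obtain Q :: "'a set" where Q: "countable Q" "\<And>U. open U \<Longrightarrow> U \<noteq> {} \<Longrightarrow> \<exists>d\<in>Q. d \<in> U"
        using countable_dense_exists by blast
      have dense: "\<exists>d\<in>Q. dist x d < r" if "0 < r" for x and r :: real
        using Q(2)[of "ball x r"] that by auto
      \<comment> \<open>In a good ball no admissible time change moves \<open>F\<close> by
        \<open>e\<close> or more from its value under the exact linear one. This concerns only the
        centre and the radius, so good balls can be selected from a countable list.\<close>
      define good where "good p j \<longleftrightarrow> (\<forall>f v. f \<in> ?D \<and> rho f p < 1 / (real j + 1) \<and> admissible c j f v
         \<longrightarrow> \<bar>F (\<lambda>t\<in>{0..}. f (v t)) - F (sc f)\<bar> < e)" for p j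
      define I where "I = (UNIV :: nat set) \<times> lists Q \<times> (UNIV :: nat set)"
      have "countable I" "I \<noteq> {}" using Q(1) by (auto simp: I_def)
      then obtain en :: "nat \<Rightarrow> nat \<times> 'a list \<times> nat" where en: "range en = I"
        by (metis uncountable_def)
      define p where "p i = interp (fst (en i)) (fst (snd (en i)))" for i
      define j where "j i = snd (snd (en i))" for i
      have pc: "continuous_on {0..} (p i)" for i unfolding p_def by (rule continuous_on_interp)
      have cover: "\<exists>i. good (p i) (j i) \<and> rho g (p i) < 1 / (real (j i) + 1)"
        if g: "continuous_on {0..} g" for g
      proof -
        have "0 < e / 2" using e by simp
        from continuous_map_J1_compose[OF F g c this]
        obtain k where k: "\<And>f v. \<lbrakk>rho f g < 1 / (real k + 1); admissible c k f v\<rbrakk> \<Longrightarrow>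
          \<bar>F (\<lambda>t\<in>{0..}. f (v t)) - F (\<lambda>t\<in>{0..}. g (c * t))\<bar> < e / 2" by blast
        \<comment> \<open>This halves the radius \<open>1 / (real k + 1)\<close>: a ball of half the
          radius that contains \<open>g\<close> lies in the full ball around
          \<open>g\<close>.\<close>
        let ?k = "2 * k + 1"
        have k2: "1 / (real ?k + 1) = 1 / (real k + 1) / 2" by (simp add: field_simps)
        have "0 < 1 / (real ?k + 1)" by simp
        obtain m as where mas: "set as \<subseteq> Q" "rho g (interp m as) < 1 / (real ?k + 1)"
          by (rule interp_dense[OF g \<open>0 < 1 / (real ?k + 1)\<close> dense])
        have "good (interp m as) ?k" unfolding good_def
        proof (intro allI impI)
          fix f v assume fv: "f \<in> ?D \<and> rho f (interp m as) < 1 / (real ?k + 1) \<and> admissible c ?k f v"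
          have "rho f g \<le> rho f (interp m as) + rho (interp m as) g" by (rule rho_triangle)
          also have "\<dots> < 1 / (real k + 1)"
            using fv mas(2) unfolding k2 by (subst (2) rho_commute) linarith
          finally have fg: "rho f g < 1 / (real k + 1)" .
          have le: "1 / (real ?k + 1) \<le> 1 / (real k + 1)" by (intro divide_left_mono) auto
          have "admissible c k f v" unfolding admissible_def
          proof (intro conjI ballI)
            fix t assume "t \<in> {0..real k + 1}"
            then have "\<bar>v t - c * t\<bar> < 1 / (real ?k + 1)" using fv by (auto simp: admissible_def)
            then show "\<bar>v t - c * t\<bar> < 1 / (real k + 1)" using le by linarith
          qed (use fv in \<open>auto simp: admissible_def\<close>)
          \<comment> \<open>The exact linear time change is admissible too, so both values of
            \<open>F\<close> are within \<open>e / 2\<close> of the value at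
            \<open>g\<close>.\<close>
          moreover have "admissible c k f (\<lambda>t. c * t)"
            using fv sc_sk[of f] c by (auto simp: admissible_def sc_def)
          ultimately have "\<bar>F (\<lambda>t\<in>{0..}. f (v t)) - F (\<lambda>t\<in>{0..}. g (c * t))\<bar> < e / 2"
            "\<bar>F (sc f) - F (\<lambda>t\<in>{0..}. g (c * t))\<bar> < e / 2"
            using k[OF fg] by (auto simp: sc_def)
          then show "\<bar>F (\<lambda>t\<in>{0..}. f (v t)) - F (sc f)\<bar> < e" by linarith
        qed
        moreover have "(m, as, ?k) \<in> range en" using mas(1) unfolding en by (auto simp: I_def)
        then obtain i where "en i = (m, as, ?k)" by (metis rangeE)
        ultimately show ?thesis using mas(2) by (intro exI[of _ i]) (simp add: p_def j_def)
      qed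
      define G where "G k = {i. i < k \<and> good (p i) (j i)}" for k
      have Gfin: "finite (G k)" for k by (simp add: G_def)
      define gap where "gap i f = max 0 (1 / (real (j i) + 1) - rho f (p i))" for i f
      \<comment> \<open>\<open>gap i\<close> is positive exactly inside the \<open>i\<close>-th ball
        and \<open>J\<^sub>1\<close>-continuous by \<open>tendsto_rho\<close>. The factor
        \<open>k\<close> drives \<open>\<phi> k\<close> up to 1 at every path that lies in some good
        ball.\<close>
      define \<phi> where "\<phi> k f = min 1 (real k * (\<Sum>i\<in>G k. gap i f))" for k f
      have \<phi>01: "0 \<le> \<phi> k f" "\<phi> k f \<le> 1" for k f by (auto simp: \<phi>_def gap_def intro!: mult_nonneg_nonneg sum_nonneg)
      have \<phi>c: "continuous_map J1_topology euclideanreal (\<phi> k)" for k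
        unfolding continuous_map_J1_iff \<phi>_def gap_def
        by (intro allI impI tendsto_intros tendsto_rho pc) auto
      have \<phi>b: "bounded (\<phi> k ` S)" for k S
        unfolding bounded_iff using \<phi>01 by (auto intro!: exI[of _ 1])
      have "(\<lambda>k. \<integral>w. \<phi> k (B' w) \<partial>W) \<longlonglongrightarrow> (\<integral>w. 1 \<partial>W)"
      proof (rule integral_dominated_convergence[where w = "\<lambda>_. 1"])
        show "(\<lambda>w. \<phi> k (B' w)) \<in> borel_measurable W" for k
          using measurable_compose[OF B'(1) continuous_map_measurable_borel_of[OF \<phi>c]] .
        show "AE w in W. norm (\<phi> k (B' w)) \<le> 1" for k using \<phi>01 by simp
        show "AE w in W. (\<lambda>k. \<phi> k (B' w)) \<longlonglongrightarrow> 1"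
          using cont B'(2)
        proof eventually_elim
          case (elim w)
          then have "continuous_on {0..} (B' w)" by simp
          from cover[OF this] obtain i where i: "good (p i) (j i)" "rho (B' w) (p i) < 1 / (real (j i) + 1)"
            by blast
          define d where "d = 1 / (real (j i) + 1) - rho (B' w) (p i)"
          have d: "0 < d" using i by (simp add: d_def)
          obtain k0 where k0: "1 / d < real k0" using reals_Archimedean2 by blast
          have "\<forall>\<^sub>F k in sequentially. \<phi> k (B' w) = 1"
            using eventually_ge_at_top[of "max k0 (Suc i)"]
          proof eventually_elim
            case (elim k)
            then have iG: "i \<in> G k" using i(1) by (auto simp: G_def)
            have "1 \<le> real k0 * d" using k0 d by (simp add: pos_divide_less_eq)
            also have "\<dots> \<le> real k * d" using elim d by (intro mult_right_mono) auto
            also have "\<dots> \<le> real k * (\<Sum>i\<in>G k. gap i (B' w))"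
            proof (rule mult_left_mono)
              have "d \<le> gap i (B' w)" by (simp add: d_def gap_def)
              also have "\<dots> \<le> (\<Sum>i\<in>G k. gap i (B' w))"
                by (rule member_le_sum[OF iG]) (auto simp: Gfin gap_def)
              finally show "d \<le> (\<Sum>i\<in>G k. gap i (B' w))" .
            qed simp
            finally show ?case by (simp add: \<phi>_def)
          qed
          then show ?case by (rule tendsto_eventually)
        qed
      qed auto
      then have "(\<lambda>k. \<integral>w. \<phi> k (B' w) \<partial>W) \<longlonglongrightarrow> 1" by (simp add: W.prob_space)
      moreover have "1 - e / (2 * K) < 1" using e K(1) by simp
      ultimately have "\<forall>\<^sub>F k in sequentially. 1 - e / (2 * K) < (\<integral>w. \<phi> k (B' w) \<partial>W)"
        by (rule order_tendstoD)
      then obtain k where k: "1 - e / (2 * K) < (\<integral>w. \<phi> k (B' w) \<partial>W)"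
        using eventually_happens'[OF sequentially_bot] by blast
      \<comment> \<open>Only finitely many balls are involved, so one precision of
        \<open>v n\<close> makes it admissible for all of them.\<close>
      define J where "J = Max (insert 0 (j ` G k))"
      have J: "j i \<le> J" if "i \<in> G k" for i unfolding J_def using that Gfin by (intro Max_ge) auto
      have "0 < 1 / (real J + 1)" by simp
      from close[OF this, of "real J + 1"] obtain E where E: "\<And>n. E n \<in> sets P"
        "(\<lambda>n. measure P (E n)) \<longlonglongrightarrow> 1"
        "\<And>n w t. \<lbrakk>w \<in> E n; t \<in> {0..real J + 1}\<rbrakk> \<Longrightarrow> \<bar>v n w t - c * t\<bar> < 1 / (real J + 1)" by blast
      \<comment> \<open>The error is \<open>e\<close> when the path is in a good ball and the time
        change is accurate; otherwise the trivial bound \<open>2 * K\<close> is charged to whichever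
        of the two fails.\<close>
      let ?h = "\<lambda>n w. e + 2 * K * (1 - \<phi> k (V' n w)) + 2 * K * (1 - indicator (E n) w)"
      have bnd: "\<bar>(\<integral>w. F (X' n w) \<partial>P) - (\<integral>w. F (sc (V' n w)) \<partial>P)\<bar>
          \<le> e + 2 * K * (1 - (\<integral>w. \<phi> k (V' n w) \<partial>P)) + 2 * K * (1 - measure P (E n))" for n
      proof -
        have iE: "integrable P (\<lambda>w. indicator (E n) w :: real)"
          using E(1) by (simp add: integrable_real_indicator P.emeasure_eq_measure)
        have i\<phi>: "integrable P (\<lambda>w. \<phi> k (V' n w))"
          by (rule integrable_bounded_borel_of[OF P V'(1) \<phi>c, of _ 1]) (use \<phi>01 in auto)
        have "\<bar>(\<integral>w. F (X' n w) \<partial>P) - (\<integral>w. F (sc (V' n w)) \<partial>P)\<bar> \<le> (\<integral>w. ?h n w \<partial>P)"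
        proof (rule abs_integral_diff_le)
          show "integrable P (\<lambda>w. F (X' n w))"
            by (rule integrable_bounded_borel_of[OF P X'(1) F]) (use K in auto)
          show "integrable P (\<lambda>w. F (sc (V' n w)))"
            by (rule integrable_bounded_borel_of[OF P V'(1) Fsc]) (use K sc_sk in auto)
          show "integrable P (?h n)" using iE i\<phi> by simp
          show "AE w in P. \<bar>F (X' n w) - F (sc (V' n w))\<bar> \<le> ?h n w"
            using X'(2)[of n] V'(2)[of n] X[of n] AE_space
          proof eventually_elim
            case (elim w)
            have b: "\<bar>F (X' n w)\<bar> \<le> K" "\<bar>F (sc (V' n w))\<bar> \<le> K"
              using K(2) X's[OF elim(4)] sc_sk[OF V's[OF elim(4)]] by auto
            have b2: "\<bar>F (X' n w) - F (sc (V' n w))\<bar> \<le> 2 * K" using b by linarith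
            have nn: "0 \<le> 2 * K * (1 - \<phi> k (V' n w))" "0 \<le> 2 * K * (1 - indicator (E n) w)"
              using K(1) \<phi>01 by (auto simp: indicator_def)
            show ?case
            \<comment> \<open>It is enough that \<open>\<phi> k\<close> is nonzero: some gap is then
              positive, which already places the path in a good ball.\<close>
            proof (cases "w \<in> E n \<and> \<phi> k (V' n w) \<noteq> 0")
              case True
              have "\<exists>i\<in>G k. gap i (V' n w) \<noteq> 0"
              proof (rule ccontr)
                assume "\<not> ?thesis"
                then have "\<phi> k (V' n w) = 0" by (simp add: \<phi>_def)
                then show False using True by simp
              qed
              then obtain i where i: "i \<in> G k" "rho (V' n w) (p i) < 1 / (real (j i) + 1)"
                by (auto simp: gap_def max_def split: if_splits)
              have Ji: "1 / (real J + 1) \<le> 1 / (real (j i) + 1)"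
                using J[OF i(1)] by (intro divide_left_mono) auto
              have X'eq: "X' n w = (\<lambda>t\<in>{0..}. V' n w (v n w t))" using elim by simp
              have "admissible c (j i) (V' n w) (v n w)" unfolding admissible_def
              proof (intro conjI ballI)
                show "(\<lambda>t\<in>{0..}. V' n w (v n w t)) \<in> skorohod_space"
                  using X's[OF elim(4), of n] unfolding X'eq .
                fix t assume "t \<in> {0..real (j i) + 1}"
                then have "t \<in> {0..real J + 1}" using J[OF i(1)] by auto
                then show "\<bar>v n w t - c * t\<bar> < 1 / (real (j i) + 1)" using E(3)[of w n t] True Ji by simp
              qed (use elim in auto)
              then have "\<bar>F (X' n w) - F (sc (V' n w))\<bar> < e"
                using i V's[OF elim(4)] X'eq unfolding G_def good_def by auto
              then show ?thesis using nn by linarith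
            next
              case False
              then have "w \<notin> E n \<or> \<phi> k (V' n w) = 0" by blast
              then show ?thesis
              proof
                assume "w \<notin> E n"
                then have "2 * K * (1 - indicator (E n) w) = 2 * K" by simp
                then show ?thesis using b2 nn e by linarith
              next
                assume "\<phi> k (V' n w) = 0"
                then have "2 * K * (1 - \<phi> k (V' n w)) = 2 * K" by simp
                then show ?thesis using b2 nn e by linarith
              qed
            qed
          qed
        qed
        also have "\<dots> = e + 2 * K * (1 - (\<integral>w. \<phi> k (V' n w) \<partial>P)) + 2 * K * (1 - measure P (E n))"
          using iE i\<phi> sets.sets_into_space[OF E(1)[of n]] by (simp add: P.prob_space Int_absorb1 Int_absorb2)
        finally show ?thesis .
      qed
      \<comment> \<open>Since \<open>\<phi> k\<close> is bounded and continuous, the assumed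
        convergence transfers the mass bound from the limit to \<open>V' n\<close>.\<close>
      have "(\<lambda>n. e + 2 * K * (1 - (\<integral>w. \<phi> k (V' n w) \<partial>P)) + 2 * K * (1 - measure P (E n)))
          \<longlonglongrightarrow> e + 2 * K * (1 - (\<integral>w. \<phi> k (B' w) \<partial>W)) + 2 * K * (1 - 1)"
        by (intro tendsto_intros E(2) lim[OF \<phi>c \<phi>b])
      moreover have "e + 2 * K * (1 - (\<integral>w. \<phi> k (B' w) \<partial>W)) + 2 * K * (1 - 1) < \<epsilon>"
      proof -
        have "1 - (\<integral>w. \<phi> k (B' w) \<partial>W) < e / (2 * K)" using k by linarith
        then have "2 * K * (1 - (\<integral>w. \<phi> k (B' w) \<partial>W)) < e" using K(1) by (simp add: pos_less_divide_eq mult.commute)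
        then show ?thesis using e by (simp add: e_def)
      qed
      ultimately have "\<forall>\<^sub>F n in sequentially.
          e + 2 * K * (1 - (\<integral>w. \<phi> k (V' n w) \<partial>P)) + 2 * K * (1 - measure P (E n)) < \<epsilon>"
        by (rule order_tendstoD)
      then show "\<forall>\<^sub>F n in sequentially. dist ((\<integral>w. F (X' n w) \<partial>P) - (\<integral>w. F (sc (V' n w)) \<partial>P)) 0 < \<epsilon>"
      proof eventually_elim
        case (elim n) then show ?case using bnd[of n] by (simp add: dist_real_def)
      qed
    qed
    from tendsto_add[OF this lim_sc] show ?thesis by simp
  qed
  show ?thesis unfolding converges_in_distribution_def
  proof (intro exI[of _ X'] exI[of _ "\<lambda>w. sc (B' w)"] conjI allI impI X' meas_sc)
    show "AE w in W. sc (B' w) = (\<lambda>t\<in>{0..}. B w (c * t))"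
      using B'(2) by eventually_elim (simp add: sc_def)
  qed (use main in blast)
qed

section \<open>Point probabilities of the walk\<close>

primrec walk_pmf :: "'a :: ab_group_add pmf \<Rightarrow> nat \<Rightarrow> 'a pmf" where
  "walk_pmf \<nu> 0 = return_pmf 0"
| "walk_pmf \<nu> (Suc n) = bind_pmf (walk_pmf \<nu> n) (\<lambda>x. map_pmf ((+) x) \<nu>)"

lemma pmf_map_plus: "pmf (map_pmf ((+) x) q) z = pmf q (z - x :: 'a :: ab_group_add)"
  using pmf_map_inj'[of "(+) x" q "z - x"] by simp

lemma walk_pmf_add:
  "walk_pmf \<nu> (m + n) = bind_pmf (walk_pmf \<nu> n) (\<lambda>x. map_pmf ((+) x) (walk_pmf \<nu> m))"
proof (induction m)
  case 0 then show ?case by (simp add: bind_return_pmf')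
next
  case (Suc m)
  have "(+) (x + y) = (\<lambda>z. x + (y + z))" for x y :: 'a by (simp add: fun_eq_iff add.assoc)
  with Suc show ?case
    by (simp add: bind_assoc_pmf bind_map_pmf map_bind_pmf map_pmf_comp comp_def)
qed

lemma pmf_walk_add:
  "pmf (walk_pmf \<nu> (m + n)) z = (\<integral>x. pmf (walk_pmf \<nu> m) (z - x) \<partial>walk_pmf \<nu> n)"
  by (simp add: walk_pmf_add pmf_bind pmf_map_plus)

text \<open>Unlike the return probability, which may vanish at alternate times, the maximal point
  mass decreases along the walk and therefore has a limit.\<close>

definition max_prob :: "'a pmf \<Rightarrow> real" where "max_prob p = (SUP x. pmf p x)"

lemma pmf_le_max_prob: "pmf p x \<le> max_prob p"
  unfolding max_prob_def by (rule cSUP_upper) (auto intro!: bdd_aboveI2[where M = 1] pmf_le_1)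

text \<open>The point mass after \<open>m + n\<close> steps is an average of point masses after
  \<open>m\<close> steps, all at most \<open>c\<close>. A deficit at the single position
  \<open>y\<close> lowers this average by the weight of \<open>y\<close> times the deficit.\<close>

lemma pmf_convolution_gap:
  fixes \<nu> :: "'a :: ab_group_add pmf" and m :: nat
  defines "c \<equiv> max_prob (walk_pmf \<nu> m)"
  shows "pmf (walk_pmf \<nu> (m + n)) z \<le> c - pmf (walk_pmf \<nu> n) y * (c - pmf (walk_pmf \<nu> m) (z - y))"
proof -
  have int: "integrable (walk_pmf \<nu> n) (indicator {y} :: 'a \<Rightarrow> real)"
    by (rule measure_pmf.integrable_const_bound[where B = 1]) (auto simp: indicator_def)
  have "pmf (walk_pmf \<nu> (m + n)) z = (\<integral>x. pmf (walk_pmf \<nu> m) (z - x) \<partial>walk_pmf \<nu> n)"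
    by (rule pmf_walk_add)
  also have "\<dots> \<le> (\<integral>x. c - indicator {y} x * (c - pmf (walk_pmf \<nu> m) (z - y)) \<partial>walk_pmf \<nu> n)"
  proof (rule integral_mono)
    show "integrable (walk_pmf \<nu> n) (\<lambda>x. pmf (walk_pmf \<nu> m) (z - x))"
      by (rule measure_pmf.integrable_const_bound[where B = 1]) (auto simp: pmf_le_1)
    show "integrable (walk_pmf \<nu> n) (\<lambda>x. c - indicator {y} x * (c - pmf (walk_pmf \<nu> m) (z - y)))"
      using int by simp
    show "pmf (walk_pmf \<nu> m) (z - x) \<le> c - indicator {y} x * (c - pmf (walk_pmf \<nu> m) (z - y))" for x
      unfolding c_def by (cases "x = y") (auto simp: pmf_le_max_prob)
  qed
  also have "\<dots> = c - pmf (walk_pmf \<nu> n) y * (c - pmf (walk_pmf \<nu> m) (z - y))"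
    using int by (simp add: measure_pmf_single)
  finally show ?thesis .
qed

lemma max_prob_nonneg: "0 \<le> max_prob p"
  using pmf_le_max_prob[of p] pmf_nonneg[of p] order_trans by blast

lemma max_prob_walk_antimono: "max_prob (walk_pmf \<nu> (m + n)) \<le> max_prob (walk_pmf \<nu> m)"
proof -
  have "pmf (walk_pmf \<nu> (m + n)) z \<le> max_prob (walk_pmf \<nu> m)" for z
  proof -
    have "0 \<le> pmf (walk_pmf \<nu> n) 0 * (max_prob (walk_pmf \<nu> m) - pmf (walk_pmf \<nu> m) (z - 0))"
      by (intro mult_nonneg_nonneg) (auto simp: pmf_le_max_prob simp del: diff_zero)
    then show ?thesis using pmf_convolution_gap[of \<nu> m n z 0] by linarith
  qed
  then show ?thesis unfolding max_prob_def[of "walk_pmf \<nu> (m + n)"] by (intro cSUP_least) auto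
qed

text \<open>Where a walk stands after \<open>i\<close> steps equal to \<open>a\<close> and
  \<open>j\<close> steps equal to \<open>b\<close>, in whatever order.\<close>

definition lattice_point :: "nat \<Rightarrow> nat \<Rightarrow> int ^ 'd \<Rightarrow> int ^ 'd \<Rightarrow> int ^ 'd" where
  "lattice_point i j a b = (\<chi> l. int i * a $ l + int j * b $ l)"

lemma lattice_point_in_walk_pmf:
  assumes "a \<in> set_pmf \<nu>" "b \<in> set_pmf \<nu>"
  shows "lattice_point i j a b \<in> set_pmf (walk_pmf \<nu> (i + j))"
proof (induction i)
  case 0
  show ?case
  proof (induction j)
    case 0 then show ?case by (auto simp: lattice_point_def vec_eq_iff)
  next
    case (Suc j)
    have "lattice_point 0 (Suc j) a b = lattice_point 0 j a b + b"
      by (simp add: lattice_point_def vec_eq_iff algebra_simps)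
    then show ?case using Suc assms by auto
  qed
next
  case (Suc i)
  have "lattice_point (Suc i) j a b = lattice_point i j a b + a"
    by (simp add: lattice_point_def vec_eq_iff algebra_simps)
  then show ?case using Suc assms by auto
qed

text \<open>If the maximal point probability of the walk had a positive limit, then a near-maximiser would
  force almost the same probability on its translates by all the points of the support of a later
  step, of which there are arbitrarily many.\<close>
lemma max_prob_walk_tendsto_0:
  fixes \<nu> :: "(int ^ 'd) pmf"
  assumes ab: "a \<in> set_pmf \<nu>" "b \<in> set_pmf \<nu>" "a \<noteq> b"
  shows "(\<lambda>n. max_prob (walk_pmf \<nu> n)) \<longlonglongrightarrow> 0"
proof -
  define c where "c n = max_prob (walk_pmf \<nu> n)" for n
  have dec: "decseq c" unfolding decseq_def c_def
    using max_prob_walk_antimono[of \<nu>] by (metis le_add_diff_inverse)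
  obtain L where L: "c \<longlonglongrightarrow> L" "\<And>n. L \<le> c n"
    using decseq_convergent[OF dec, of 0] max_prob_nonneg by (auto simp: c_def)
  have "0 \<le> L" using L(1) by (rule LIMSEQ_le_const) (auto simp: c_def max_prob_nonneg)
  moreover have "\<not> 0 < L"
  proof
    assume pos: "0 < L"
    \<comment> \<open>So large that \<open>h + 1\<close> distinct points of mass at least
      \<open>L / 2\<close> would have total mass above 1.\<close>
    obtain h :: nat where h: "2 / L < real h" using reals_Archimedean2 by blast
    define y where "y j = lattice_point j (h - j) a b" for j
    define w where "w = Min ((\<lambda>j. pmf (walk_pmf \<nu> h) (y j)) ` {..h})"
    have ypos: "0 < pmf (walk_pmf \<nu> h) (y j)" if "j \<le> h" for j
      using lattice_point_in_walk_pmf[OF ab(1,2), of j "h - j"] that by (simp add: y_def pmf_positive)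
    have w: "0 < w" "\<And>j. j \<le> h \<Longrightarrow> w \<le> pmf (walk_pmf \<nu> h) (y j)"
      using ypos by (auto simp: w_def)
    obtain l where l: "a $ l \<noteq> b $ l" using ab(3) by (auto simp: vec_eq_iff)
    have inj: "inj_on y {..h}"
    proof (rule inj_onI)
      fix i j assume ij: "i \<in> {..h}" "j \<in> {..h}" "y i = y j"
      then have "int i * a $ l + int (h - i) * b $ l = int j * a $ l + int (h - j) * b $ l"
        by (simp add: y_def lattice_point_def vec_eq_iff)
      then have "(int i - int j) * (a $ l - b $ l) = 0" using ij by (simp add: of_nat_diff algebra_simps)
      then show "i = j" using l by simp
    qed
    \<comment> \<open>The margins \<open>w * L / 4\<close> here and in the choice of
      \<open>z\<close> leave less than \<open>w * L / 2\<close> between \<open>c m\<close> and the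
      mass at \<open>z\<close>. A deficit of \<open>L / 2\<close> at a point of weight at least
      \<open>w\<close> would need that much.\<close>
    have "\<forall>\<^sub>F n in sequentially. c n < L + w * L / 4"
      using L(1) w(1) pos by (intro order_tendstoD) auto
    then obtain m where m: "c m < L + w * L / 4"
      using eventually_happens'[OF sequentially_bot] by blast
    have "c (m + h) - w * L / 4 < (SUP x. pmf (walk_pmf \<nu> (m + h)) x)"
      using w(1) pos by (simp add: c_def max_prob_def)
    then obtain z where z: "c (m + h) - w * L / 4 < pmf (walk_pmf \<nu> (m + h)) z"
      by (auto simp: less_cSUP_iff bdd_aboveI2[where M = 1] pmf_le_1)
    have big: "L / 2 \<le> pmf (walk_pmf \<nu> m) (z - y j)" if j: "j \<le> h" for j
    proof (rule ccontr)
      assume "\<not> ?thesis"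
      then have "L / 2 < c m - pmf (walk_pmf \<nu> m) (z - y j)" using L(2)[of m] by linarith
      then have "w * (L / 2) \<le> pmf (walk_pmf \<nu> h) (y j) * (c m - pmf (walk_pmf \<nu> m) (z - y j))"
        using w(1) w(2)[OF j] pos by (intro mult_mono) auto
      then have "pmf (walk_pmf \<nu> (m + h)) z \<le> c m - w * (L / 2)"
        using pmf_convolution_gap[of \<nu> m h z "y j"] by (simp add: c_def)
      then show False using z m L(2)[of "m + h"] by simp
    qed
    have "real (h + 1) * (L / 2) = (\<Sum>j\<le>h. L / 2)" by simp
    also have "\<dots> \<le> (\<Sum>j\<le>h. pmf (walk_pmf \<nu> m) (z - y j))" using big by (intro sum_mono) auto
    also have "\<dots> = (\<Sum>x\<in>(\<lambda>j. z - y j) ` {..h}. pmf (walk_pmf \<nu> m) x)"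
      using inj by (subst sum.reindex) (auto simp: inj_on_def)
    also have "\<dots> \<le> 1" by (simp add: measure_measure_pmf_finite[symmetric])
    finally have "real (h + 1) * L \<le> 2" by simp
    moreover have "2 < real h * L" using h pos by (simp add: pos_divide_less_eq)
    ultimately show False using pos by (simp add: algebra_simps)
  qed
  ultimately have "L = 0" by simp
  then show ?thesis using L(1) by (simp add: c_def[abs_def])
qed

text \<open>Two different possible steps make the walk spread out; with a single one, which is then
  nonzero, the walk is deterministic and never returns.\<close>

lemma walk_return_prob_tendsto_0:
  fixes \<nu> :: "(int ^ 'd) pmf"
  assumes "\<nu> \<noteq> return_pmf 0"
  shows "(\<lambda>n. pmf (walk_pmf \<nu> n) 0) \<longlonglongrightarrow> 0"
proof (cases "\<exists>a\<in>set_pmf \<nu>. \<exists>b\<in>set_pmf \<nu>. a \<noteq> b")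
  case True
  then have "(\<lambda>n. max_prob (walk_pmf \<nu> n)) \<longlonglongrightarrow> 0" using max_prob_walk_tendsto_0 by blast
  show ?thesis
    by (rule tendsto_sandwich[OF _ _ tendsto_const \<open>(\<lambda>n. max_prob (walk_pmf \<nu> n)) \<longlonglongrightarrow> 0\<close>])
      (auto simp: pmf_le_max_prob)
next
  case False
  obtain a where "a \<in> set_pmf \<nu>" using set_pmf_not_empty[of \<nu>] by blast
  with False have "set_pmf \<nu> = {a}" by auto
  then have \<nu>: "\<nu> = return_pmf a" by (simp add: set_pmf_subset_singleton[symmetric])
  then have "a \<noteq> 0" using assms by auto
  then obtain l where l: "a $ l \<noteq> 0" by (auto simp: vec_eq_iff)
  have w: "walk_pmf \<nu> n = return_pmf (\<chi> l. int n * a $ l)" for n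
  proof (induction n)
    case (Suc n)
    then show ?case by (simp add: \<nu> bind_return_pmf) (simp add: vec_eq_iff algebra_simps)
  qed (simp add: zero_vec_def)
  have "\<forall>\<^sub>F n in sequentially. pmf (walk_pmf \<nu> n) 0 = 0"
    using eventually_gt_at_top[of 0]
    by eventually_elim (use l in \<open>auto simp: w vec_eq_iff indicator_def\<close>)
  then show ?thesis by (rule tendsto_eventually)
qed

text \<open>For each \<open>j\<close> at most \<open>2 * m\<close> indices \<open>k\<close> are
  close to \<open>j\<close>, and they vanish in the average; at all the others \<open>u\<close> is
  below \<open>e / 2\<close>.\<close>

lemma double_average_tendsto_0:
  fixes u :: "nat \<Rightarrow> real"
  assumes u: "u \<longlonglongrightarrow> 0" "\<And>n. 0 \<le> u n" "\<And>n. u n \<le> 1"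
  shows "(\<lambda>n. (\<Sum>j<n. \<Sum>k<n. u (nat \<bar>int j - int k\<bar>)) / (real n)\<^sup>2) \<longlonglongrightarrow> 0"
proof (rule tendstoI)
  fix e :: real assume e: "0 < e"
  have "\<forall>\<^sub>F n in sequentially. u n < e / 2" using u(1) e by (intro order_tendstoD) auto
  then obtain m where m: "\<And>n. m \<le> n \<Longrightarrow> u n < e / 2" by (auto simp: eventually_sequentially)
  have row: "(\<Sum>k<n. u (nat \<bar>int j - int k\<bar>)) \<le> 2 * real m + real n * (e / 2)" for j n
  proof -
    have "(\<Sum>k<n. u (nat \<bar>int j - int k\<bar>)) \<le> (\<Sum>k<n. (if k \<in> {j - m..<j + m} then 1 else 0) + e / 2)"
    proof (rule sum_mono)
      fix k assume "k \<in> {..<n}"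
      show "u (nat \<bar>int j - int k\<bar>) \<le> (if k \<in> {j - m..<j + m} then 1 else 0) + e / 2"
      proof (cases "k \<in> {j - m..<j + m}")
        case True then show ?thesis using u(3)[of "nat \<bar>int j - int k\<bar>"] e by simp
      next
        case False
        then have "m \<le> nat \<bar>int j - int k\<bar>" by auto
        then show ?thesis using m False by (auto intro: less_imp_le)
      qed
    qed
    also have "\<dots> = real (card ({..<n} \<inter> {j - m..<j + m})) + real n * (e / 2)"
      by (simp only: sum.distrib sum.If_cases finite_lessThan Collect_mem_eq) simp
    also have "card ({..<n} \<inter> {j - m..<j + m}) \<le> card {j - m..<j + m}" by (intro card_mono) auto
    then have "real (card ({..<n} \<inter> {j - m..<j + m})) \<le> 2 * real m" by simp
    finally show ?thesis by simp
  qed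
  have bound: "(\<Sum>j<n. \<Sum>k<n. u (nat \<bar>int j - int k\<bar>)) / (real n)\<^sup>2 \<le> 2 * real m / real n + e / 2" if "0 < n" for n
  proof -
    have "(\<Sum>j<n. \<Sum>k<n. u (nat \<bar>int j - int k\<bar>)) \<le> (\<Sum>j<n. 2 * real m + real n * (e / 2))"
      by (intro sum_mono row)
    also have "\<dots> = (2 * real m / real n + e / 2) * (real n)\<^sup>2"
      using that by (simp add: power2_eq_square field_simps)
    finally show ?thesis using that by (simp add: pos_divide_le_eq)
  qed
  have "(\<lambda>n. 2 * real m / real n + e / 2) \<longlonglongrightarrow> 0 + e / 2"
    by (intro tendsto_intros lim_const_over_n)
  then have "\<forall>\<^sub>F n in sequentially. 2 * real m / real n + e / 2 < e"
    by (rule order_tendstoD) (use e in simp)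
  then show "\<forall>\<^sub>F n in sequentially. dist ((\<Sum>j<n. \<Sum>k<n. u (nat \<bar>int j - int k\<bar>)) / (real n)\<^sup>2) 0 < e"
    using eventually_gt_at_top[of 0]
  proof eventually_elim
    case (elim n)
    moreover have "0 \<le> (\<Sum>j<n. \<Sum>k<n. u (nat \<bar>int j - int k\<bar>)) / (real n)\<^sup>2"
      by (intro divide_nonneg_nonneg sum_nonneg u(2)) auto
    ultimately show ?case using bound[of n] by (simp add: dist_real_def)
  qed
qed

section \<open>A weak law of large numbers\<close>

lemma truncation_error_tendsto_0:
  assumes "integrable \<eta> (\<lambda>u. u :: real)" "sets \<eta> = sets borel"
  shows "(\<lambda>K. \<integral>u. \<bar>u - max (- real K) (min u (real K))\<bar> \<partial>\<eta>) \<longlonglongrightarrow> 0"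
proof -
  have "(\<lambda>K. \<integral>u. \<bar>u - max (- real K) (min u (real K))\<bar> \<partial>\<eta>) \<longlonglongrightarrow> (\<integral>u. 0 \<partial>\<eta>)"
  proof (rule integral_dominated_convergence[where w = "\<lambda>u. \<bar>u\<bar>"])
    have [measurable_cong]: "sets \<eta> = sets borel" by fact
    show "(\<lambda>u. \<bar>u - max (- real K) (min u (real K))\<bar>) \<in> borel_measurable \<eta>" for K by measurable
    show "integrable \<eta> (\<lambda>u. \<bar>u\<bar>)" using assms(1) by simp
    show "AE u in \<eta>. norm \<bar>u - max (- real K) (min u (real K))\<bar> \<le> \<bar>u\<bar>" for K
      by (auto intro!: AE_I2 simp: max_def min_def)
    show "AE u in \<eta>. (\<lambda>K. \<bar>u - max (- real K) (min u (real K))\<bar>) \<longlonglongrightarrow> 0"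
    proof (rule AE_I2)
      fix u :: real
      obtain N :: nat where N: "\<bar>u\<bar> \<le> real N" using real_arch_simple by blast
      have "\<forall>\<^sub>F K in sequentially. \<bar>u - max (- real K) (min u (real K))\<bar> = 0"
        using eventually_ge_at_top[of N]
      proof eventually_elim
        case (elim K)
        then have "real N \<le> real K" by simp
        then show ?case using N by (auto simp: max_def min_def)
      qed
      then show "(\<lambda>K. \<bar>u - max (- real K) (min u (real K))\<bar>) \<longlonglongrightarrow> 0" by (rule tendsto_eventually)
    qed
  qed simp
  then show ?thesis by simp
qed

text \<open>After truncation at \<open>K\<close> and centring, products have mean zero off
  \<open>D j k\<close> and are at most \<open>4 * (real K)\<^sup>2\<close> on it, so the second
  moment of the sum is controlled by the probabilities of the events \<open>D j k\<close>. The
  assumption \<open>uncorr\<close> ranges over all bounded centred \<open>h\<close> because the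
  truncation level depends on \<open>e\<close>.\<close>

lemma (in prob_space) weak_law_uncorrelated_off_collisions:
  fixes \<sigma> :: "nat \<Rightarrow> 'a \<Rightarrow> real"
  assumes \<sigma>: "\<And>k. \<sigma> k \<in> borel_measurable M" and law: "\<And>k. distr M borel (\<sigma> k) = \<eta>"
    and int: "integrable \<eta> (\<lambda>u. u)"
    and D: "\<And>j k. D j k \<in> events"
    and uncorr: "\<And>h K j k. \<lbrakk>h \<in> borel_measurable borel; \<And>u. \<bar>h u\<bar> \<le> K; (\<integral>u. h u \<partial>\<eta>) = 0\<rbrakk> \<Longrightarrow>
       (\<integral>w. h (\<sigma> j w) * h (\<sigma> k w) * indicator (space M - D j k) w \<partial>M) = (0 :: real)"
    and coll: "(\<lambda>n. (\<Sum>j<n. \<Sum>k<n. prob (D j k)) / (real n)\<^sup>2) \<longlonglongrightarrow> 0"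
  shows "(\<lambda>n. (\<integral>w. \<bar>(\<Sum>k<n. \<sigma> k w) - real n * (\<integral>u. u \<partial>\<eta>)\<bar> \<partial>M) / real n) \<longlonglongrightarrow> 0"
proof (rule tendstoI)
  fix e :: real assume e: "0 < e"
  note [measurable] = \<sigma>
  let ?m = "\<integral>u. u \<partial>\<eta>"
  have sets_\<eta>: "sets \<eta> = sets borel" using law[of 0] by auto
  have [measurable_cong]: "sets \<eta> = sets borel" by fact
  interpret \<eta>: prob_space \<eta> using prob_space_distr[OF \<sigma>[of 0]] law by simp
  have intd: "integrable M (\<lambda>w. f (\<sigma> k w))" "(\<integral>w. f (\<sigma> k w) \<partial>M) = (\<integral>u. f u \<partial>\<eta>)"
    if "integrable \<eta> f" for f :: "real \<Rightarrow> real" and k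
  proof -
    have [measurable]: "f \<in> borel_measurable borel" using borel_measurable_integrable[OF that]
      by (simp cong: measurable_cong_sets)
    show "integrable M (\<lambda>w. f (\<sigma> k w))" using that unfolding law[of k, symmetric]
      by (subst (asm) integrable_distr_eq) auto
    show "(\<integral>w. f (\<sigma> k w) \<partial>M) = (\<integral>u. f u \<partial>\<eta>)" unfolding law[of k, symmetric]
      by (subst integral_distr) auto
  qed
  have "0 < e / 5" using e by simp
  from order_tendstoD(2)[OF truncation_error_tendsto_0[OF int sets_\<eta>] this]
  obtain K :: nat where K: "(\<integral>u. \<bar>u - max (- real K) (min u (real K))\<bar> \<partial>\<eta>) < e / 5"
    using eventually_happens'[OF sequentially_bot] by blast
  define g where "g u = max (- real K) (min u (real K))" for u
  have g: "\<bar>g u\<bar> \<le> real K" for u by (auto simp: g_def max_def min_def)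
  have [measurable]: "g \<in> borel_measurable borel" unfolding g_def by measurable
  have ig: "integrable \<eta> g"
    by (rule \<eta>.integrable_const_bound[where B = "real K"]) (use g in auto)
  have ir: "integrable \<eta> (\<lambda>u. \<bar>u - g u\<bar>)" using ig int by simp
  \<comment> \<open>\<open>R\<close> is paid twice, for truncating the summands and for truncating
    their mean.\<close>
  define R where "R = (\<integral>u. \<bar>u - g u\<bar> \<partial>\<eta>)"
  have R: "R < e / 5" using K by (simp add: R_def g_def)
  define a where "a = (\<integral>u. g u \<partial>\<eta>)"
  have am: "\<bar>a - ?m\<bar> \<le> R" unfolding a_def R_def
    using ig int ir by (intro abs_integral_diff_le) (auto simp: abs_minus_commute)
  define h where "h u = g u - a" for u
  have "\<bar>a\<bar> \<le> (\<integral>u. real K \<partial>\<eta>)" unfolding a_def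
    using abs_integral_diff_le[OF ig _ _, of "\<lambda>_. 0" "\<lambda>_. real K"] g by simp
  then have "\<bar>a\<bar> \<le> real K" by (simp add: \<eta>.prob_space)
  then have hb: "\<bar>h u\<bar> \<le> 2 * real K" for u using g[of u] unfolding h_def by linarith
  have [measurable]: "h \<in> borel_measurable borel" unfolding h_def by measurable
  have h0: "(\<integral>u. h u \<partial>\<eta>) = 0" unfolding h_def using ig by (simp add: a_def \<eta>.prob_space)
  have ihh: "integrable M (\<lambda>w. h (\<sigma> j w) * h (\<sigma> k w) * indicator A w)" if "A \<in> events" for A j k
  proof (rule integrable_const_bound[where B = "2 * real K * (2 * real K)"], rule AE_I2)
    fix w
    have "\<bar>h (\<sigma> j w)\<bar> * \<bar>h (\<sigma> k w)\<bar> \<le> 2 * real K * (2 * real K)" using hb by (intro mult_mono) auto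
    then show "norm (h (\<sigma> j w) * h (\<sigma> k w) * indicator A w) \<le> 2 * real K * (2 * real K)"
      by (auto simp: indicator_def abs_mult)
  qed (use that in measurable)
  have cov: "(\<integral>w. h (\<sigma> j w) * h (\<sigma> k w) \<partial>M) \<le> 4 * (real K)\<^sup>2 * prob (D j k)" for j k
  proof -
    have "(\<integral>w. h (\<sigma> j w) * h (\<sigma> k w) \<partial>M)
        = (\<integral>w. h (\<sigma> j w) * h (\<sigma> k w) * indicator (space M - D j k) w
            + h (\<sigma> j w) * h (\<sigma> k w) * indicator (D j k) w \<partial>M)"
      by (intro Bochner_Integration.integral_cong) (auto simp: indicator_def)
    also have "\<dots> = (\<integral>w. h (\<sigma> j w) * h (\<sigma> k w) * indicator (D j k) w \<partial>M)"
      using D uncorr[OF _ hb h0] by (subst Bochner_Integration.integral_add) (auto intro!: ihh)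
    also have "\<dots> \<le> (\<integral>w. 4 * (real K)\<^sup>2 * indicator (D j k) w \<partial>M)"
    proof (rule integral_mono)
      show "integrable M (\<lambda>w. 4 * (real K)\<^sup>2 * indicator (D j k) w)"
        using D by (intro integrable_mult_right integrable_real_indicator) (auto simp: emeasure_eq_measure)
      fix w
      have "h (\<sigma> j w) * h (\<sigma> k w) \<le> \<bar>h (\<sigma> j w)\<bar> * \<bar>h (\<sigma> k w)\<bar>" by (simp flip: abs_mult)
      also have "\<dots> \<le> 2 * real K * (2 * real K)" using hb by (intro mult_mono) auto
      finally show "h (\<sigma> j w) * h (\<sigma> k w) * indicator (D j k) w \<le> 4 * (real K)\<^sup>2 * indicator (D j k) w"
        by (simp add: indicator_def power2_eq_square)
    qed (use D in \<open>auto intro!: ihh\<close>)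
    also have "\<dots> = 4 * (real K)\<^sup>2 * prob (D j k)"
      using sets.sets_into_space[OF D] by (simp add: Int_absorb1 Int_absorb2)
    finally show ?thesis .
  qed
  define \<delta> where "\<delta> n = (\<Sum>j<n. \<Sum>k<n. prob (D j k)) / (real n)\<^sup>2" for n
  have ih: "integrable M (\<lambda>w. h (\<sigma> k w))" for k
    by (rule intd) (use ig in \<open>simp add: h_def[abs_def]\<close>)
  have ihh': "integrable M (\<lambda>w. h (\<sigma> j w) * h (\<sigma> k w))" for j k
    using ihh[OF sets.top, of j k] by (simp cong: Bochner_Integration.integrable_cong)
  have main: "(\<integral>w. \<bar>(\<Sum>k<n. \<sigma> k w) - real n * ?m\<bar> \<partial>M) / real n \<le> e / 5 + 5 * (real K)\<^sup>2 * \<delta> n / e + 2 * R"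
    if n: "0 < n" for n
  proof -
    define H where "H w = (\<Sum>k<n. h (\<sigma> k w))" for w
    \<comment> \<open>The first moment of \<open>H\<close> is reached from the second through
      \<open>\<bar>H w\<bar> \<le> b / 2 + (H w)\<^sup>2 / (2 * b)\<close>. This \<open>b\<close>
      makes the first term \<open>e / 5\<close> per summand, and the second vanishes with
      \<open>\<delta> n\<close>.\<close>
    define b where "b = real n * (2 * e / 5)"
    have b: "0 < b" using n e by (simp add: b_def)
    have H2: "(H w)\<^sup>2 = (\<Sum>j<n. \<Sum>k<n. h (\<sigma> j w) * h (\<sigma> k w))" for w
      by (simp add: H_def power2_eq_square sum_product)
    have iH2: "integrable M (\<lambda>w. (H w)\<^sup>2)" unfolding H2 by (intro Bochner_Integration.integrable_sum ihh')
    have "(\<integral>w. (H w)\<^sup>2 \<partial>M) = (\<Sum>j<n. \<Sum>k<n. \<integral>w. h (\<sigma> j w) * h (\<sigma> k w) \<partial>M)"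
      unfolding H2 by (subst Bochner_Integration.integral_sum; intro sum.cong refl Bochner_Integration.integrable_sum ihh')
        (subst Bochner_Integration.integral_sum; auto intro!: ihh')
    also have "\<dots> \<le> (\<Sum>j<n. \<Sum>k<n. 4 * (real K)\<^sup>2 * prob (D j k))" by (intro sum_mono cov)
    also have "\<dots> = 4 * (real K)\<^sup>2 * (\<delta> n * (real n)\<^sup>2)" using n by (simp add: \<delta>_def sum_distrib_left)
    finally have EH2: "(\<integral>w. (H w)\<^sup>2 \<partial>M) \<le> 4 * (real K)\<^sup>2 * (\<delta> n * (real n)\<^sup>2)" .
    have ir': "integrable M (\<lambda>w. \<bar>\<sigma> k w - g (\<sigma> k w)\<bar>)" "(\<integral>w. \<bar>\<sigma> k w - g (\<sigma> k w)\<bar> \<partial>M) = R" for k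
      using intd[OF ir, of k] by (auto simp: R_def)
    have "(\<integral>w. \<bar>(\<Sum>k<n. \<sigma> k w) - real n * ?m\<bar> \<partial>M)
        \<le> (\<integral>w. (b / 2 + (H w)\<^sup>2 / (2 * b)) + (\<Sum>k<n. \<bar>\<sigma> k w - g (\<sigma> k w)\<bar>) + real n * R \<partial>M)"
    proof (rule integral_mono)
      show "integrable M (\<lambda>w. \<bar>(\<Sum>k<n. \<sigma> k w) - real n * ?m\<bar>)"
        using intd(1)[OF int] by (intro integrable_abs Bochner_Integration.integrable_diff Bochner_Integration.integrable_sum) auto
      show "integrable M (\<lambda>w. (b / 2 + (H w)\<^sup>2 / (2 * b)) + (\<Sum>k<n. \<bar>\<sigma> k w - g (\<sigma> k w)\<bar>) + real n * R)"
        using iH2 ir' by (intro Bochner_Integration.integrable_add Bochner_Integration.integrable_sum) auto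
      fix w
      have "(\<Sum>k<n. \<sigma> k w) - real n * ?m = H w + (\<Sum>k<n. \<sigma> k w - g (\<sigma> k w)) + real n * (a - ?m)"
        by (simp add: H_def h_def sum_subtractf algebra_simps)
      also have "\<bar>\<dots>\<bar> \<le> \<bar>H w\<bar> + (\<Sum>k<n. \<bar>\<sigma> k w - g (\<sigma> k w)\<bar>) + real n * R"
      proof -
        have "\<bar>real n * (a - ?m)\<bar> \<le> real n * R" using am by (simp add: abs_mult mult_left_mono)
        moreover have "\<bar>\<Sum>k<n. \<sigma> k w - g (\<sigma> k w)\<bar> \<le> (\<Sum>k<n. \<bar>\<sigma> k w - g (\<sigma> k w)\<bar>)" by (rule sum_abs)
        ultimately show ?thesis by linarith
      qed
      also have "\<bar>H w\<bar> \<le> b / 2 + (H w)\<^sup>2 / (2 * b)"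
      proof -
        have "0 \<le> (b - \<bar>H w\<bar>)\<^sup>2" by simp
        then have "2 * b * \<bar>H w\<bar> \<le> b\<^sup>2 + (H w)\<^sup>2" by (simp add: power2_diff)
        then have "\<bar>H w\<bar> \<le> (b\<^sup>2 + (H w)\<^sup>2) / (2 * b)" using b by (simp add: pos_le_divide_eq mult.commute)
        also have "\<dots> = b / 2 + (H w)\<^sup>2 / (2 * b)" using b by (simp add: field_simps power2_eq_square)
        finally show ?thesis .
      qed
      finally show "\<bar>(\<Sum>k<n. \<sigma> k w) - real n * ?m\<bar>
          \<le> (b / 2 + (H w)\<^sup>2 / (2 * b)) + (\<Sum>k<n. \<bar>\<sigma> k w - g (\<sigma> k w)\<bar>) + real n * R" by simp
    qed
    also have "\<dots> = b / 2 + (\<integral>w. (H w)\<^sup>2 \<partial>M) / (2 * b) + real n * R + real n * R"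
      using iH2 ir' by (simp add: prob_space)
    also have "\<dots> \<le> b / 2 + 4 * (real K)\<^sup>2 * (\<delta> n * (real n)\<^sup>2) / (2 * b) + real n * R + real n * R"
      using EH2 b by (intro add_mono divide_right_mono) auto
    also have "\<dots> \<le> (e / 5 + 5 * (real K)\<^sup>2 * \<delta> n / e + 2 * R) * real n"
    proof -
      have "4 * (real K)\<^sup>2 * (\<delta> n * (real n)\<^sup>2) / (2 * b) = 5 * (real K)\<^sup>2 * \<delta> n / e * real n"
        using n e by (simp add: b_def field_simps power2_eq_square)
      then show ?thesis by (simp only:) (simp add: b_def algebra_simps)
    qed
    finally show ?thesis using n by (simp add: pos_divide_le_eq)
  qed
  have "(\<lambda>n. e / 5 + 5 * (real K)\<^sup>2 * \<delta> n / e + 2 * R) \<longlonglongrightarrow> e / 5 + 5 * (real K)\<^sup>2 * 0 / e + 2 * R"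
    unfolding \<delta>_def using e by (intro tendsto_intros coll) auto
  then have "\<forall>\<^sub>F n in sequentially. e / 5 + 5 * (real K)\<^sup>2 * \<delta> n / e + 2 * R < e"
    by (rule order_tendstoD) (use R e in simp)
  then show "\<forall>\<^sub>F n in sequentially. dist ((\<integral>w. \<bar>(\<Sum>k<n. \<sigma> k w) - real n * ?m\<bar> \<partial>M) / real n) 0 < e"
    using eventually_gt_at_top[of 0]
  proof eventually_elim
    case (elim n)
    have "0 \<le> (\<integral>w. \<bar>(\<Sum>k<n. \<sigma> k w) - real n * ?m\<bar> \<partial>M) / real n" by simp
    then show ?case using main[OF elim(2)] elim(1) unfolding dist_real_def by linarith
  qed
qed

section \<open>Sojourn times\<close>

lemma measurable_map_PiM_count_space:
  assumes "set xs \<subseteq> I"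
  shows "(\<lambda>s. map s xs) \<in> PiM I (\<lambda>_. count_space (UNIV :: 'a :: countable set)) \<rightarrow>\<^sub>M count_space UNIV"
  using assms
proof (induction xs)
  case (Cons x xs)
  have "(\<lambda>s. (\<lambda>a s. a # map s xs) (s x) s) \<in> PiM I (\<lambda>_. count_space (UNIV :: 'a set)) \<rightarrow>\<^sub>M count_space UNIV"
  proof (rule measurable_compose_countable[where f = "\<lambda>a s. a # map s xs" and g = "\<lambda>s. s x"])
    fix a :: 'a
    show "(\<lambda>s. a # map s xs) \<in> PiM I (\<lambda>_. count_space (UNIV :: 'a set)) \<rightarrow>\<^sub>M count_space UNIV"
      by (rule measurable_compose[OF Cons.IH]) (use Cons.prems in auto)
  qed (use Cons.prems in \<open>auto intro!: measurable_component_singleton\<close>)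
  then show ?case by simp
qed simp

text \<open>Such a function factors through a finite list of coordinates. These lists form a
  countable discrete space, on which every function is measurable.\<close>

lemma measurable_PiM_count_space_finite_dependence:
  fixes f :: "('i \<Rightarrow> 'a :: countable) \<Rightarrow> 'b"
  assumes "finite J" "J \<subseteq> I" and dep: "\<And>s s'. (\<And>i. i \<in> J \<Longrightarrow> s i = s' i) \<Longrightarrow> f s = f s'"
  shows "f \<in> PiM I (\<lambda>_. count_space UNIV) \<rightarrow>\<^sub>M count_space UNIV"
proof -
  obtain xs where xs: "set xs = J" using finite_list[OF assms(1)] by blast
  define F where "F l = f (SOME s. map s xs = l)" for l
  have "f s = F (map s xs)" for s
  proof -
    have "map (SOME s'. map s' xs = map s xs) xs = map s xs" by (rule someI[of "\<lambda>s'. map s' xs = map s xs" s]) (rule refl)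
    then have "\<And>i. i \<in> J \<Longrightarrow> (SOME s'. map s' xs = map s xs) i = s i" using xs by simp
    then show ?thesis unfolding F_def by (intro dep) auto
  qed
  then have "f = (\<lambda>s. F (map s xs))" by auto
  moreover have "(\<lambda>s. F (map s xs)) \<in> PiM I (\<lambda>_. count_space UNIV) \<rightarrow>\<^sub>M count_space UNIV"
    by (rule measurable_compose[OF measurable_map_PiM_count_space]) (use xs assms(2) in auto)
  ultimately show ?thesis by simp
qed

text \<open>If the events \<open>E i\<close> all have the same conditional probability
  \<open>q\<close> given \<open>Z = i\<close> within \<open>D\<close>, the index may be made random.
  This carries statements about a fixed trap variable over to the one that the walk meets.\<close>

lemma (in prob_space) emeasure_countable_mixture:
  fixes Z :: "'a \<Rightarrow> 'i :: countable"
  assumes Z: "Z \<in> M \<rightarrow>\<^sub>M count_space UNIV" and E: "\<And>i. E i \<in> events" and D: "D \<in> events"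
    and eq: "\<And>i. emeasure M {w \<in> space M. w \<in> E i \<and> Z w = i \<and> w \<in> D}
      = q * emeasure M {w \<in> space M. Z w = i \<and> w \<in> D}"
  shows "emeasure M {w \<in> space M. w \<in> E (Z w) \<and> w \<in> D} = q * emeasure M D"
proof -
  note [measurable] = Z E D
  have "{w \<in> space M. w \<in> E (Z w) \<and> w \<in> D} = (\<Union>i. {w \<in> space M. w \<in> E i \<and> Z w = i \<and> w \<in> D})" by auto
  also have "emeasure M \<dots> = (\<integral>\<^sup>+i. emeasure M {w \<in> space M. w \<in> E i \<and> Z w = i \<and> w \<in> D} \<partial>count_space UNIV)"
    by (rule emeasure_UN_countable) (auto simp: disjoint_family_on_def)
  also have "\<dots> = q * (\<integral>\<^sup>+i. emeasure M {w \<in> space M. Z w = i \<and> w \<in> D} \<partial>count_space UNIV)"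
    unfolding eq by (rule nn_integral_cmult) simp
  also have "(\<integral>\<^sup>+i. emeasure M {w \<in> space M. Z w = i \<and> w \<in> D} \<partial>count_space UNIV)
      = emeasure M (\<Union>i. {w \<in> space M. Z w = i \<and> w \<in> D})"
    by (rule emeasure_UN_countable[symmetric]) (auto simp: disjoint_family_on_def)
  also have "(\<Union>i. {w \<in> space M. Z w = i \<and> w \<in> D}) = D" using sets.sets_into_space[OF D] by auto
  finally show ?thesis .
qed

section \<open>Sojourn times and the clock\<close>

definition visit_count :: "(nat \<Rightarrow> 'w \<Rightarrow> int ^ 'd) \<Rightarrow> nat \<Rightarrow> 'w \<Rightarrow> nat" where
  "visit_count \<xi> k \<omega> = card {j. j < k \<and> walk \<xi> j \<omega> = walk \<xi> k \<omega>}"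

text \<open>\<open>visit_count\<close> leaves out time \<open>k\<close> itself, and the trap
  variables of a site are numbered from 1; hence the successor.\<close>

definition sojourn ::
  "(nat \<Rightarrow> 'w \<Rightarrow> int ^ 'd) \<Rightarrow> (int ^ 'd \<Rightarrow> nat \<Rightarrow> 'w \<Rightarrow> real) \<Rightarrow> nat \<Rightarrow> 'w \<Rightarrow> real" where
  "sojourn \<xi> \<tau> k \<omega> = \<tau> (walk \<xi> k \<omega>) (Suc (visit_count \<xi> k \<omega>)) \<omega>"

lemma local_time_eq: "local_time \<xi> x n w = card {k. k < Suc n \<and> walk \<xi> k w = x}"
proof -
  have "local_time \<xi> x n w = (\<Sum>k\<in>{..n}. if walk \<xi> k w = x then 1 else 0)"
    by (simp add: local_time_def atLeast0AtMost)
  also have "\<dots> = card ({..n} \<inter> {k. walk \<xi> k w = x})" by (simp add: sum.If_cases)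
  also have "{..n} \<inter> {k. walk \<xi> k w = x} = {k. k < Suc n \<and> walk \<xi> k w = x}" by auto
  finally show ?thesis .
qed

text \<open>A further step raises the count only at the current site, and the new summand there is
  the sojourn time of that step.\<close>

lemma sum_sojourn:
  assumes "finite F" "(\<lambda>k. walk \<xi> k w) ` {..<n} \<subseteq> F"
  shows "(\<Sum>x\<in>F. \<Sum>i=1..card {k. k < n \<and> walk \<xi> k w = x}. \<tau> x i w) = (\<Sum>k<n. sojourn \<xi> \<tau> k w)"
  using assms(2)
proof (induction n)
  case (Suc n)
  let ?c = "\<lambda>n x. card {k. k < n \<and> walk \<xi> k w = x}"
  have c: "?c (Suc n) x = (if x = walk \<xi> n w then Suc (?c n x) else ?c n x)" for x
  proof -
    have "{k. k < Suc n \<and> walk \<xi> k w = x} =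
        (if x = walk \<xi> n w then insert n {k. k < n \<and> walk \<xi> k w = x} else {k. k < n \<and> walk \<xi> k w = x})"
      by (auto simp: less_Suc_eq)
    then show ?thesis by simp
  qed
  have "(\<Sum>i=1..?c (Suc n) x. \<tau> x i w)
      = (\<Sum>i=1..?c n x. \<tau> x i w) + (if x = walk \<xi> n w then sojourn \<xi> \<tau> n w else 0)" for x
    by (simp add: c sojourn_def visit_count_def)
  then have "(\<Sum>x\<in>F. \<Sum>i=1..?c (Suc n) x. \<tau> x i w)
      = (\<Sum>x\<in>F. \<Sum>i=1..?c n x. \<tau> x i w) + sojourn \<xi> \<tau> n w"
    using assms(1) Suc.prems by (auto simp: sum.distrib)
  then show ?case using Suc by (simp add: lessThan_Suc)
qed simp

text \<open>The local time up to \<open>n - 1\<close> counts the times \<open>k < n\<close>, and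
  only the finitely many sites visited by then contribute to the infinite sum.\<close>

lemma clock_eq_sum_sojourn: "clock \<xi> \<tau> n w = (\<Sum>k<n. sojourn \<xi> \<tau> k w)"
proof (cases n)
  case (Suc m)
  let ?F = "(\<lambda>k. walk \<xi> k w) ` {..<n}"
  let ?f = "\<lambda>x. \<Sum>i=1..local_time \<xi> x (n - 1) w. \<tau> x i w"
  have "(\<Sum>\<^sub>\<infinity>x\<in>UNIV. ?f x) = (\<Sum>\<^sub>\<infinity>x\<in>?F. ?f x)"
  proof (rule infsum_cong_neutral)
    fix x assume "x \<in> UNIV - ?F"
    then have "{k. k < Suc m \<and> walk \<xi> k w = x} = {}" using Suc by auto
    then show "?f x = 0" using Suc by (simp add: local_time_eq)
  qed auto
  also have "\<dots> = (\<Sum>x\<in>?F. ?f x)" by (rule infsum_finite) simp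
  also have "\<dots> = (\<Sum>k<n. sojourn \<xi> \<tau> k w)"
    unfolding local_time_eq using sum_sojourn[of ?F \<xi> w n \<tau>] Suc by simp
  finally show ?thesis using Suc by (simp add: clock_def)
qed (simp add: clock_def)

section \<open>The trap met at a given time as a function of the steps\<close>

context randomly_trapped_random_walk
begin

abbreviation "step_space \<equiv> PiM {1::nat..} (\<lambda>_. count_space (UNIV :: (int ^ 'd) set))"

definition steps :: "'w \<Rightarrow> nat \<Rightarrow> int ^ 'd" where "steps \<omega> = (\<lambda>i\<in>{1..}. \<xi> i \<omega>)"

lemma walk_steps: "walk \<xi> k \<omega> = walk (\<lambda>i s. s i) k (steps \<omega>)"
  by (simp add: walk_def steps_def)

lemma visit_count_steps: "visit_count \<xi> k \<omega> = visit_count (\<lambda>i s. s i) k (steps \<omega>)"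
  by (simp add: visit_count_def walk_steps)

lemma measurable_step: "i \<ge> 1 \<Longrightarrow> \<xi> i \<in> P \<rightarrow>\<^sub>M count_space UNIV"
  using steps_indep by (auto simp: indep_vars_def)

lemma measurable_steps: "steps \<in> P \<rightarrow>\<^sub>M step_space"
  unfolding steps_def by (rule measurable_restrict) (auto intro: measurable_step)

lemma measurable_environment: "\<pi> x \<in> P \<rightarrow>\<^sub>M trap_space"
  using environment_indep by (auto simp: indep_vars_def)

text \<open>Site and number of earlier visits tell which trap variable is used at time
  \<open>k\<close>. They depend on the steps alone and range over a countable set, so one can sum
  over their values.\<close>

definition position :: "nat \<Rightarrow> (nat \<Rightarrow> int ^ 'd) \<Rightarrow> (int ^ 'd) \<times> nat" where
  "position k s = (walk (\<lambda>i s. s i) k s, visit_count (\<lambda>i s. s i) k s)"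

lemma measurable_position:
  "position k \<in> step_space \<rightarrow>\<^sub>M count_space UNIV"
  "(\<lambda>s. (position j s, position k s)) \<in> step_space \<rightarrow>\<^sub>M count_space UNIV"
proof -
  have dep: "position j s = position j s'" if "\<And>i. i \<in> {1..max j k} \<Longrightarrow> s i = s' i" for s s' :: "nat \<Rightarrow> int ^ 'd" and j k
  proof -
    have w: "walk (\<lambda>i s. s i) l s = walk (\<lambda>i s. s i) l s'" if "l \<le> j" for l
      unfolding walk_def using that \<open>\<And>i. i \<in> {1..max j k} \<Longrightarrow> s i = s' i\<close> by (intro sum.cong) auto
    then show ?thesis by (auto simp: position_def visit_count_def intro!: arg_cong[where f = card])
  qed
  show "position k \<in> step_space \<rightarrow>\<^sub>M count_space UNIV"
    by (rule measurable_PiM_count_space_finite_dependence[where J = "{1..k}"]) (auto intro: dep[of k k])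
  show "(\<lambda>s. (position j s, position k s)) \<in> step_space \<rightarrow>\<^sub>M count_space UNIV"
  proof (rule measurable_PiM_count_space_finite_dependence[where J = "{1..max j k}"])
    fix s s' :: "nat \<Rightarrow> int ^ 'd" assume eq: "\<And>i. i \<in> {1..max j k} \<Longrightarrow> s i = s' i"
    have "position j s = position j s'" by (rule dep[of j k]) (rule eq)
    moreover have "position k s = position k s'" by (rule dep[of k j]) (rule eq, simp add: max.commute)
    ultimately show "(position j s, position k s) = (position j s', position k s')" by simp
  qed auto
qed

lemma sojourn_position:
  "sojourn \<xi> \<tau> k \<omega> = \<tau> (fst (position k (steps \<omega>))) (Suc (snd (position k (steps \<omega>)))) \<omega>"
  by (simp add: sojourn_def position_def walk_steps visit_count_steps)

lemma measurable_walk: "walk \<xi> k \<in> P \<rightarrow>\<^sub>M count_space UNIV"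
proof -
  have "(\<lambda>\<omega>. fst (position k (steps \<omega>))) \<in> P \<rightarrow>\<^sub>M count_space UNIV"
    by (rule measurable_compose[OF measurable_compose[OF measurable_steps measurable_position(1)]]) simp
  then show ?thesis by (simp add: position_def walk_steps[abs_def])
qed

lemma measurable_trap: "i \<ge> 1 \<Longrightarrow> \<tau> x i \<in> borel_measurable P"
  using traps_measurable[of i x] by (rule measurable_restrict_space2_iff[THEN iffD1, THEN conjunct1])

lemma trap_pos: "i \<ge> 1 \<Longrightarrow> \<omega> \<in> space P \<Longrightarrow> 0 < \<tau> x i \<omega>"
  using measurable_space[OF traps_measurable, of i \<omega> x] by (simp add: space_restrict_space)

lemma sojourn_pos: "\<omega> \<in> space P \<Longrightarrow> 0 < sojourn \<xi> \<tau> k \<omega>"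
  unfolding sojourn_def by (rule trap_pos) auto

lemma measurable_sojourn: "sojourn \<xi> \<tau> k \<in> borel_measurable P"
  unfolding sojourn_position[abs_def]
  by (rule measurable_compose_countable[where f = "\<lambda>p \<omega>. \<tau> (fst p) (Suc (snd p)) \<omega>",
        OF _ measurable_compose[OF measurable_steps measurable_position(1)]]) (simp add: measurable_trap)

lemma trap_measure_measurable:
  assumes "A \<in> sets borel"
  shows "(\<lambda>\<kappa>. measure \<kappa> (A \<inter> {0<..})) \<in> borel_measurable trap_space"
proof -
  have "A \<inter> {0<..} \<in> sets (restrict_space borel {0::real<..})"
    using assms by (auto simp: sets_restrict_space)
  then show ?thesis unfolding trap_space_def by measurable
qed

section \<open>Annealed probabilities of events of traps and steps\<close>

definition env_algebra :: "'w measure" where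
  "env_algebra = vimage_algebra (space P) (\<lambda>\<omega> x. \<pi> x \<omega>) (PiM UNIV (\<lambda>_. trap_space))"

lemma finite_measure_subalgebra_env: "finite_measure_subalgebra P env_algebra"
proof -
  have "(\<lambda>\<omega> x. \<pi> x \<omega>) \<in> P \<rightarrow>\<^sub>M PiM UNIV (\<lambda>_. trap_space)"
    by (intro measurable_abs_UNIV measurable_environment)
  then have "sets env_algebra \<subseteq> sets P" unfolding env_algebra_def
    by (simp add: measurable_iff_sets)
  then have "subalgebra P env_algebra" by (simp add: subalgebra_def env_algebra_def)
  then show ?thesis by unfold_locales
qed

lemma trap_measure_environment_measurable [measurable]:
  assumes "A \<in> sets borel"
  shows "(\<lambda>\<omega>. measure (\<pi> x \<omega>) (A \<inter> {0<..})) \<in> borel_measurable P"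
  using measurable_compose[OF measurable_environment trap_measure_measurable[OF assms]] .

text \<open>Integrating \<open>traps\<close> over the environment removes the conditional
  expectation for good; the steps factor out because their conditional probability is
  constant.\<close>

lemma prob_traps_steps:
  assumes J: "finite J" "J \<subseteq> UNIV \<times> {1..}"
    and A: "\<And>x i. (x, i) \<in> J \<Longrightarrow> A x i \<in> sets borel"
    and C: "C \<in> sets step_space"
  shows "prob {\<omega> \<in> space P. (\<forall>(x, i)\<in>J. \<tau> x i \<omega> \<in> A x i) \<and> steps \<omega> \<in> C}
    = (\<integral>\<omega>. (\<Prod>(x, i)\<in>J. measure (\<pi> x \<omega>) (A x i \<inter> {0<..})) \<partial>P) * prob {\<omega> \<in> space P. steps \<omega> \<in> C}"
proof -
  interpret sub: finite_measure_subalgebra P env_algebra by (rule finite_measure_subalgebra_env)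
  \<comment> \<open>The measures \<open>\<pi> x \<omega>\<close> live on the positive half-line, so
    Borel sets are cut down to it. The traps are positive, and the event does not change.\<close>
  let ?A = "\<lambda>x i. A x i \<inter> {0<..}"
  let ?E = "{\<omega> \<in> space P. (\<forall>(x, i)\<in>J. \<tau> x i \<omega> \<in> A x i) \<and> steps \<omega> \<in> C}"
  have pos: "0 < \<tau> x i \<omega>" if "(x, i) \<in> J" "\<omega> \<in> space P" for x i \<omega>
    using that J(2) by (intro trap_pos) auto
  have E: "?E = {\<omega> \<in> space P. (\<forall>(x, i)\<in>J. \<tau> x i \<omega> \<in> ?A x i) \<and> (\<lambda>i\<in>{1..}. \<xi> i \<omega>) \<in> C}"
    using pos by (auto simp: steps_def)
  have Es: "?E \<in> events"
  proof -
    have "{\<omega> \<in> space P. \<tau> x i \<omega> \<in> A x i} \<in> events" if "(x, i) \<in> J" for x i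
    proof -
      have "\<tau> x i -` A x i \<inter> space P \<in> events"
        using measurable_trap[of i x] A that J(2) by (intro measurable_sets) auto
      then show ?thesis by (simp add: vimage_def Int_def conj_commute)
    qed
    moreover have "{\<omega> \<in> space P. steps \<omega> \<in> C} \<in> events"
      using measurable_sets[OF measurable_steps C] by (simp add: vimage_def Int_def conj_commute)
    ultimately show ?thesis using J(1)
      by (intro sets.sets_Collect_conj sets.sets_Collect_finite_All) auto
  qed
  have As: "(x, i) \<in> J \<Longrightarrow> ?A x i \<in> sets (restrict_space borel {0<..})" for x i
    using A by (auto simp: sets_restrict_space)
  have iE: "integrable P (indicator ?E :: 'w \<Rightarrow> real)"
    using Es by (simp add: integrable_real_indicator emeasure_eq_measure)
  have "prob ?E = (\<integral>\<omega>. indicator ?E \<omega> \<partial>P)" using Es sets.sets_into_space[OF Es] by (simp add: Int_absorb1 Int_absorb2)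
  also have "\<dots> = (\<integral>\<omega>. real_cond_exp P env_algebra (indicator ?E) \<omega> \<partial>P)"
    using sub.real_cond_exp_int(2)[OF iE] by simp
  also have "\<dots> = (\<integral>\<omega>. (\<Prod>(x, i)\<in>J. measure (\<pi> x \<omega>) (?A x i)) * prob {\<omega> \<in> space P. steps \<omega> \<in> C} \<partial>P)"
  proof (rule integral_cong_AE)
    show "AE \<omega> in P. real_cond_exp P env_algebra (indicator ?E) \<omega>
        = (\<Prod>(x, i)\<in>J. measure (\<pi> x \<omega>) (?A x i)) * prob {\<omega> \<in> space P. steps \<omega> \<in> C}"
    proof -
      have "AE \<omega> in P. real_cond_exp P env_algebra
          (indicator {\<omega> \<in> space P. (\<forall>(x, i)\<in>J. \<tau> x i \<omega> \<in> ?A x i) \<and> (\<lambda>i\<in>{1..}. \<xi> i \<omega>) \<in> C}) \<omega>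
        = (\<Prod>(x, i)\<in>J. measure (\<pi> x \<omega>) (?A x i)) * prob {\<omega> \<in> space P. (\<lambda>i\<in>{1..}. \<xi> i \<omega>) \<in> C}"
        unfolding env_algebra_def by (rule traps[where A = ?A, OF J As C])
      then show ?thesis unfolding E by (simp only: steps_def)
    qed
    show "(\<lambda>\<omega>. (\<Prod>(x, i)\<in>J. measure (\<pi> x \<omega>) (?A x i)) * prob {\<omega> \<in> space P. steps \<omega> \<in> C}) \<in> borel_measurable P"
      using A by (intro borel_measurable_times borel_measurable_const borel_measurable_prod)
        (auto intro!: trap_measure_environment_measurable split: prod.splits)
  qed simp
  finally show ?thesis by simp
qed

definition annealed_law :: "real measure" where "annealed_law = distr P borel (\<tau> 0 1)"

lemma prob_space_annealed_law: "prob_space annealed_law"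
  unfolding annealed_law_def by (rule prob_space_distr) (simp add: measurable_trap)

lemma sets_annealed_law [simp, measurable_cong]: "sets annealed_law = sets borel"
  by (simp add: annealed_law_def)

text \<open>All the \<open>\<pi> x\<close> have law \<open>\<mu>\<close>, so the expectation does
  not depend on the site and can be read off from the variable that defines
  \<open>annealed_law\<close>.\<close>

lemma expectation_trap_measure:
  assumes A: "A \<in> sets borel"
  shows "(\<integral>\<omega>. measure (\<pi> x \<omega>) (A \<inter> {0<..}) \<partial>P) = measure annealed_law A"
proof -
  have eq: "(\<integral>\<omega>. measure (\<pi> y \<omega>) (A \<inter> {0<..}) \<partial>P) = (\<integral>\<kappa>. measure \<kappa> (A \<inter> {0<..}) \<partial>\<mu>)" for y
    unfolding environment_distr[of y, symmetric]
    by (rule integral_distr[symmetric, OF measurable_environment trap_measure_measurable[OF A]])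
  have "prob {\<omega> \<in> space P. (\<forall>(x, i)\<in>{(0, 1)}. \<tau> x i \<omega> \<in> A) \<and> steps \<omega> \<in> space step_space}
    = (\<integral>\<omega>. (\<Prod>(x, i)\<in>{(0, 1::nat)}. measure (\<pi> x \<omega>) (A \<inter> {0<..})) \<partial>P) *
        prob {\<omega> \<in> space P. steps \<omega> \<in> space step_space}"
    using A by (intro prob_traps_steps) auto
  moreover have "{\<omega> \<in> space P. steps \<omega> \<in> space step_space} = space P"
    using measurable_space[OF measurable_steps] by auto
  moreover have "{\<omega> \<in> space P. \<tau> 0 1 \<omega> \<in> A \<and> steps \<omega> \<in> space step_space}
      = \<tau> 0 1 -` A \<inter> space P"
    using measurable_space[OF measurable_steps] by auto
  ultimately have "prob (\<tau> 0 1 -` A \<inter> space P) = (\<integral>\<omega>. measure (\<pi> 0 \<omega>) (A \<inter> {0<..}) \<partial>P)"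
    by (simp add: prob_space)
  then show ?thesis using A by (simp add: eq annealed_law_def measure_distr measurable_trap)
qed

lemma prob_trap_steps:
  assumes "i \<ge> 1" "A \<in> sets borel" "C \<in> sets step_space"
  shows "prob {\<omega> \<in> space P. \<tau> x i \<omega> \<in> A \<and> steps \<omega> \<in> C} = measure annealed_law A * prob {\<omega> \<in> space P. steps \<omega> \<in> C}"
  using prob_traps_steps[of "{(x, i)}" "\<lambda>_ _. A" C] assms by (simp add: expectation_trap_measure)

text \<open>Different sites have independent environments, so the expected product of the two trap
  measures factorises. At one and the same site both traps would share \<open>\<pi> x\<close>, and
  averaging over it generally makes them dependent.\<close>

lemma prob_two_traps_steps:
  assumes xy: "x \<noteq> y" and ij: "i \<ge> 1" "j \<ge> 1" and A: "A \<in> sets borel" and B: "B \<in> sets borel"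
    and C: "C \<in> sets step_space"
  shows "prob {\<omega> \<in> space P. \<tau> x i \<omega> \<in> A \<and> \<tau> y j \<omega> \<in> B \<and> steps \<omega> \<in> C}
    = measure annealed_law A * measure annealed_law B * prob {\<omega> \<in> space P. steps \<omega> \<in> C}"
proof -
  let ?A = "\<lambda>z (_::nat). if z = x then A else B"
  let ?X = "\<lambda>z \<omega>. measure (\<pi> z \<omega>) (?A z 0 \<inter> {0<..})"
  have AB: "?A z 0 \<in> sets borel" for z using A B by simp
  have "indep_vars (\<lambda>_. borel) (\<lambda>z. (\<lambda>\<kappa>. measure \<kappa> (?A z 0 \<inter> {0<..})) \<circ> \<pi> z) {x, y}"
    by (rule indep_vars_compose[OF indep_vars_subset[OF environment_indep]])
      (use trap_measure_measurable[OF AB] in auto)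
  then have ind: "indep_vars (\<lambda>_. borel) ?X {x, y}" by (simp add: comp_def)
  have "integrable P (?X z)" for z
  proof (rule integrable_const_bound[where B = 1])
    show "AE \<omega> in P. norm (?X z \<omega>) \<le> 1"
    proof (rule AE_I2)
      fix \<omega> assume "\<omega> \<in> space P"
      then have "prob_space (\<pi> z \<omega>)" using measurable_space[OF measurable_environment, of \<omega> z]
        by (simp add: trap_space_def space_prob_algebra)
      then show "norm (?X z \<omega>) \<le> 1" by (simp add: prob_space.prob_le_1)
    qed
  qed (rule trap_measure_environment_measurable[OF AB])
  from indep_vars_lebesgue_integral[OF _ ind this]
  have "(\<integral>\<omega>. (\<Prod>z\<in>{x, y}. ?X z \<omega>) \<partial>P) = (\<Prod>z\<in>{x, y}. \<integral>\<omega>. ?X z \<omega> \<partial>P)" by simp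
  then have "(\<integral>\<omega>. ?X x \<omega> * ?X y \<omega> \<partial>P) = measure annealed_law A * measure annealed_law B"
    using xy A B by (simp add: expectation_trap_measure)
  moreover have "prob {\<omega> \<in> space P. (\<forall>(z, k)\<in>{(x, i), (y, j)}. \<tau> z k \<omega> \<in> ?A z k) \<and> steps \<omega> \<in> C}
    = (\<integral>\<omega>. (\<Prod>(z, k)\<in>{(x, i), (y, j)}. measure (\<pi> z \<omega>) (?A z k \<inter> {0<..})) \<partial>P) * prob {\<omega> \<in> space P. steps \<omega> \<in> C}"
    using ij A B C by (intro prob_traps_steps) auto
  ultimately show ?thesis using xy by simp
qed

lemma steps_event:
  assumes "f \<in> step_space \<rightarrow>\<^sub>M count_space UNIV"
  shows "f -` S \<inter> space step_space \<in> sets step_space"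
  using measurable_sets[OF assms, of S] by simp

lemma trap_event: "i \<ge> 1 \<Longrightarrow> A \<in> sets borel \<Longrightarrow> {\<omega> \<in> space P. \<tau> x i \<omega> \<in> A} \<in> events"
  using measurable_sets[OF measurable_trap, of i A x] by (simp add: vimage_def Int_def conj_commute)

text \<open>Given the position at time \<open>k\<close>, the sojourn time is a fixed trap variable,
  whose annealed law is independent of the steps and the same for every index.\<close>

lemma distr_sojourn: "distr P borel (sojourn \<xi> \<tau> k) = annealed_law"
proof (rule measure_eqI)
  fix A assume "A \<in> sets (distr P borel (sojourn \<xi> \<tau> k))"
  then have A: "A \<in> sets borel" by simp
  let ?Z = "\<lambda>\<omega>. position k (steps \<omega>)"
  have "emeasure P {\<omega> \<in> space P. \<omega> \<in> (\<lambda>(x, n). {\<omega> \<in> space P. \<tau> x (Suc n) \<omega> \<in> A}) (?Z \<omega>) \<and> \<omega> \<in> space P}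
      = ennreal (measure annealed_law A) * emeasure P (space P)"
  proof (rule emeasure_countable_mixture)
    show "?Z \<in> P \<rightarrow>\<^sub>M count_space UNIV" by (rule measurable_compose[OF measurable_steps measurable_position(1)])
    show "(case i of (x, n) \<Rightarrow> {\<omega> \<in> space P. \<tau> x (Suc n) \<omega> \<in> A}) \<in> events" for i
      using A by (cases i) (auto intro: trap_event)
    fix i :: "(int ^ 'd) \<times> nat"
    obtain x n where i: "i = (x, n)" by (cases i)
    let ?C = "position k -` {i} \<inter> space step_space"
    have C: "?C \<in> sets step_space" by (rule steps_event[OF measurable_position(1)])
    have eq: "position k (steps \<omega>) = i \<longleftrightarrow> steps \<omega> \<in> ?C" if "\<omega> \<in> space P" for \<omega>
      using measurable_space[OF measurable_steps that] by auto
    have "{\<omega> \<in> space P. \<omega> \<in> (case i of (x, n) \<Rightarrow> {\<omega> \<in> space P. \<tau> x (Suc n) \<omega> \<in> A}) \<and> ?Z \<omega> = i \<and> \<omega> \<in> space P}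
        = {\<omega> \<in> space P. \<tau> x (Suc n) \<omega> \<in> A \<and> steps \<omega> \<in> ?C}"
      using eq by (auto simp: i)
    moreover have "{\<omega> \<in> space P. ?Z \<omega> = i \<and> \<omega> \<in> space P} = {\<omega> \<in> space P. steps \<omega> \<in> ?C}"
      using eq by auto
    ultimately show "emeasure P {\<omega> \<in> space P. \<omega> \<in> (case i of (x, n) \<Rightarrow> {\<omega> \<in> space P. \<tau> x (Suc n) \<omega> \<in> A}) \<and> ?Z \<omega> = i \<and> \<omega> \<in> space P}
        = ennreal (measure annealed_law A) * emeasure P {\<omega> \<in> space P. ?Z \<omega> = i \<and> \<omega> \<in> space P}"
      using prob_trap_steps[OF _ A C, of "Suc n" x] by (simp add: emeasure_eq_measure ennreal_mult')
  qed simp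
  also have "{\<omega> \<in> space P. \<omega> \<in> (\<lambda>(x, n). {\<omega> \<in> space P. \<tau> x (Suc n) \<omega> \<in> A}) (?Z \<omega>) \<and> \<omega> \<in> space P}
      = sojourn \<xi> \<tau> k -` A \<inter> space P"
    by (auto simp: sojourn_position case_prod_beta)
  finally have "emeasure P (sojourn \<xi> \<tau> k -` A \<inter> space P) = ennreal (measure annealed_law A)"
    by (simp add: emeasure_space_1)
  then show "emeasure (distr P borel (sojourn \<xi> \<tau> k)) A = emeasure annealed_law A"
    using A measurable_sojourn
    by (simp add: emeasure_distr finite_measure.emeasure_eq_measure[OF prob_space.finite_measure[OF prob_space_annealed_law]])
qed simp

lemma collision_event: "{\<omega> \<in> space P. walk \<xi> j \<omega> = walk \<xi> k \<omega>} \<in> events"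
proof -
  have "(\<lambda>\<omega>. (position j (steps \<omega>), position k (steps \<omega>))) -` {(p, q). fst p = fst q} \<inter> space P \<in> events"
    by (rule measurable_sets[OF measurable_compose[OF measurable_steps measurable_position(2)]]) simp
  also have "(\<lambda>\<omega>. (position j (steps \<omega>), position k (steps \<omega>))) -` {(p, q). fst p = fst q} \<inter> space P
      = {\<omega> \<in> space P. walk \<xi> j \<omega> = walk \<xi> k \<omega>}" by (auto simp: position_def walk_steps)
  finally show ?thesis .
qed

text \<open>The same mixture argument over pairs of positions. On \<open>D\<close> only pairs with
  different sites occur, and for these the two traps are independent under the annealed law.\<close>

lemma emeasure_two_sojourns:
  fixes j k :: nat
  assumes A: "A \<in> sets borel" and B: "B \<in> sets borel"
  defines "D \<equiv> {\<omega> \<in> space P. walk \<xi> j \<omega> \<noteq> walk \<xi> k \<omega>}"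
  shows "emeasure P {\<omega> \<in> space P. sojourn \<xi> \<tau> j \<omega> \<in> A \<and> sojourn \<xi> \<tau> k \<omega> \<in> B \<and> \<omega> \<in> D}
    = emeasure annealed_law A * emeasure annealed_law B * emeasure P D"
proof -
  interpret \<eta>: prob_space annealed_law by (rule prob_space_annealed_law)
  let ?Z = "\<lambda>\<omega>. (position j (steps \<omega>), position k (steps \<omega>))"
  let ?E = "\<lambda>((x, m), (y, n)). {\<omega> \<in> space P. \<tau> x (Suc m) \<omega> \<in> A \<and> \<tau> y (Suc n) \<omega> \<in> B}"
  have D: "D = {\<omega> \<in> space P. fst (fst (?Z \<omega>)) \<noteq> fst (snd (?Z \<omega>))}"
    by (simp add: D_def position_def walk_steps)
  have Zm: "?Z \<in> P \<rightarrow>\<^sub>M count_space UNIV" by (rule measurable_compose[OF measurable_steps measurable_position(2)])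
  have "emeasure P {\<omega> \<in> space P. \<omega> \<in> ?E (?Z \<omega>) \<and> \<omega> \<in> D}
      = ennreal (measure annealed_law A * measure annealed_law B) * emeasure P D"
  proof (rule emeasure_countable_mixture[OF Zm])
    show "?E i \<in> events" for i
    proof -
      obtain x m y n where i: "i = ((x, m), (y, n))" by (metis surj_pair)
      have "{\<omega> \<in> space P. \<tau> x (Suc m) \<omega> \<in> A} \<inter> {\<omega> \<in> space P. \<tau> y (Suc n) \<omega> \<in> B} \<in> events"
        using A B by (intro sets.Int trap_event) auto
      also have "{\<omega> \<in> space P. \<tau> x (Suc m) \<omega> \<in> A} \<inter> {\<omega> \<in> space P. \<tau> y (Suc n) \<omega> \<in> B} = ?E i" by (auto simp: i)
      finally show ?thesis .
    qed
    have "D = space P - {\<omega> \<in> space P. walk \<xi> j \<omega> = walk \<xi> k \<omega>}" by (auto simp: D_def)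
    then show "D \<in> events" using collision_event by auto
    fix i :: "((int ^ 'd) \<times> nat) \<times> ((int ^ 'd) \<times> nat)"
    obtain x m y n where i: "i = ((x, m), (y, n))" by (metis surj_pair)
    show "emeasure P {\<omega> \<in> space P. \<omega> \<in> ?E i \<and> ?Z \<omega> = i \<and> \<omega> \<in> D}
        = ennreal (measure annealed_law A * measure annealed_law B) * emeasure P {\<omega> \<in> space P. ?Z \<omega> = i \<and> \<omega> \<in> D}"
    \<comment> \<open>Equal sites are incompatible with \<open>D\<close>, so both sides
      vanish.\<close>
    proof (cases "x = y")
      case True
      then have "{\<omega> \<in> space P. \<omega> \<in> ?E i \<and> ?Z \<omega> = i \<and> \<omega> \<in> D} = {}" "{\<omega> \<in> space P. ?Z \<omega> = i \<and> \<omega> \<in> D} = {}"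
        unfolding D i by auto
      then show ?thesis by (simp only: emeasure_empty mult_zero_right)
    next
      case False
      let ?C = "(\<lambda>s. (position j s, position k s)) -` {i} \<inter> space step_space"
      have C: "?C \<in> sets step_space" by (rule steps_event[OF measurable_position(2)])
      have eq: "?Z \<omega> = i \<longleftrightarrow> steps \<omega> \<in> ?C" if "\<omega> \<in> space P" for \<omega>
        using measurable_space[OF measurable_steps that] by auto
      have inD: "\<omega> \<in> D" if "\<omega> \<in> space P" "?Z \<omega> = i" for \<omega> using that False unfolding D i by auto
      have "{\<omega> \<in> space P. \<omega> \<in> ?E i \<and> ?Z \<omega> = i \<and> \<omega> \<in> D}
          = {\<omega> \<in> space P. \<tau> x (Suc m) \<omega> \<in> A \<and> \<tau> y (Suc n) \<omega> \<in> B \<and> steps \<omega> \<in> ?C}"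
      proof -
        have "(\<omega> \<in> ?E i) = (\<tau> x (Suc m) \<omega> \<in> A \<and> \<tau> y (Suc n) \<omega> \<in> B)" if "\<omega> \<in> space P" for \<omega>
          using that by (simp add: i)
        then show ?thesis using eq inD by blast
      qed
      moreover have "{\<omega> \<in> space P. ?Z \<omega> = i \<and> \<omega> \<in> D} = {\<omega> \<in> space P. steps \<omega> \<in> ?C}"
        using eq inD by blast
      ultimately show ?thesis
        using prob_two_traps_steps[OF False _ _ A B C, of "Suc m" "Suc n"]
        by (simp only: emeasure_eq_measure) (simp add: ennreal_mult')
    qed
  qed
  also have "{\<omega> \<in> space P. \<omega> \<in> ?E (?Z \<omega>) \<and> \<omega> \<in> D}
      = {\<omega> \<in> space P. sojourn \<xi> \<tau> j \<omega> \<in> A \<and> sojourn \<xi> \<tau> k \<omega> \<in> B \<and> \<omega> \<in> D}"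
    by (auto simp: sojourn_position case_prod_beta)
  finally show ?thesis by (simp add: \<eta>.emeasure_eq_measure ennreal_mult')
qed

section \<open>Increments of the walk\<close>

lemma increment_event: "{\<omega> \<in> space P. (\<Sum>i\<in>{Suc j..j + n}. \<xi> i \<omega>) = z} \<in> events"
proof -
  let ?f = "\<lambda>s :: nat \<Rightarrow> int ^ 'd. \<Sum>i\<in>{Suc j..j + n}. s i"
  have "?f \<in> step_space \<rightarrow>\<^sub>M count_space UNIV"
    by (rule measurable_PiM_count_space_finite_dependence[where J = "{Suc j..j + n}"]) auto
  from measurable_sets[OF measurable_compose[OF measurable_steps this], of "{z}"]
  have "(\<lambda>\<omega>. ?f (steps \<omega>)) -` {z} \<inter> space P \<in> events" by simp
  also have "(\<lambda>\<omega>. ?f (steps \<omega>)) -` {z} \<inter> space P = {\<omega> \<in> space P. (\<Sum>i\<in>{Suc j..j + n}. \<xi> i \<omega>) = z}"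
    by (auto simp: steps_def)
  finally show ?thesis .
qed

lemma prob_increment_step_indep:
  "prob {w \<in> space P. (\<Sum>i\<in>{Suc j..j + n}. \<xi> i w) = x \<and> \<xi> (Suc (j + n)) w = y}
    = prob {w \<in> space P. (\<Sum>i\<in>{Suc j..j + n}. \<xi> i w) = x} * prob {w \<in> space P. \<xi> (Suc (j + n)) w = y}"
proof -
  let ?A = "{Suc j..j + n}" and ?B = "{Suc (j + n)}"
  let ?f = "\<lambda>s :: nat \<Rightarrow> int ^ 'd. \<Sum>i\<in>?A. s i" and ?g = "\<lambda>s :: nat \<Rightarrow> int ^ 'd. s (Suc (j + n))"
  let ?X = "?f \<circ> (\<lambda>w. restrict (\<lambda>i. \<xi> i w) ?A)" and ?Y = "?g \<circ> (\<lambda>w. restrict (\<lambda>i. \<xi> i w) ?B)"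
  have "indep_var (count_space UNIV) ?X (count_space UNIV) ?Y"
  proof (rule indep_var_compose[OF indep_var_restrict[OF steps_indep]])
    show "?f \<in> PiM ?A (\<lambda>_. count_space UNIV) \<rightarrow>\<^sub>M count_space UNIV"
      by (rule measurable_PiM_count_space_finite_dependence[where J = ?A]) auto
    show "?g \<in> PiM ?B (\<lambda>_. count_space UNIV) \<rightarrow>\<^sub>M count_space UNIV"
      by (rule measurable_PiM_count_space_finite_dependence[where J = ?B]) auto
  qed auto
  from indep_varD[OF this, of "{x}" "{y}"]
  have "prob ((\<lambda>w. (?X w, ?Y w)) -` ({x} \<times> {y}) \<inter> space P)
    = prob (?X -` {x} \<inter> space P) * prob (?Y -` {y} \<inter> space P)" by simp
  moreover have "(\<lambda>w. (?X w, ?Y w)) -` ({x} \<times> {y}) \<inter> space P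
      = {w \<in> space P. (\<Sum>i\<in>?A. \<xi> i w) = x \<and> \<xi> (Suc (j + n)) w = y}" by auto
  moreover have "?X -` {x} \<inter> space P = {w \<in> space P. (\<Sum>i\<in>?A. \<xi> i w) = x}" by auto
  moreover have "?Y -` {y} \<inter> space P = {w \<in> space P. \<xi> (Suc (j + n)) w = y}" by auto
  ultimately show ?thesis by simp
qed

lemma prob_step: "i \<ge> 1 \<Longrightarrow> prob {\<omega> \<in> space P. \<xi> i \<omega> = y} = pmf \<nu> y"
proof -
  assume i: "i \<ge> 1"
  have "pmf \<nu> y = measure (distr P (count_space UNIV) (\<xi> i)) {y}"
    by (simp only: steps_distr[OF i] measure_pmf_single)
  also have "\<dots> = prob (\<xi> i -` {y} \<inter> space P)" using measurable_step[OF i] by (simp add: measure_distr)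
  also have "\<xi> i -` {y} \<inter> space P = {\<omega> \<in> space P. \<xi> i \<omega> = y}" by auto
  finally show ?thesis by simp
qed

text \<open>Splitting according to the value before the last step gives the recursion of
  \<open>walk_pmf\<close>. The starting time \<open>j\<close> is arbitrary because the collisions of
  two arbitrary times are needed.\<close>

lemma prob_increment: "prob {w \<in> space P. (\<Sum>i\<in>{Suc j..j + n}. \<xi> i w) = z} = pmf (walk_pmf \<nu> n) z"
proof (induction n arbitrary: z)
  case 0
  show ?case by (cases "z = 0") (auto simp: prob_space indicator_def)
next
  case (Suc n)
  let ?S = "\<lambda>w. \<Sum>i\<in>{Suc j..j + n}. \<xi> i w" and ?x = "\<xi> (Suc (j + n))"
  have step: "{w \<in> space P. ?x w = y} \<in> events" for y
  proof -
    have "?x -` {y} \<inter> space P \<in> events" by (rule measurable_sets[OF measurable_step]) auto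
    also have "?x -` {y} \<inter> space P = {w \<in> space P. ?x w = y}" by auto
    finally show ?thesis .
  qed
  have ev: "{w \<in> space P. ?S w = x \<and> ?x w = z - x} \<in> events" for x
  proof -
    have "{w \<in> space P. ?S w = x} \<inter> {w \<in> space P. ?x w = z - x} \<in> events"
      using step increment_event by (intro sets.Int) auto
    also have "{w \<in> space P. ?S w = x} \<inter> {w \<in> space P. ?x w = z - x} = {w \<in> space P. ?S w = x \<and> ?x w = z - x}" by auto
    finally show ?thesis .
  qed
  have "{w \<in> space P. (\<Sum>i\<in>{Suc j..j + Suc n}. \<xi> i w) = z} = (\<Union>x. {w \<in> space P. ?S w = x \<and> ?x w = z - x})"
    by (auto simp: algebra_simps)
  then have "emeasure P {w \<in> space P. (\<Sum>i\<in>{Suc j..j + Suc n}. \<xi> i w) = z}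
      = (\<integral>\<^sup>+x. emeasure P {w \<in> space P. ?S w = x \<and> ?x w = z - x} \<partial>count_space UNIV)"
    using ev by (simp only:) (rule emeasure_UN_countable, auto simp: disjoint_family_on_def)
  also have "\<dots> = (\<integral>\<^sup>+x. ennreal (pmf (walk_pmf \<nu> n) x) * ennreal (pmf \<nu> (z - x)) \<partial>count_space UNIV)"
    unfolding emeasure_eq_measure prob_increment_step_indep Suc.IH
    by (simp add: prob_step ennreal_mult')
  also have "\<dots> = (\<integral>\<^sup>+x. ennreal (pmf \<nu> (z - x)) \<partial>measure_pmf (walk_pmf \<nu> n))"
    by (simp add: nn_integral_measure_pmf)
  also have "\<dots> = ennreal (pmf (walk_pmf \<nu> (Suc n)) z)"
    by (simp add: ennreal_pmf_bind pmf_map_plus)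
  finally show ?case by (simp add: emeasure_eq_measure)
qed

lemma prob_walk_eq: "prob {\<omega> \<in> space P. walk \<xi> j \<omega> = walk \<xi> k \<omega>} = pmf (walk_pmf \<nu> (nat \<bar>int j - int k\<bar>)) 0"
proof (induction j k rule: linorder_wlog)
  case (le j k)
  then obtain n where k: "k = j + n" using le_Suc_ex by blast
  have "walk \<xi> k \<omega> = walk \<xi> j \<omega> + (\<Sum>i\<in>{Suc j..j + n}. \<xi> i \<omega>)" for \<omega>
    using sum.ub_add_nat[of 1 j "\<lambda>i. \<xi> i \<omega>" n] by (simp add: walk_def k)
  then have "{\<omega> \<in> space P. walk \<xi> j \<omega> = walk \<xi> k \<omega>} = {\<omega> \<in> space P. (\<Sum>i\<in>{Suc j..j + n}. \<xi> i \<omega>) = 0}" by auto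
  then show ?case by (simp only: prob_increment) (simp add: k)
next
  case (sym j k)
  have "{\<omega> \<in> space P. walk \<xi> k \<omega> = walk \<xi> j \<omega>} = {\<omega> \<in> space P. walk \<xi> j \<omega> = walk \<xi> k \<omega>}" by auto
  with sym show ?case by (simp only: abs_minus_commute)
qed

text \<open>Restricted to the event of different sites, the joint law of the two sojourn times is a
  multiple of the product of annealed laws, so the integral contains the factor
  \<open>\<integral>u. h u \<partial>annealed_law\<close>.\<close>

lemma sojourn_uncorrelated:
  assumes h: "h \<in> borel_measurable borel" "\<And>u. \<bar>h u\<bar> \<le> K" "(\<integral>u. h u \<partial>annealed_law) = (0 :: real)"
  shows "(\<integral>\<omega>. h (sojourn \<xi> \<tau> j \<omega>) * h (sojourn \<xi> \<tau> k \<omega>)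
    * indicator (space P - {\<omega> \<in> space P. walk \<xi> j \<omega> = walk \<xi> k \<omega>}) \<omega> \<partial>P) = 0"
proof -
  interpret \<eta>: prob_space annealed_law by (rule prob_space_annealed_law)
  let ?D = "{\<omega> \<in> space P. walk \<xi> j \<omega> \<noteq> walk \<xi> k \<omega>}"
  let ?Q = "density P (\<lambda>\<omega>. ennreal (indicator ?D \<omega>))"
  let ?\<sigma> = "\<lambda>\<omega>. (sojourn \<xi> \<tau> j \<omega>, sojourn \<xi> \<tau> k \<omega>)"
  have Deq: "space P - {\<omega> \<in> space P. walk \<xi> j \<omega> = walk \<xi> k \<omega>} = ?D" by auto
  have D: "?D \<in> events" using collision_event[of j k] unfolding Deq[symmetric] by (rule sets.compl_sets)
  note [measurable] = measurable_sojourn h(1)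
  \<comment> \<open>The probability of \<open>?D\<close> is absorbed into the first factor, which
    makes the restricted joint law an exact product measure.\<close>
  define M1 where "M1 = density annealed_law (\<lambda>_. emeasure P ?D)"
  define N where "N = distr ?Q (borel \<Otimes>\<^sub>M borel) ?\<sigma>"
  have finM1: "finite_measure M1"
  proof (rule finite_measureI)
    have "emeasure M1 (space annealed_law) = emeasure P ?D * emeasure annealed_law (space annealed_law)"
      unfolding M1_def by (rule emeasure_density_const[OF sets.top])
    moreover have "space M1 = space annealed_law" by (simp add: M1_def)
    ultimately show "emeasure M1 (space M1) \<noteq> \<infinity>" by (simp add: \<eta>.emeasure_space_1)
  qed
  have setsM1: "sets M1 = sets borel" by (simp add: M1_def)
  have \<sigma>m: "?\<sigma> \<in> ?Q \<rightarrow>\<^sub>M borel \<Otimes>\<^sub>M borel" by measurable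
  have pair: "M1 \<Otimes>\<^sub>M annealed_law = N"
  proof (rule pair_measure_eqI)
    show "sigma_finite_measure M1" using finM1 by (simp add: finite_measure_def)
    show "sigma_finite_measure annealed_law" by unfold_locales
    show "sets (M1 \<Otimes>\<^sub>M annealed_law) = sets N"
      using setsM1 by (simp add: N_def cong: sets_pair_measure_cong)
    fix A B assume "A \<in> sets M1" "B \<in> sets annealed_law"
    then have AB: "A \<in> sets borel" "B \<in> sets borel" using setsM1 by auto
    have AB': "?\<sigma> -` (A \<times> B) \<inter> space P \<in> events"
      by (rule measurable_sets[of ?\<sigma> P "borel \<Otimes>\<^sub>M borel"]) (use AB in measurable)
    have "emeasure N (A \<times> B) = emeasure ?Q (?\<sigma> -` (A \<times> B) \<inter> space ?Q)"
      unfolding N_def using AB \<sigma>m by (intro emeasure_distr) auto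
    also have "\<dots> = emeasure P (?D \<inter> (?\<sigma> -` (A \<times> B) \<inter> space P))"
      using emeasure_restricted[OF D AB'] by (simp add: ennreal_indicator)
    also have "?D \<inter> (?\<sigma> -` (A \<times> B) \<inter> space P)
        = {\<omega> \<in> space P. sojourn \<xi> \<tau> j \<omega> \<in> A \<and> sojourn \<xi> \<tau> k \<omega> \<in> B \<and> \<omega> \<in> ?D}" by auto
    also have "emeasure P \<dots> = emeasure annealed_law A * emeasure annealed_law B * emeasure P ?D"
      by (rule emeasure_two_sojourns[OF AB])
    finally have "emeasure N (A \<times> B) = emeasure annealed_law A * emeasure annealed_law B * emeasure P ?D" .
    moreover have "emeasure M1 A = emeasure P ?D * emeasure annealed_law A"
      unfolding M1_def by (rule emeasure_density_const) (use AB in simp)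
    ultimately show "emeasure M1 A * emeasure annealed_law B = emeasure N (A \<times> B)"
      by (simp add: mult_ac)
  qed
  interpret M1: finite_measure M1 by (rule finM1)
  interpret pair_sigma_finite M1 annealed_law by unfold_locales
  let ?f = "\<lambda>p. h (fst p) * h (snd p)"
  have "finite_measure N"
  proof (rule finite_measureI)
    have "emeasure N (space N) = emeasure M1 (space M1) * emeasure annealed_law (space annealed_law)"
      unfolding pair[symmetric] space_pair_measure
      by (rule \<eta>.emeasure_pair_measure_Times[OF sets.top sets.top])
    then show "emeasure N (space N) \<noteq> \<infinity>" by (simp add: \<eta>.emeasure_space_1)
  qed
  then interpret N: finite_measure N .
  have fN: "?f \<in> borel_measurable (borel \<Otimes>\<^sub>M borel)" by measurable
  have "integrable N ?f"
  proof (rule N.integrable_const_bound[where B = "K * K"], rule AE_I2)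
    show "norm (?f p) \<le> K * K" for p
      using mult_mono[OF h(2)[of "fst p"] h(2)[of "snd p"]] order_trans[OF abs_ge_zero h(2)[of 0]]
      by (simp add: abs_mult)
  qed (use fN in \<open>simp add: N_def\<close>)
  then have iN: "integrable (M1 \<Otimes>\<^sub>M annealed_law) ?f" by (simp add: pair)
  have "(\<integral>\<omega>. h (sojourn \<xi> \<tau> j \<omega>) * h (sojourn \<xi> \<tau> k \<omega>) * indicator ?D \<omega> \<partial>P)
      = (\<integral>\<omega>. indicator ?D \<omega> *\<^sub>R ?f (?\<sigma> \<omega>) \<partial>P)" by (simp add: mult.commute)
  also have "\<dots> = (\<integral>\<omega>. ?f (?\<sigma> \<omega>) \<partial>?Q)"
    by (rule integral_density[symmetric]) (use D in auto)
  also have "\<dots> = (\<integral>p. ?f p \<partial>N)" unfolding N_def by (rule integral_distr[symmetric, OF \<sigma>m fN])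
  also have "\<dots> = (\<integral>p. ?f p \<partial>(M1 \<Otimes>\<^sub>M annealed_law))" by (simp add: pair)
  also have "\<dots> = (\<integral>u. \<integral>v. ?f (u, v) \<partial>annealed_law \<partial>M1)" by (rule integral_fst'[OF iN, symmetric])
  also have "\<dots> = 0" using h(3) by simp
  finally show ?thesis unfolding Deq .
qed

text \<open>The annealed law is the mixture of the kernel \<open>\<pi> 0\<close> under
  \<open>P\<close>, so its mean is the expected mean of the trap measure. The identification is made
  on the positive half-line, where the kernel takes its values, and transferred to the real line
  afterwards.\<close>

lemma nn_integral_annealed_law:
  "(\<integral>\<^sup>+u. ennreal u \<partial>annealed_law) = (\<integral>\<^sup>+\<omega>. (\<integral>\<^sup>+u. ennreal u \<partial>(\<pi> 0 \<omega>)) \<partial>P)"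
proof -
  let ?S = "restrict_space borel {0 :: real<..}"
  have \<pi>m: "\<pi> 0 \<in> P \<rightarrow>\<^sub>M subprob_algebra ?S"
    using measurable_environment[of 0] unfolding trap_space_def by (rule measurable_prob_algebraD)
  have \<tau>m: "\<tau> 0 1 \<in> P \<rightarrow>\<^sub>M ?S" by (rule traps_measurable) simp
  have "distr P ?S (\<tau> 0 1) = P \<bind> \<pi> 0"
  proof (rule measure_eqI)
    show "sets (distr P ?S (\<tau> 0 1)) = sets (P \<bind> \<pi> 0)"
      using sets_bind[OF sets_kernel[OF \<pi>m] not_empty] by simp
    fix A assume "A \<in> sets (distr P ?S (\<tau> 0 1))"
    then have A: "A \<in> sets ?S" by simp
    then have A': "A \<in> sets borel" "A \<inter> {0<..} = A" by (auto simp: sets_restrict_space)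
    have ps: "prob_space (\<pi> 0 \<omega>)" if "\<omega> \<in> space P" for \<omega>
      using measurable_space[OF measurable_environment that, of 0] by (simp add: trap_space_def space_prob_algebra)
    have "emeasure (P \<bind> \<pi> 0) A = (\<integral>\<^sup>+\<omega>. emeasure (\<pi> 0 \<omega>) A \<partial>P)"
      by (rule emeasure_bind[OF not_empty \<pi>m A])
    also have "\<dots> = (\<integral>\<^sup>+\<omega>. ennreal (measure (\<pi> 0 \<omega>) A) \<partial>P)"
      by (intro nn_integral_cong)
        (simp add: finite_measure.emeasure_eq_measure[OF prob_space.finite_measure[OF ps]])
    also have "\<dots> = ennreal (\<integral>\<omega>. measure (\<pi> 0 \<omega>) A \<partial>P)"
    proof (rule nn_integral_eq_integral)
      show "integrable P (\<lambda>\<omega>. measure (\<pi> 0 \<omega>) A)"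
      proof (rule integrable_const_bound[where B = 1])
        show "AE \<omega> in P. norm (measure (\<pi> 0 \<omega>) A) \<le> 1" using ps by (auto intro!: AE_I2 prob_space.prob_le_1)
      qed (use trap_measure_environment_measurable[OF A'(1), of 0] A'(2) in simp)
    qed simp
    also have "\<dots> = ennreal (measure annealed_law A)" using expectation_trap_measure[OF A'(1)] A'(2) by simp
    also have "\<dots> = emeasure P (\<tau> 0 1 -` A \<inter> space P)"
      using A'(1) by (simp add: annealed_law_def measure_distr measurable_trap emeasure_eq_measure)
    also have "\<dots> = emeasure (distr P ?S (\<tau> 0 1)) A" by (rule emeasure_distr[OF \<tau>m A, symmetric])
    finally show "emeasure (distr P ?S (\<tau> 0 1)) A = emeasure (P \<bind> \<pi> 0) A" by simp
  qed
  moreover have "ennreal \<in> borel_measurable ?S" by (rule measurable_restrict_space1) simp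
  ultimately have "(\<integral>\<^sup>+\<omega>. (\<integral>\<^sup>+u. ennreal u \<partial>(\<pi> 0 \<omega>)) \<partial>P) = (\<integral>\<^sup>+u. ennreal u \<partial>(distr P ?S (\<tau> 0 1)))"
    using nn_integral_bind[OF _ \<pi>m] by simp
  also have "\<dots> = (\<integral>\<^sup>+\<omega>. ennreal (\<tau> 0 1 \<omega>) \<partial>P)"
    by (rule nn_integral_distr[OF \<tau>m]) (simp add: \<open>ennreal \<in> borel_measurable ?S\<close>)
  also have "\<dots> = (\<integral>\<^sup>+u. ennreal u \<partial>annealed_law)"
    unfolding annealed_law_def by (rule nn_integral_distr[symmetric]) (auto simp: measurable_trap)
  finally show ?thesis by simp
qed

text \<open>\<open>ennreal M\<close> vanishes for every \<open>M \<le> 0\<close>, so positivity of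
  \<open>M\<close> has to come from the traps: a zero mean would make a strictly positive variable
  vanish almost surely.\<close>

lemma annealed_law_mean:
  assumes M: "(\<integral>\<^sup>+\<omega>. (\<integral>\<^sup>+u. ennreal u \<partial>(\<pi> 0 \<omega>)) \<partial>P) = ennreal M"
  shows "0 < M" "integrable annealed_law (\<lambda>u. u)" "(\<integral>u. u \<partial>annealed_law) = M"
proof -
  have nn: "(\<integral>\<^sup>+u. ennreal u \<partial>annealed_law) = ennreal M" using M by (simp add: nn_integral_annealed_law)
  have \<tau>: "(\<integral>\<^sup>+\<omega>. ennreal (\<tau> 0 1 \<omega>) \<partial>P) = ennreal M"
    unfolding nn[symmetric] annealed_law_def by (rule nn_integral_distr[symmetric]) (auto simp: measurable_trap)
  show "0 < M"
  proof (rule ccontr)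
    assume "\<not> 0 < M"
    then have "(\<integral>\<^sup>+\<omega>. ennreal (\<tau> 0 1 \<omega>) \<partial>P) = 0" using \<tau> by (simp add: ennreal_neg)
    then have "AE \<omega> in P. ennreal (\<tau> 0 1 \<omega>) = 0"
      using measurable_compose[OF measurable_trap[of 1 0] measurable_ennreal]
      by (simp add: nn_integral_0_iff_AE)
    then have "AE \<omega> in P. False" using AE_space
    proof eventually_elim
      case (elim \<omega>)
      then show ?case using trap_pos[of 1 \<omega> 0] by (simp add: ennreal_eq_0_iff)
    qed
    then show False by simp
  qed
  then have "integrable P (\<tau> 0 1)" "(\<integral>\<omega>. \<tau> 0 1 \<omega> \<partial>P) = M"
    using nn_integral_eq_integrable[of "\<tau> 0 1" P M] \<tau> trap_pos[of 1]
    by (auto simp: measurable_trap less_imp_le intro!: AE_I2)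
  then show "integrable annealed_law (\<lambda>u. u)" "(\<integral>u. u \<partial>annealed_law) = M"
    unfolding annealed_law_def by (auto simp: integrable_distr_eq integral_distr measurable_trap)
qed

lemma measurable_clock: "clock \<xi> \<tau> n \<in> borel_measurable P"
  unfolding clock_eq_sum_sojourn[abs_def] by (intro borel_measurable_sum measurable_sojourn)

lemma clock_weak_law:
  assumes \<nu>: "\<nu> \<noteq> return_pmf 0" and M: "(\<integral>\<^sup>+\<omega>. (\<integral>\<^sup>+u. ennreal u \<partial>(\<pi> 0 \<omega>)) \<partial>P) = ennreal M"
  shows "(\<lambda>n. (\<integral>\<omega>. \<bar>clock \<xi> \<tau> n \<omega> - real n * M\<bar> \<partial>P) / real n) \<longlonglongrightarrow> 0"
proof -
  have "(\<lambda>n. (\<integral>\<omega>. \<bar>(\<Sum>k<n. sojourn \<xi> \<tau> k \<omega>) - real n * (\<integral>u. u \<partial>annealed_law)\<bar> \<partial>P) / real n) \<longlonglongrightarrow> 0"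
  proof (rule weak_law_uncorrelated_off_collisions[OF measurable_sojourn distr_sojourn
      annealed_law_mean(2)[OF M] collision_event sojourn_uncorrelated])
    show "(\<lambda>n. (\<Sum>j<n. \<Sum>k<n. prob {\<omega> \<in> space P. walk \<xi> j \<omega> = walk \<xi> k \<omega>}) / (real n)\<^sup>2) \<longlonglongrightarrow> 0"
      unfolding prob_walk_eq
      by (rule double_average_tendsto_0[OF walk_return_prob_tendsto_0[OF \<nu>]]) (auto simp: pmf_le_1)
  qed
  then show ?thesis by (simp add: clock_eq_sum_sojourn annealed_law_mean(3)[OF M])
qed

end

section \<open>Scaling limits of the clock and of the trapped walk\<close>

lemma scaled_floor_tendsto:
  assumes "0 \<le> t"
  shows "(\<lambda>N. real (nat \<lfloor>real N * t\<rfloor>) / real N) \<longlonglongrightarrow> t"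
proof (rule tendsto_sandwich)
  show "\<forall>\<^sub>F N in sequentially. t - 1 / real N \<le> real (nat \<lfloor>real N * t\<rfloor>) / real N"
    using eventually_gt_at_top[of 0]
  proof eventually_elim
    case (elim N)
    have "real N * t - 1 \<le> real (nat \<lfloor>real N * t\<rfloor>)" by linarith
    then have "(real N * t - 1) / real N \<le> real (nat \<lfloor>real N * t\<rfloor>) / real N" by (rule divide_right_mono) simp
    then show ?case using elim by (simp add: diff_divide_distrib)
  qed
  show "\<forall>\<^sub>F N in sequentially. real (nat \<lfloor>real N * t\<rfloor>) / real N \<le> t"
    using eventually_gt_at_top[of 0]
  proof eventually_elim
    case (elim N)
    have "real (nat \<lfloor>real N * t\<rfloor>) \<le> real N * t" using assms by simp
    then show ?case using elim by (simp add: pos_divide_le_eq mult.commute)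
  qed
  have "(\<lambda>N. t - 1 / real N) \<longlonglongrightarrow> t - 0" by (intro tendsto_intros lim_const_over_n)
  then show "(\<lambda>N. t - 1 / real N) \<longlonglongrightarrow> t" by simp
qed simp

context randomly_trapped_random_walk
begin

section \<open>The scaled clock and its inverse\<close>

abbreviation "clock_path N t \<omega> \<equiv> clock \<xi> \<tau> (nat \<lfloor>real N * t\<rfloor>) \<omega> / real N"

lemma clock_mono: "\<omega> \<in> space P \<Longrightarrow> m \<le> n \<Longrightarrow> clock \<xi> \<tau> m \<omega> \<le> clock \<xi> \<tau> n \<omega>"
  unfolding clock_eq_sum_sojourn by (intro sum_mono2) (auto intro: less_imp_le[OF sojourn_pos])

lemma clock_strict_mono: "\<omega> \<in> space P \<Longrightarrow> strict_mono (\<lambda>n. clock \<xi> \<tau> n \<omega>)"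
  by (rule strict_mono_Suc_iff[THEN iffD2]) (simp add: clock_eq_sum_sojourn sojourn_pos)

lemma clock_0: "clock \<xi> \<tau> 0 \<omega> = 0"
  by (simp add: clock_def)

definition clock_inverse :: "real \<Rightarrow> 'w \<Rightarrow> nat" where
  "clock_inverse t \<omega> = (THE k. clock \<xi> \<tau> k \<omega> \<le> t \<and> t < clock \<xi> \<tau> (Suc k) \<omega>)"

lemma clock_inverse:
  assumes "(\<lambda>k. clock \<xi> \<tau> k \<omega>) \<in> partition_times" "0 \<le> t"
  shows "clock \<xi> \<tau> (clock_inverse t \<omega>) \<omega> \<le> t" "t < clock \<xi> \<tau> (Suc (clock_inverse t \<omega>)) \<omega>"
proof -
  obtain k where k: "clock \<xi> \<tau> k \<omega> \<le> t" "t < clock \<xi> \<tau> (Suc k) \<omega>"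
    using partition_index_exists[OF assms] .
  moreover have "clock_inverse t \<omega> = k" unfolding clock_inverse_def
    using partition_index_unique[OF _ k] assms(1) by (simp add: partition_times_def)
  ultimately show "clock \<xi> \<tau> (clock_inverse t \<omega>) \<omega> \<le> t" "t < clock \<xi> \<tau> (Suc (clock_inverse t \<omega>)) \<omega>" by auto
qed

lemma rtrw_eq: "rtrw \<xi> \<tau> t \<omega> = walk \<xi> (clock_inverse t \<omega>) \<omega>"
  by (simp add: rtrw_def clock_inverse_def)

text \<open>The inverse clock is an integer, so the floor in \<open>scaled_walk\<close> undoes the
  division by \<open>N\<close>. For \<open>N = 0\<close> division by zero makes both paths
  zero.\<close>

lemma scaled_rtrw_eq_time_change:
  "scaled_rtrw \<xi> \<tau> A N \<omega> = (\<lambda>t\<in>{0..}. scaled_walk \<xi> A N \<omega> (real (clock_inverse (real N * t) \<omega>) / real N))"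
proof (cases "N = 0")
  case False
  then have "nat \<lfloor>real N * (real k / real N)\<rfloor> = k" for k by simp
  then show ?thesis unfolding scaled_rtrw_def scaled_walk_def rtrw_eq by (intro restrict_ext) simp
qed (simp add: scaled_rtrw_def scaled_walk_def)

context
  fixes M :: real
  assumes \<nu>: "\<nu> \<noteq> return_pmf 0" and M: "(\<integral>\<^sup>+\<omega>. (\<integral>\<^sup>+u. ennreal u \<partial>(\<pi> 0 \<omega>)) \<partial>P) = ennreal M"
begin

lemma M_pos: "0 < M" by (rule annealed_law_mean(1)[OF M])

lemma integrable_clock: "integrable P (clock \<xi> \<tau> n)"
proof -
  have "integrable P (sojourn \<xi> \<tau> k)" for k
  proof -
    have "integrable (distr P borel (sojourn \<xi> \<tau> k)) (\<lambda>u. u)"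
      unfolding distr_sojourn by (rule annealed_law_mean(2)[OF M])
    then show ?thesis by (subst (asm) integrable_distr_eq) (auto simp: measurable_sojourn)
  qed
  then show ?thesis unfolding clock_eq_sum_sojourn[abs_def] by (intro Bochner_Integration.integrable_sum)
qed

lemma scaled_clock_L1:
  assumes t: "0 \<le> t"
  shows "(\<lambda>N. \<integral>\<omega>. \<bar>clock_path N t \<omega> - M * t\<bar> \<partial>P) \<longlonglongrightarrow> 0"
proof -
  define E where "E n = (\<integral>\<omega>. \<bar>clock \<xi> \<tau> n \<omega> - real n * M\<bar> \<partial>P)" for n
  define a where "a N = nat \<lfloor>real N * t\<rfloor>" for N
  have lima: "(\<lambda>N. real (a N) / real N) \<longlonglongrightarrow> t" unfolding a_def by (rule scaled_floor_tendsto[OF t])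
  have E0: "E 0 = 0" by (simp add: E_def clock_0)
  \<comment> \<open>The weak law is used along \<open>a N\<close>, which tends to infinity only for
    \<open>t > 0\<close>. Dividing by \<open>a N\<close> when it is zero does no harm, since
    \<open>E 0 = 0\<close>.\<close>
  have "(\<lambda>N. E (a N) / real (a N) * (real (a N) / real N)) \<longlonglongrightarrow> 0"
  proof (cases "t = 0")
    case True then show ?thesis by (simp add: a_def E0)
  next
    case False
    have "filterlim (\<lambda>N. real N * t) at_top sequentially"
      using False t by (intro filterlim_at_top_mult_tendsto_pos[OF tendsto_const]) (auto intro: filterlim_real_sequentially)
    then have "filterlim a at_top sequentially" unfolding a_def
      by (rule filterlim_compose[OF filterlim_nat_sequentially filterlim_compose[OF filterlim_floor_sequentially]])
    then have "(\<lambda>N. E (a N) / real (a N)) \<longlonglongrightarrow> 0"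
      using filterlim_compose[OF clock_weak_law[OF \<nu> M]] unfolding E_def by blast
    from tendsto_mult[OF this lima] show ?thesis by simp
  qed
  then have lim1: "(\<lambda>N. E (a N) / real N) \<longlonglongrightarrow> 0"
  proof (rule Lim_transform_eventually)
    show "\<forall>\<^sub>F N in sequentially. E (a N) / real (a N) * (real (a N) / real N) = E (a N) / real N"
      by (intro always_eventually allI) (auto simp: E0)
  qed
  have "(\<lambda>N. \<bar>real (a N) / real N * M - M * t\<bar>) \<longlonglongrightarrow> \<bar>t * M - M * t\<bar>"
    by (intro tendsto_intros lima)
  with lim1 have lim: "(\<lambda>N. E (a N) / real N + \<bar>real (a N) / real N * M - M * t\<bar>) \<longlonglongrightarrow> 0"
    using tendsto_add[OF lim1] by (fastforce simp: mult.commute)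
  have "(\<integral>\<omega>. \<bar>clock \<xi> \<tau> (a N) \<omega> / real N - M * t\<bar> \<partial>P) \<le> E (a N) / real N + \<bar>real (a N) / real N * M - M * t\<bar>" for N
  proof -
    have "(\<integral>\<omega>. \<bar>clock \<xi> \<tau> (a N) \<omega> / real N - M * t\<bar> \<partial>P)
        \<le> (\<integral>\<omega>. \<bar>clock \<xi> \<tau> (a N) \<omega> - real (a N) * M\<bar> / real N + \<bar>real (a N) / real N * M - M * t\<bar> \<partial>P)"
    proof (rule integral_mono)
      fix \<omega>
      have "clock \<xi> \<tau> (a N) \<omega> / real N - M * t
          = (clock \<xi> \<tau> (a N) \<omega> - real (a N) * M) / real N + (real (a N) / real N * M - M * t)"
        by (simp add: diff_divide_distrib)
      then show "\<bar>clock \<xi> \<tau> (a N) \<omega> / real N - M * t\<bar>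
          \<le> \<bar>clock \<xi> \<tau> (a N) \<omega> - real (a N) * M\<bar> / real N + \<bar>real (a N) / real N * M - M * t\<bar>"
        by (simp only:) (rule order_trans[OF abs_triangle_ineq], simp add: abs_divide)
    qed ((intro integrable_abs Bochner_Integration.integrable_add Bochner_Integration.integrable_diff
        integrable_divide integrable_const integrable_clock; simp)+)
    also have "\<dots> = E (a N) / real N + \<bar>real (a N) / real N * M - M * t\<bar>"
      by (simp add: E_def integrable_clock prob_space)
    finally show ?thesis .
  qed
  then show ?thesis unfolding a_def[symmetric]
    by (intro tendsto_sandwich[OF _ _ tendsto_const lim]) (auto intro!: always_eventually)
qed

text \<open>Both the clock and its limit are monotone, so closeness at the points of a finite grid
  controls everything between; on the grid the bound in mean and a union bound suffice.\<close>

lemma scaled_clock_uniform: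
  assumes e: "0 < e"
  obtains E where "\<And>N. E N \<in> events" "(\<lambda>N. prob (E N)) \<longlonglongrightarrow> 1" "E 0 = {}"
    "\<And>N \<omega> t. \<lbrakk>\<omega> \<in> E N; 0 \<le> t; t \<le> T\<rbrakk> \<Longrightarrow> \<bar>clock_path N t \<omega> - M * t\<bar> \<le> e"
proof -
  \<comment> \<open>The limit grows by \<open>e / 2\<close> over one cell, which together with the
    error \<open>e / 2\<close> at the grid points gives \<open>e\<close>.\<close>
  define d where "d = e / (2 * M)"
  have d: "0 < d" "M * d = e / 2" using e M_pos by (auto simp: d_def)
  \<comment> \<open>One point more than the horizon requires, so that the right neighbour of every
    \<open>t \<le> T\<close> is on the grid.\<close>
  define J where "J = Suc (nat \<lceil>T / d\<rceil>)"
  define S where "S N t \<omega> = clock_path N t \<omega>" for N t \<omega>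
  have Sm: "S N t \<in> borel_measurable P" for N t
    unfolding S_def[abs_def] using measurable_clock by (intro borel_measurable_divide) auto
  define B where "B N j = {\<omega> \<in> space P. e / 2 \<le> \<bar>S N (real j * d) \<omega> - M * (real j * d)\<bar>}" for N j
  have Bev: "B N j \<in> events" for N j unfolding B_def using Sm[of N "real j * d"] by measurable
  \<comment> \<open>At \<open>N = 0\<close> the scaled clock is identically zero by division by
    zero. The empty event keeps the estimate valid for every \<open>N\<close>.\<close>
  define E where "E N = (if N = 0 then {} else space P - (\<Union>j\<le>J. B N j))" for N
  have Eev: "E N \<in> events" for N unfolding E_def using Bev by auto
  have Blim: "(\<lambda>N. prob (B N j)) \<longlonglongrightarrow> 0" for j
  proof -
    have jd: "0 \<le> real j * d" using d by simp
    have le: "prob (B N j) \<le> (\<integral>\<omega>. \<bar>S N (real j * d) \<omega> - M * (real j * d)\<bar> \<partial>P) / (e / 2)" for N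
      unfolding B_def
    proof (rule integral_Markov_inequality_measure[where A = "{}"])
      show "integrable P (\<lambda>\<omega>. \<bar>S N (real j * d) \<omega> - M * (real j * d)\<bar>)"
        unfolding S_def
        by (intro integrable_abs Bochner_Integration.integrable_diff integrable_divide integrable_clock) simp
    qed (use e in auto)
    have "(\<lambda>N. (\<integral>\<omega>. \<bar>S N (real j * d) \<omega> - M * (real j * d)\<bar> \<partial>P) / (e / 2)) \<longlonglongrightarrow> 0 / (e / 2)"
      unfolding S_def by (intro tendsto_intros scaled_clock_L1[OF jd]) (use e in simp)
    then have lim: "(\<lambda>N. (\<integral>\<omega>. \<bar>S N (real j * d) \<omega> - M * (real j * d)\<bar> \<partial>P) / (e / 2)) \<longlonglongrightarrow> 0" by simp
    show ?thesis
      by (rule tendsto_sandwich[OF _ _ tendsto_const lim]) (use le in \<open>auto intro!: always_eventually\<close>)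
  qed
  show thesis
  proof (rule that[of E])
    show "(\<lambda>N. prob (E N)) \<longlonglongrightarrow> 1"
    proof (rule tendsto_sandwich[OF _ _ _ tendsto_const])
      have "(\<lambda>N. 1 - (\<Sum>j\<le>J. prob (B N j))) \<longlonglongrightarrow> 1 - (\<Sum>j\<le>J. 0)"
        by (intro tendsto_intros Blim)
      then show "(\<lambda>N. 1 - (\<Sum>j\<le>J. prob (B N j))) \<longlonglongrightarrow> 1" by simp
      show "\<forall>\<^sub>F N in sequentially. 1 - (\<Sum>j\<le>J. prob (B N j)) \<le> prob (E N)"
        using eventually_gt_at_top[of 0]
      proof eventually_elim
        case (elim N)
        have "prob (\<Union>j\<le>J. B N j) \<le> (\<Sum>j\<le>J. prob (B N j))"
          by (rule finite_measure_subadditive_finite) (use Bev in auto)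
        moreover have "prob (E N) = 1 - prob (\<Union>j\<le>J. B N j)"
          using elim Bev by (simp add: E_def) (rule prob_compl, auto)
        ultimately show ?case by simp
      qed
    qed simp
    fix N \<omega> t assume \<omega>: "\<omega> \<in> E N" and t: "0 \<le> t" "t \<le> T"
    then have N: "0 < N" and sp: "\<omega> \<in> space P" by (auto simp: E_def split: if_splits)
    define j where "j = nat \<lfloor>t / d\<rfloor>"
    have j: "real j * d \<le> t" "t < real (Suc j) * d"
    proof -
      have "0 \<le> t / d" using t d by simp
      then have "real j \<le> t / d" "t / d < real j + 1" unfolding j_def by linarith+
      then show "real j * d \<le> t" "t < real (Suc j) * d"
        using d by (auto simp: pos_le_divide_eq pos_divide_less_eq add.commute)
    qed
    have "t / d \<le> T / d" using t d by (intro divide_right_mono) auto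
    then have "\<lfloor>t / d\<rfloor> \<le> \<lceil>T / d\<rceil>" by linarith
    then have jJ: "Suc j \<le> J" by (simp add: j_def J_def nat_mono)
    have grid: "\<bar>S N (real i * d) \<omega> - M * (real i * d)\<bar> < e / 2" if "i \<le> J" for i
      using \<omega> N that sp by (auto simp: E_def B_def not_le)
    have mono: "S N u \<omega> \<le> S N u' \<omega>" if "u \<le> u'" for u u'
    proof -
      have "real N * u \<le> real N * u'" using that by (intro mult_left_mono) auto
      then show ?thesis unfolding S_def
        by (intro divide_right_mono clock_mono[OF sp] nat_mono floor_mono) auto
    qed
    have "S N (real j * d) \<omega> \<le> S N t \<omega>" "S N t \<omega> \<le> S N (real (Suc j) * d) \<omega>"
      using j mono by (auto intro: less_imp_le)
    moreover have "M * (real (Suc j) * d) = M * (real j * d) + e / 2"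
      using d(2) by (simp add: algebra_simps)
    moreover have "M * (real j * d) \<le> M * t" "M * t \<le> M * (real (Suc j) * d)"
      using j M_pos by (auto intro!: mult_left_mono)
    ultimately have "\<bar>S N t \<omega> - M * t\<bar> \<le> e" using grid[of j] grid[of "Suc j"] jJ by linarith
    then show "\<bar>clock_path N t \<omega> - M * t\<bar> \<le> e" by (simp add: S_def)
  qed (rule Eev, simp add: E_def)
qed

text \<open>A clock bounded by \<open>K\<close> is incompatible with the event \<open>E N\<close>
  once \<open>N\<close> exceeds \<open>2 * K / M\<close>, because there the clock at
  \<open>N\<close> is at least \<open>N * M / 2\<close>. As the probability of \<open>E N\<close>
  tends to 1, bounded clocks have probability zero.\<close>

lemma clock_unbounded: "AE \<omega> in P. \<forall>K. \<exists>n. K < clock \<xi> \<tau> n \<omega>"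
proof -
  have "0 < M / 2" using M_pos by simp
  from scaled_clock_uniform[OF this, of 1]
  obtain E where E: "\<And>N. E N \<in> events" "(\<lambda>N. prob (E N)) \<longlonglongrightarrow> 1" "E 0 = {}"
    "\<And>N \<omega> t. \<lbrakk>\<omega> \<in> E N; 0 \<le> t; t \<le> 1\<rbrakk> \<Longrightarrow> \<bar>clock_path N t \<omega> - M * t\<bar> \<le> M / 2"
    by metis
  have "AE \<omega> in P. \<exists>n. real K < clock \<xi> \<tau> n \<omega>" for K :: nat
  proof -
    let ?B = "{\<omega> \<in> space P. \<forall>n. clock \<xi> \<tau> n \<omega> \<le> real K}"
    have Bev: "?B \<in> events" using measurable_clock by measurable
    have "\<forall>\<^sub>F N in sequentially. prob ?B \<le> 1 - prob (E N)"
      using eventually_gt_at_top[of "nat \<lceil>real K / (M / 2)\<rceil>"]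
    proof eventually_elim
      case (elim N)
      then have "real K / (M / 2) < real N" by linarith
      then have big: "real K < real N * (M / 2)" using M_pos by (simp add: pos_divide_less_eq)
      have "?B \<subseteq> space P - E N"
      proof safe
        fix \<omega> assume \<omega>: "\<omega> \<in> E N" "\<forall>n. clock \<xi> \<tau> n \<omega> \<le> real K"
        have N: "0 < real N" using elim by simp
        have "\<bar>clock \<xi> \<tau> N \<omega> / real N - M\<bar> \<le> M / 2" using E(4)[OF \<omega>(1), of 1] by simp
        then have "M / 2 \<le> clock \<xi> \<tau> N \<omega> / real N" by linarith
        then have "real N * (M / 2) \<le> clock \<xi> \<tau> N \<omega>" using N by (simp add: pos_le_divide_eq mult.commute)
        then show False using big \<omega>(2) by (meson leD order_trans)
      qed
      then have "prob ?B \<le> prob (space P - E N)" using E(1) by (intro finite_measure_mono) auto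
      then show ?case using E(1) by (simp add: prob_compl)
    qed
    moreover have "(\<lambda>N. 1 - prob (E N)) \<longlonglongrightarrow> 1 - 1" by (intro tendsto_intros E(2))
    ultimately have "prob ?B \<le> 1 - 1" by (intro tendsto_lowerbound) auto
    then have "prob ?B = 0" using measure_nonneg[of P ?B] by simp
    then have "?B \<in> null_sets P" using Bev by (simp add: null_sets_def emeasure_eq_measure)
    then have "AE \<omega> in P. \<omega> \<notin> ?B" by (rule AE_not_in)
    then show ?thesis using AE_space by eventually_elim (auto simp: not_le)
  qed
  then have "AE \<omega> in P. \<forall>K :: nat. \<exists>n. real K < clock \<xi> \<tau> n \<omega>" by (simp add: AE_all_countable)
  then show ?thesis
  proof eventually_elim
    case (elim \<omega>)
    show ?case
    proof
      fix K :: real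
      obtain k :: nat where "K \<le> real k" using real_arch_simple by blast
      then show "\<exists>n. K < clock \<xi> \<tau> n \<omega>" using elim by (meson le_less_trans)
    qed
  qed
qed

section \<open>Measurable versions and convergence of the paths\<close>

lemma clock_in_partition_times:
  "AE \<omega> in P. (\<lambda>k. clock \<xi> \<tau> k \<omega>) \<in> partition_times"
  using clock_unbounded AE_space
  by eventually_elim (auto simp: partition_times_def clock_0 clock_strict_mono)

text \<open>The scaled clock is a step function with deterministic breakpoints \<open>k / N\<close>
  and random values.\<close>

lemma scaled_clock_version:
  "\<exists>Z. Z \<in> P \<rightarrow>\<^sub>M borel_of J1_topology \<and> (AE \<omega> in P. Z \<omega> = scaled_clock \<xi> \<tau> N \<omega>)"
proof (cases "N = 0")
  case True
  have "(\<lambda>t\<in>{0..}. 0 :: real) \<in> skorohod_space"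
    using continuous_in_skorohod_space[of "\<lambda>_. 0 :: real"] by simp
  then show ?thesis using True
    by (intro exI[of _ "\<lambda>_. \<lambda>t\<in>{0..}. 0"]) (simp add: scaled_clock_def)
next
  case False
  have "real \<in> partition_times"
    by (auto simp: partition_times_def strict_mono_def reals_Archimedean2)
  then have part: "(\<lambda>k. real k / real N) \<in> partition_times"
    using False by (intro scaled_partition_times) auto
  have "step_fun (\<lambda>k. real k / real N) (\<lambda>k. clock \<xi> \<tau> k \<omega> / real N) = scaled_clock \<xi> \<tau> N \<omega>" for \<omega>
  proof (rule extensionalityI[of _ "{0..}"])
    fix t :: real assume "t \<in> {0..}"
    then have t: "0 \<le> t" by simp
    let ?k = "nat \<lfloor>real N * t\<rfloor>"
    have "real ?k \<le> real N * t" "real N * t < real ?k + 1" using t by (auto simp: of_nat_floor)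
    then have "real ?k / real N \<le> t" "t < real (Suc ?k) / real N"
      using False by (auto simp: pos_divide_le_eq pos_less_divide_eq mult.commute add.commute)
    then show "step_fun (\<lambda>k. real k / real N) (\<lambda>k. clock \<xi> \<tau> k \<omega> / real N) t = scaled_clock \<xi> \<tau> N \<omega> t"
      using step_fun_eq[OF part, of ?k t] t by (simp add: scaled_clock_def)
  qed (auto simp: step_fun_def scaled_clock_def)
  moreover have "\<exists>Z. Z \<in> P \<rightarrow>\<^sub>M borel_of J1_topology \<and>
      (AE \<omega> in P. Z \<omega> = step_fun (\<lambda>k. real k / real N) (\<lambda>k. clock \<xi> \<tau> k \<omega> / real N))"
    using part measurable_clock by (intro measurable_step_fun) (auto intro!: borel_measurable_divide)
  ultimately show ?thesis by simp
qed

text \<open>The scaled clock is the identity path run along the scaled clock.\<close>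
lemma scaled_clock_converges:
  "converges_in_distribution J1_topology P (scaled_clock \<xi> \<tau>) P (\<lambda>\<omega>. \<lambda>t\<in>{0..}. M * t)"
proof -
  let ?id = "\<lambda>t\<in>{0..}. t :: real"
  have id: "?id \<in> skorohod_space" "continuous_on {0..} ?id"
    by (rule continuous_in_skorohod_space[OF continuous_on_id]) (rule continuous_on_eq[OF continuous_on_id], simp)
  have nonneg: "0 \<le> clock \<xi> \<tau> n \<omega>" if "\<omega> \<in> space P" for n \<omega>
    using clock_mono[OF that, of 0 n] by (simp add: clock_0)
  have "converges_in_distribution J1_topology P (scaled_clock \<xi> \<tau>) P (\<lambda>\<omega>. \<lambda>t\<in>{0..}. ?id (M * t))"
  proof (rule converges_in_distribution_time_change[OF prob_space_axioms prob_space_axioms M_pos _ _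
        scaled_clock_version, where V = "\<lambda>_ _. ?id"
        and v = "\<lambda>N \<omega> t. clock_path N t \<omega>"])
    show "converges_in_distribution J1_topology P (\<lambda>_ _. ?id) P (\<lambda>_. ?id)"
      unfolding converges_in_distribution_def using id(1)
      by (intro exI[of _ "\<lambda>_ _. ?id"] exI[of _ "\<lambda>_. ?id"]) auto
    show "AE \<omega> in P. scaled_clock \<xi> \<tau> N \<omega> = (\<lambda>t\<in>{0..}. ?id (clock_path N t \<omega>))
        \<and> (\<forall>t\<ge>0. 0 \<le> clock_path N t \<omega>)" for N
      using nonneg by (intro AE_I2) (auto simp: scaled_clock_def intro!: restrict_ext)
    fix T e :: real assume "0 < e"
    then have "0 < e / 2" by simp
    from scaled_clock_uniform[OF this, of T]
    obtain E where E: "\<And>N. E N \<in> events" "(\<lambda>N. prob (E N)) \<longlonglongrightarrow> 1"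
      "\<And>N \<omega> t. \<lbrakk>\<omega> \<in> E N; 0 \<le> t; t \<le> T\<rbrakk> \<Longrightarrow> \<bar>clock_path N t \<omega> - M * t\<bar> \<le> e / 2"
      by metis
    then show "\<exists>E. (\<forall>N. E N \<in> events) \<and> (\<lambda>N. prob (E N)) \<longlonglongrightarrow> 1 \<and>
        (\<forall>N. \<forall>\<omega>\<in>E N. \<forall>t\<in>{0..T}. \<bar>clock_path N t \<omega> - M * t\<bar> < e)"
      using \<open>0 < e\<close> by (intro exI[of _ E]) (auto intro!: order_le_less_trans[OF E(3)])
  qed (use id(2) in auto)
  moreover have "(\<lambda>t\<in>{0..}. ?id (M * t)) = (\<lambda>t\<in>{0..}. M * t)" using M_pos by (intro restrict_ext) simp
  ultimately show ?thesis by simp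
qed

text \<open>Here the breakpoints are random, namely the scaled clock values, and they exhaust the
  half-line only almost surely.\<close>

lemma scaled_rtrw_version:
  "\<exists>Z. Z \<in> P \<rightarrow>\<^sub>M borel_of J1_topology \<and> (AE \<omega> in P. Z \<omega> = scaled_rtrw \<xi> \<tau> A N \<omega>)"
proof (cases "N = 0")
  case True
  have "(\<lambda>t\<in>{0..}. 0 :: real ^ 'd) \<in> skorohod_space"
    using continuous_in_skorohod_space[of "\<lambda>_. 0 :: real ^ 'd"] by simp
  then show ?thesis using True
    by (intro exI[of _ "\<lambda>_. \<lambda>t\<in>{0..}. 0"]) (simp add: scaled_rtrw_def)
next
  case False
  let ?s = "\<lambda>k \<omega>. clock \<xi> \<tau> k \<omega> / real N"
  let ?y = "\<lambda>k \<omega>. (1 / sqrt (real N)) *\<^sub>R (A *v real_vec (walk \<xi> k \<omega>))"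
  have part: "AE \<omega> in P. (\<lambda>k. ?s k \<omega>) \<in> partition_times"
    using clock_in_partition_times by eventually_elim (use False in \<open>auto intro: scaled_partition_times\<close>)
  have "\<exists>Z. Z \<in> P \<rightarrow>\<^sub>M borel_of J1_topology \<and> (AE \<omega> in P. Z \<omega> = step_fun (\<lambda>k. ?s k \<omega>) (\<lambda>k. ?y k \<omega>))"
  proof (rule measurable_step_fun[OF _ _ part])
    show "?s k \<in> borel_measurable P" for k using measurable_clock by (intro borel_measurable_divide) auto
    show "?y k \<in> borel_measurable P" for k by (rule measurable_compose[OF measurable_walk]) simp
  qed
  then obtain Z where Z: "Z \<in> P \<rightarrow>\<^sub>M borel_of J1_topology"
    "AE \<omega> in P. Z \<omega> = step_fun (\<lambda>k. ?s k \<omega>) (\<lambda>k. ?y k \<omega>)" by blast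
  have "AE \<omega> in P. Z \<omega> = scaled_rtrw \<xi> \<tau> A N \<omega>"
    using Z(2) clock_in_partition_times part
  proof eventually_elim
    case (elim \<omega>)
    have "step_fun (\<lambda>k. ?s k \<omega>) (\<lambda>k. ?y k \<omega>) t = scaled_rtrw \<xi> \<tau> A N \<omega> t" for t
    proof (cases "0 \<le> t")
      case True
      then have "0 \<le> real N * t" by simp
      note ci = clock_inverse[OF elim(2) this]
      let ?k = "clock_inverse (real N * t) \<omega>"
      have "?s ?k \<omega> \<le> t" "t < ?s (Suc ?k) \<omega>"
        using ci False by (auto simp: pos_divide_le_eq pos_less_divide_eq mult.commute)
      then show ?thesis using step_fun_eq[OF elim(3), of ?k t] True by (simp add: scaled_rtrw_def rtrw_eq)
    qed (simp add: step_fun_def scaled_rtrw_def)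
    then show ?case using elim(1) by auto
  qed
  then show ?thesis using Z(1) by blast
qed

text \<open>For the inverse clock \<open>k\<close> at time \<open>N * t\<close>, the scaled clock is
  at most \<open>t\<close> at \<open>k\<close> and above \<open>t\<close> at \<open>Suc k\<close>.
  Replacing the clock by its linear limit confines \<open>k / N\<close> to a neighbourhood of
  \<open>t / M\<close> of size \<open>\<eta> / M + 1 / N\<close>.\<close>

lemma clock_inverse_uniform:
  assumes e: "0 < e"
  shows "\<exists>E. (\<forall>N. E N \<in> events) \<and> (\<lambda>N. prob (E N)) \<longlonglongrightarrow> 1 \<and>
    (\<forall>N. \<forall>\<omega>\<in>E N. \<forall>t\<in>{0..T}. \<bar>real (clock_inverse (real N * t) \<omega>) / real N - inverse M * t\<bar> < e)"
proof -
  \<comment> \<open>\<open>\<eta> / M\<close> is at most \<open>e / 4\<close> and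
    \<open>1 / N\<close> will be below \<open>e / 2\<close>, in total less than \<open>e\<close>;
    \<open>\<eta> \<le> 1\<close> serves the horizon \<open>R\<close>.\<close>
  define \<eta> where "\<eta> = min 1 (M * e / 4)"
  have \<eta>: "0 < \<eta>" "\<eta> \<le> 1" "\<eta> / M \<le> e / 4"
    using e M_pos by (auto simp: \<eta>_def pos_divide_le_eq min_le_iff_disj mult.commute)
  \<comment> \<open>An a priori bound for \<open>k / N\<close>: at \<open>R\<close> the limit has
    reached \<open>\<bar>T\<bar> + 2\<close>, so the clock has passed \<open>T\<close> despite an
    error of 1. The estimate is requested up to \<open>R + 1\<close> to include
    \<open>Suc k\<close>.\<close>
  define R where "R = (\<bar>T\<bar> + 2) / M"
  have R: "0 \<le> R" "M * R = \<bar>T\<bar> + 2" using M_pos by (auto simp: R_def)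
  obtain E where E: "\<And>N. E N \<in> events" "(\<lambda>N. prob (E N)) \<longlonglongrightarrow> 1" "E 0 = {}"
    "\<And>N \<omega> t. \<lbrakk>\<omega> \<in> E N; 0 \<le> t; t \<le> R + 1\<rbrakk> \<Longrightarrow> \<bar>clock_path N t \<omega> - M * t\<bar> \<le> \<eta>"
    using scaled_clock_uniform[OF \<eta>(1), of "R + 1"] by metis
  obtain G where G: "G \<in> null_sets P" "{\<omega> \<in> space P. (\<lambda>k. clock \<xi> \<tau> k \<omega>) \<notin> partition_times} \<subseteq> G"
    using clock_in_partition_times by (auto elim!: AE_E intro: null_setsI)
  \<comment> \<open>For small \<open>N\<close> the discretisation error \<open>1 / N\<close> is too
    large and the event is empty. \<open>N = 0\<close> passes this test by division by zero, but
    \<open>E 0\<close> is empty already.\<close>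
  define E' where "E' N = (if 1 / real N < e / 2 then E N - G else {})" for N
  have "\<forall>N. E' N \<in> events" using E(1) G(1) by (auto simp: E'_def)
  moreover have "(\<lambda>N. prob (E' N)) \<longlonglongrightarrow> 1"
  proof (rule Lim_transform_eventually[OF E(2)])
    have "\<forall>\<^sub>F N in sequentially. 1 / real N < e / 2"
      using e by (intro order_tendstoD(2)[OF lim_const_over_n]) simp
    then show "\<forall>\<^sub>F N in sequentially. prob (E N) = prob (E' N)"
      by eventually_elim (simp add: E'_def measure_Diff_null_set[OF E(1) G(1)])
  qed
  moreover have "\<bar>real (clock_inverse (real N * t) \<omega>) / real N - inverse M * t\<bar> < e"
    if \<omega>: "\<omega> \<in> E' N" and t: "t \<in> {0..T}" for N \<omega> t
  proof -
    have \<omega>E: "\<omega> \<in> E N" "\<omega> \<notin> G" and Ne: "1 / real N < e / 2" using \<omega> by (auto simp: E'_def split: if_splits)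
    then have N: "0 < real N" using E(3) by (cases "N = 0") auto
    have sp: "\<omega> \<in> space P" using \<omega>E(1) sets.sets_into_space[OF E(1)] by blast
    then have part: "(\<lambda>k. clock \<xi> \<tau> k \<omega>) \<in> partition_times" using G(2) \<omega>E by blast
    define k where "k = clock_inverse (real N * t) \<omega>"
    have "0 \<le> real N * t" using t by simp
    from clock_inverse[OF part this]
    have k: "clock \<xi> \<tau> k \<omega> / real N \<le> t" "t < clock \<xi> \<tau> (Suc k) \<omega> / real N"
      using N by (auto simp: k_def pos_divide_le_eq pos_less_divide_eq mult.commute)
    have fl: "nat \<lfloor>real N * (real n / real N)\<rfloor> = n" for n using N by simp
    have kR: "real k / real N \<le> R"
    proof (rule ccontr)
      assume "\<not> ?thesis"
      then have "real N * R \<le> real k" using N by (simp add: not_le pos_less_divide_eq mult.commute less_imp_le)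
      then have "nat \<lfloor>real N * R\<rfloor> \<le> k" by linarith
      then have "clock \<xi> \<tau> (nat \<lfloor>real N * R\<rfloor>) \<omega> / real N \<le> clock \<xi> \<tau> k \<omega> / real N"
        using N by (intro divide_right_mono clock_mono[OF sp]) auto
      moreover have "\<bar>clock \<xi> \<tau> (nat \<lfloor>real N * R\<rfloor>) \<omega> / real N - M * R\<bar> \<le> \<eta>"
        using R by (intro E(4)[OF \<omega>E(1)]) auto
      ultimately show False using k(1) R(2) \<eta>(2) t by auto
    qed
    have "\<bar>clock \<xi> \<tau> k \<omega> / real N - M * (real k / real N)\<bar> \<le> \<eta>"
      using E(4)[OF \<omega>E(1), of "real k / real N"] kR unfolding fl by simp
    then have up: "M * (real k / real N) \<le> t + \<eta>" using k(1) by linarith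
    have Suc_k: "real (Suc k) / real N = real k / real N + 1 / real N" by (simp add: add_divide_distrib)
    moreover have "1 / real N \<le> 1" using N by simp
    ultimately have "\<bar>clock \<xi> \<tau> (Suc k) \<omega> / real N - M * (real (Suc k) / real N)\<bar> \<le> \<eta>"
      using E(4)[OF \<omega>E(1), of "real (Suc k) / real N"] kR unfolding fl by simp
    then have lo: "t - \<eta> \<le> M * (real k / real N + 1 / real N)"
      using k(2) unfolding Suc_k by linarith
    have "real k / real N \<le> (t + \<eta>) / M" using up M_pos by (simp add: pos_le_divide_eq mult.commute)
    moreover have "(t - \<eta>) / M \<le> real k / real N + 1 / real N"
      using lo M_pos by (simp add: pos_divide_le_eq mult.commute)
    ultimately have "\<bar>real k / real N - t / M\<bar> < e"
      using \<eta>(3) Ne e unfolding add_divide_distrib diff_divide_distrib by linarith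
    then show ?thesis by (simp add: k_def field_simps)
  qed
  ultimately show ?thesis by (intro exI[of _ E']) blast
qed

text \<open>The time change theorem with the inverse clock as random time change and
  \<open>c = inverse M\<close>; the continuity of the limit paths comes from Brownian
  motion.\<close>

lemma scaled_rtrw_converges:
  fixes W :: "'v measure"
  assumes bm: "standard_brownian_motion W B"
    and conv: "converges_in_distribution J1_topology P (scaled_walk \<xi> A) W (\<lambda>\<omega>. \<lambda>t\<in>{0..}. B t \<omega>)"
  shows "converges_in_distribution J1_topology P (scaled_rtrw \<xi> \<tau> A) W (\<lambda>\<omega>. \<lambda>t\<in>{0..}. B (inverse M * t) \<omega>)"
proof -
  interpret bm: standard_brownian_motion W B by (rule bm)
  have "converges_in_distribution J1_topology P (scaled_rtrw \<xi> \<tau> A) W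
      (\<lambda>\<omega>. \<lambda>t\<in>{0..}. (\<lambda>t\<in>{0..}. B t \<omega>) (inverse M * t))"
  proof (rule converges_in_distribution_time_change[OF prob_space_axioms bm.prob_space_axioms _ conv _
        scaled_rtrw_version _ clock_inverse_uniform])
    show "0 < inverse M" using M_pos by simp
    show "AE \<omega> in W. continuous_on {0..} (\<lambda>t\<in>{0..}. B t \<omega>)"
      using bm.continuous_paths
    proof eventually_elim
      case (elim \<omega>)
      then show ?case by (rule continuous_on_eq) simp
    qed
    show "AE \<omega> in P. scaled_rtrw \<xi> \<tau> A N \<omega>
        = (\<lambda>t\<in>{0..}. scaled_walk \<xi> A N \<omega> (real (clock_inverse (real N * t) \<omega>) / real N))
        \<and> (\<forall>t\<ge>0. 0 \<le> real (clock_inverse (real N * t) \<omega>) / real N)" for N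
      by (intro AE_I2 conjI scaled_rtrw_eq_time_change) simp
  qed
  moreover have "(\<lambda>t\<in>{0..}. (\<lambda>t\<in>{0..}. B t \<omega>) (inverse M * t)) = (\<lambda>t\<in>{0..}. B (inverse M * t) \<omega>)" for \<omega>
    using M_pos by (intro restrict_ext) simp
  ultimately show ?thesis by simp
qed

end

end

theorem theorem1p3:
  fixes P :: "'w measure"
    and \<nu> :: "(int ^ 'd) pmf"
    and \<mu> :: "real measure measure"
    and \<pi> :: "int ^ 'd \<Rightarrow> 'w \<Rightarrow> real measure"
    and \<xi> :: "nat \<Rightarrow> 'w \<Rightarrow> int ^ 'd"
    and \<tau> :: "int ^ 'd \<Rightarrow> nat \<Rightarrow> 'w \<Rightarrow> real"
    and M :: real
    and A :: "real ^ 'd ^ 'd"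
    and W :: "'v measure"
    and B :: "real \<Rightarrow> 'v \<Rightarrow> real ^ 'd"
  assumes "randomly_trapped_random_walk P \<nu> \<mu> \<pi> \<xi> \<tau>"
    and "\<nu> \<noteq> return_pmf 0"
    and "(\<integral>\<^sup>+\<omega>. (\<integral>\<^sup>+u. ennreal u \<partial>(\<pi> 0 \<omega>)) \<partial>P) = ennreal M"
  shows "converges_in_distribution J1_topology P (scaled_clock \<xi> \<tau>) P (\<lambda>\<omega>. \<lambda>t\<in>{0..}. M * t)
    \<and> (genuinely_full_dimensional \<nu>
       \<and> (\<integral>\<omega>. real_vec (walk \<xi> 1 \<omega>) \<partial>P) = 0
       \<and> (\<exists>C. measure P {\<omega> \<in> space P. norm (real_vec (walk \<xi> 1 \<omega>)) > C} = 0)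
       \<and> standard_brownian_motion W B
       \<and> converges_in_distribution J1_topology P (scaled_walk \<xi> A) W (\<lambda>\<omega>. \<lambda>t\<in>{0..}. B t \<omega>)
       \<longrightarrow> converges_in_distribution J1_topology P (scaled_rtrw \<xi> \<tau> A)
             W (\<lambda>\<omega>. \<lambda>t\<in>{0..}. B (inverse M * t) \<omega>))"
proof (intro conjI impI)
  interpret randomly_trapped_random_walk P \<nu> \<mu> \<pi> \<xi> \<tau> by fact
  show "converges_in_distribution J1_topology P (scaled_clock \<xi> \<tau>) P (\<lambda>\<omega>. \<lambda>t\<in>{0..}. M * t)"
    by (rule scaled_clock_converges) fact+
  show "converges_in_distribution J1_topology P (scaled_rtrw \<xi> \<tau> A) W (\<lambda>\<omega>. \<lambda>t\<in>{0..}. B (inverse M * t) \<omega>)"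
    if "genuinely_full_dimensional \<nu>
       \<and> (\<integral>\<omega>. real_vec (walk \<xi> 1 \<omega>) \<partial>P) = 0
       \<and> (\<exists>C. measure P {\<omega> \<in> space P. norm (real_vec (walk \<xi> 1 \<omega>)) > C} = 0)
       \<and> standard_brownian_motion W B
       \<and> converges_in_distribution J1_topology P (scaled_walk \<xi> A) W (\<lambda>\<omega>. \<lambda>t\<in>{0..}. B t \<omega>)"
    using that by (intro scaled_rtrw_converges[OF assms(2,3)]) auto
qed

end
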